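(* Let $M$ be a ${\rm II}_1$ factor with trace $\tau$ and let $X,Y\subset M\ominus\mathbb C1$ be finite sets. Then there exists a unitary $u\in\mathscr U(M)$ such that $uXu^*$ and $Y$ are orthogonal, i.e., $\tau(y^*uxu^* )=0$ for all $x\in X$ and $y\in Y$.
   Context: $M\ominus\mathbb C1=\{x\in M:\tau(x)=0\}$. *)

theory Defs
  imports "HOL-Analysis.Analysis" "HOL-Library.Function_Algebras"
begin

text \<open>Concrete model of von Neumann algebras: a complex Hilbert space is a type 'h
(an abelian group) with a complex scalar multiplication sc and an inner product ip
(conjugate-linear in the first, linear in the second argument), complete for the
induced norm.  Operators are functions 'h => 'h.\<close>

definition hnorm :: "('h \<Rightarrow> 'h \<Rightarrow> complex) \<Rightarrow> 'h \<Rightarrow> real" where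
  "hnorm ip x = sqrt (Re (ip x x))"

definition complex_hilbert ::
  "(complex \<Rightarrow> 'h::ab_group_add \<Rightarrow> 'h) \<Rightarrow> ('h \<Rightarrow> 'h \<Rightarrow> complex) \<Rightarrow> bool" where
  "complex_hilbert sc ip \<longleftrightarrow>
     vector_space sc \<and>
     (\<forall>x y. ip x y = cnj (ip y x)) \<and>
     (\<forall>x y z. ip x (y + z) = ip x y + ip x z) \<and>
     (\<forall>x y c. ip x (sc c y) = c * ip x y) \<and>
     (\<forall>x. 0 \<le> Re (ip x x)) \<and>
     (\<forall>x. ip x x = 0 \<longrightarrow> x = 0) \<and>
     (\<forall>X :: nat \<Rightarrow> 'h.
        (\<forall>e>0. \<exists>N. \<forall>m\<ge>N. \<forall>n\<ge>N. hnorm ip (X m - X n) < e) \<longrightarrow>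
        (\<exists>L. (\<lambda>n. hnorm ip (X n - L)) \<longlonglongrightarrow> 0))"

definition bounded_op ::
  "(complex \<Rightarrow> 'h::ab_group_add \<Rightarrow> 'h) \<Rightarrow> ('h \<Rightarrow> 'h \<Rightarrow> complex) \<Rightarrow> ('h \<Rightarrow> 'h) \<Rightarrow> bool" where
  "bounded_op sc ip T \<longleftrightarrow>
     (\<forall>x y. T (x + y) = T x + T y) \<and> (\<forall>c x. T (sc c x) = sc c (T x)) \<and>
     (\<exists>K. \<forall>x. hnorm ip (T x) \<le> K * hnorm ip x)"

definition adj :: "('h \<Rightarrow> 'h \<Rightarrow> complex) \<Rightarrow> ('h \<Rightarrow> 'h) \<Rightarrow> ('h \<Rightarrow> 'h)" where
  "adj ip T = (\<lambda>y. THE z. \<forall>x. ip z x = ip y (T x))"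

definition commutant ::
  "(complex \<Rightarrow> 'h::ab_group_add \<Rightarrow> 'h) \<Rightarrow> ('h \<Rightarrow> 'h \<Rightarrow> complex) \<Rightarrow> ('h \<Rightarrow> 'h) set \<Rightarrow> ('h \<Rightarrow> 'h) set" where
  "commutant sc ip S = {T. bounded_op sc ip T \<and> (\<forall>A\<in>S. T \<circ> A = A \<circ> T)}"

definition von_neumann_algebra ::
  "(complex \<Rightarrow> 'h::ab_group_add \<Rightarrow> 'h) \<Rightarrow> ('h \<Rightarrow> 'h \<Rightarrow> complex) \<Rightarrow> ('h \<Rightarrow> 'h) set \<Rightarrow> bool" where
  "von_neumann_algebra sc ip M \<longleftrightarrow>
     M \<subseteq> {T. bounded_op sc ip T} \<and> (\<forall>T\<in>M. adj ip T \<in> M) \<and>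
     commutant sc ip (commutant sc ip M) = M"

definition vN_factor ::
  "(complex \<Rightarrow> 'h::ab_group_add \<Rightarrow> 'h) \<Rightarrow> ('h \<Rightarrow> 'h \<Rightarrow> complex) \<Rightarrow> ('h \<Rightarrow> 'h) set \<Rightarrow> bool" where
  "vN_factor sc ip M \<longleftrightarrow> von_neumann_algebra sc ip M \<and>
     M \<inter> commutant sc ip M = {T. \<exists>c. T = (\<lambda>x. sc c x)}"

definition op_scale :: "(complex \<Rightarrow> 'h \<Rightarrow> 'h) \<Rightarrow> complex \<Rightarrow> ('h \<Rightarrow> 'h) \<Rightarrow> ('h \<Rightarrow> 'h)" where
  "op_scale sc c T = (\<lambda>x. sc c (T x))"

definition infinite_dimensional ::
  "(complex \<Rightarrow> 'h::ab_group_add \<Rightarrow> 'h) \<Rightarrow> ('h \<Rightarrow> 'h) set \<Rightarrow> bool" where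
  "infinite_dimensional sc M \<longleftrightarrow>
     (\<forall>B. finite B \<longrightarrow> B \<subseteq> M \<longrightarrow> \<not> M \<subseteq> module.span (op_scale sc) B)"

definition contraction :: "('h \<Rightarrow> 'h \<Rightarrow> complex) \<Rightarrow> ('h \<Rightarrow> 'h) \<Rightarrow> bool" where
  "contraction ip T \<longleftrightarrow> (\<forall>x. hnorm ip (T x) \<le> hnorm ip x)"

text \<open>Faithful normal tracial state on M.  Normality is expressed as continuity on
the unit ball of M for the weak operator topology (convergence along arbitrary filters).\<close>
definition faithful_normal_tracial_state ::
  "(complex \<Rightarrow> 'h::ab_group_add \<Rightarrow> 'h) \<Rightarrow> ('h \<Rightarrow> 'h \<Rightarrow> complex) \<Rightarrow> ('h \<Rightarrow> 'h) set
     \<Rightarrow> (('h \<Rightarrow> 'h) \<Rightarrow> complex) \<Rightarrow> bool" where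
  "faithful_normal_tracial_state sc ip M \<tau> \<longleftrightarrow>
     (\<forall>S\<in>M. \<forall>T\<in>M. \<tau> (S + T) = \<tau> S + \<tau> T) \<and>
     (\<forall>c. \<forall>T\<in>M. \<tau> (op_scale sc c T) = c * \<tau> T) \<and>
     (\<forall>T\<in>M. Im (\<tau> (adj ip T \<circ> T)) = 0 \<and> 0 \<le> Re (\<tau> (adj ip T \<circ> T))) \<and>
     \<tau> id = 1 \<and>
     (\<forall>S\<in>M. \<forall>T\<in>M. \<tau> (S \<circ> T) = \<tau> (T \<circ> S)) \<and>
     (\<forall>T\<in>M. \<tau> (adj ip T \<circ> T) = 0 \<longrightarrow> T = 0) \<and>
     (\<forall>(F :: ('h \<Rightarrow> 'h) filter) x. x \<in> M \<longrightarrow> contraction ip x \<longrightarrow>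
        eventually (\<lambda>T. T \<in> M \<and> contraction ip T) F \<longrightarrow>
        (\<forall>\<xi> \<eta>. ((\<lambda>T. ip \<eta> (T \<xi>)) \<longlongrightarrow> ip \<eta> (x \<xi>)) F) \<longrightarrow>
        (\<tau> \<longlongrightarrow> \<tau> x) F)"

definition II1_factor ::
  "(complex \<Rightarrow> 'h::ab_group_add \<Rightarrow> 'h) \<Rightarrow> ('h \<Rightarrow> 'h \<Rightarrow> complex) \<Rightarrow> ('h \<Rightarrow> 'h) set
     \<Rightarrow> (('h \<Rightarrow> 'h) \<Rightarrow> complex) \<Rightarrow> bool" where
  "II1_factor sc ip M \<tau> \<longleftrightarrow> complex_hilbert sc ip \<and> vN_factor sc ip M \<and>
     infinite_dimensional sc M \<and> faithful_normal_tracial_state sc ip M \<tau>"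

definition unitary_in ::
  "('h \<Rightarrow> 'h \<Rightarrow> complex) \<Rightarrow> ('h \<Rightarrow> 'h) set \<Rightarrow> ('h \<Rightarrow> 'h) \<Rightarrow> bool" where
  "unitary_in ip M u \<longleftrightarrow> u \<in> M \<and> adj ip u \<circ> u = id \<and> u \<circ> adj ip u = id"

end

theory Submission
  imports Defs
begin

text \<open>
  The unitary is exhausted by partial isometries \<open>v\<close> satisfying \<open>\<tau>(y v x v\<^sup>*) = 0\<close> and \<open>\<tau>(y v v\<^sup>*) = 0\<close> exactly.
  A block \<open>w\<close> is added to \<open>v\<close> as follows. Below \<open>1 - v\<^sup>* v\<close> there is a nonzero projection \<open>r\<close> with \<open>r x r\<close> scalar for
  every \<open>x\<close>, since an indefinite self-adjoint element has isotropic vectors over a factor. By a Lyapunov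
  argument there is a projection \<open>q\<close> below \<open>1 - v v\<^sup>*\<close> with \<open>\<tau>(y q) = 0\<close> and small trace, and comparison gives a partial
  isometry \<open>w\<close> from a part of \<open>r\<close> onto \<open>q\<close>; the term \<open>\<tau>(y w x w\<^sup>*)\<close> is a multiple of \<open>\<tau>(y q) = 0\<close>.
  Replacing \<open>w\<close> by \<open>w \<epsilon>\<close> with a symmetry \<open>\<epsilon>\<close> changes only the cross terms, which are linear in \<open>\<epsilon>\<close>, and by
  Lyapunov again finitely many linear conditions \<open>\<tau>(\<epsilon> b) = 0\<close> can be met.
\<close>

section \<open>Algebras with a faithful trace\<close>

text \<open>The zero conditions are kept exactly rather than up to an error, so nothing has to be
  corrected at the end. The price is that every new range projection must be annihilated by all
  functionals from \<open>Y\<close>. Halving a projection only yields values proportional to those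
  of the ambient projection, so this needs \<open>\<tau> (y * (1 - v * star v)) = 0\<close>. The
  condition on \<open>y * (v * star v)\<close> is carried along for that reason: with
  \<open>\<tau> y = 0\<close> it passes to the complement. The size of \<open>r\<close> is not
  controlled, so \<open>q\<close> has to be small; dyadic fractions suffice for that, and Lyapunov
  convexity is needed only as halving. Maximality is measured by the trace, a bounded real quantity,
  so sequences take the place of transfinite chains. The abstract part has no operator norm, order
  or spectral calculus; faithfulness of the trace turns \<open>star A * A = 0\<close> into
  \<open>A = 0\<close>. A fourth root is used instead of a square root because an absolute value
  \<open>c * c\<close> with \<open>c\<close> self-adjoint satisfies
  \<open>star V * (c * c) * V = star (c * V) * (c * V)\<close>.\<close>

lemma exhaustion:
  fixes R :: "'b \<Rightarrow> 'b \<Rightarrow> bool" and \<mu> :: "'b \<Rightarrow> real"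
  assumes z0: "z0 \<in> Z"
    and refl: "\<And>z. z \<in> Z \<Longrightarrow> R z z"
    and trans: "\<And>x y z. x \<in> Z \<Longrightarrow> y \<in> Z \<Longrightarrow> z \<in> Z \<Longrightarrow> R x y \<Longrightarrow> R y z \<Longrightarrow> R x z"
    and mono: "\<And>x y. x \<in> Z \<Longrightarrow> y \<in> Z \<Longrightarrow> R x y \<Longrightarrow> \<mu> x \<le> \<mu> y"
    and bdd: "\<And>x. x \<in> Z \<Longrightarrow> \<mu> x \<le> K"
    and lim: "\<And>f. (\<And>n. f n \<in> Z) \<Longrightarrow> (\<And>m n. m \<le> n \<Longrightarrow> R (f m) (f n))
                  \<Longrightarrow> \<exists>z\<in>Z. \<forall>n::nat. R (f n) z"
  obtains z where "z \<in> Z" "\<And>z'. z' \<in> Z \<Longrightarrow> R z z' \<Longrightarrow> \<mu> z' = \<mu> z"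
proof -
  define S where "S z = \<mu> ` {z'\<in>Z. R z z'}" for z
  have ne: "S z \<noteq> {}" if "z \<in> Z" for z using that refl by (auto simp: S_def)
  have bd: "bdd_above (S z)" for z using bdd by (auto simp: S_def intro!: bdd_aboveI)
  \<comment> \<open>Greedy choice: \<open>f (Suc n)\<close> comes within \<open>1 / Suc n\<close> of
    the supremum of \<open>\<mu>\<close> over everything above \<open>f n\<close>. An element above
    an upper bound of the chain is above every \<open>f n\<close>, so its value exceeds that of the
    bound by at most \<open>1 / Suc n\<close> for each \<open>n\<close>.\<close>
  have "\<exists>f. \<forall>n. f n \<in> Z \<and> (R (f n) (f (Suc n)) \<and> Sup (S (f n)) < \<mu> (f (Suc n)) + 1 / Suc n)"
  proof (rule dependent_nat_choice[where P = "\<lambda>n x. x \<in> Z"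
        and Q = "\<lambda>n x y. R x y \<and> Sup (S x) < \<mu> y + 1 / Suc n"])
    show "\<exists>x. x \<in> Z" using z0 by blast
    fix x n assume x: "x \<in> Z"
    have "Sup (S x) - 1 / Suc n < Sup (S x)" by simp
    then obtain s where "s \<in> S x" "Sup (S x) - 1 / Suc n < s"
      using less_cSupD[OF ne[OF x]] by blast
    then show "\<exists>y. y \<in> Z \<and> (R x y \<and> Sup (S x) < \<mu> y + 1 / Suc n)"
      by (force simp: S_def)
  qed
  then obtain f where f: "\<And>n. f n \<in> Z" "\<And>n. R (f n) (f (Suc n))"
    "\<And>n. Sup (S (f n)) < \<mu> (f (Suc n)) + 1 / Suc n" by blast
  have R: "R (f m) (f n)" if "m \<le> n" for m n
    using that by (induction n rule: dec_induct) (use refl trans f in blast)+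
  obtain z where z: "z \<in> Z" "\<And>n. R (f n) z" using lim[of f, OF f(1) R] by blast
  have "\<mu> z' = \<mu> z" if z': "z' \<in> Z" "R z z'" for z'
  proof -
    have "\<mu> z' - \<mu> z \<le> 1 / Suc n" for n
    proof -
      have "\<mu> z' \<in> S (f n)" unfolding S_def using z' z f trans by blast
      then have "\<mu> z' \<le> Sup (S (f n))" using bd cSup_upper by blast
      moreover have "\<mu> (f (Suc n)) \<le> \<mu> z" using mono f z by blast
      ultimately show ?thesis using f(3)[of n] by linarith
    qed
    then have "\<not> 0 < \<mu> z' - \<mu> z"
      using reals_Archimedean[of "\<mu> z' - \<mu> z"] unfolding inverse_eq_divide
      by (meson not_less)
    with mono z z' show ?thesis by force
  qed
  with z that show ?thesis by blast
qed

text \<open>Scalars are elements \<open>\<iota> c\<close> of the ring, so scalar multiplication is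
  ring multiplication. The ring operations live on the whole type, while the laws of star and trace
  hold on the carrier \<open>M\<close>; this allows the ring to consist of all additive
  maps.\<close>

locale tracial_algebra =
  fixes M :: "'a::{ring,monoid_mult} set"
    and star :: "'a \<Rightarrow> 'a"
    and \<iota> :: "complex \<Rightarrow> 'a"
    and \<tau> :: "'a \<Rightarrow> complex"
  assumes add_M [simp]: "A \<in> M \<Longrightarrow> B \<in> M \<Longrightarrow> A + B \<in> M"
    and mult_M [simp]: "A \<in> M \<Longrightarrow> B \<in> M \<Longrightarrow> A * B \<in> M"
    and star_M [simp]: "A \<in> M \<Longrightarrow> star A \<in> M"
    and scalar_M [simp]: "\<iota> c \<in> M"
    and scalar_add: "\<iota> (c + d) = \<iota> c + \<iota> d"
    and scalar_mult: "\<iota> (c * d) = \<iota> c * \<iota> d"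
    and scalar_1 [simp]: "\<iota> 1 = 1"
    and scalar_comm: "A \<in> M \<Longrightarrow> A * \<iota> c = \<iota> c * A"
    and star_add [simp]: "A \<in> M \<Longrightarrow> B \<in> M \<Longrightarrow> star (A + B) = star A + star B"
    and star_mult [simp]: "A \<in> M \<Longrightarrow> B \<in> M \<Longrightarrow> star (A * B) = star B * star A"
    and star_star [simp]: "A \<in> M \<Longrightarrow> star (star A) = A"
    and star_scalar [simp]: "star (\<iota> c) = \<iota> (cnj c)"
    and trace_add [simp]: "A \<in> M \<Longrightarrow> B \<in> M \<Longrightarrow> \<tau> (A + B) = \<tau> A + \<tau> B"
    and trace_scalar [simp]: "A \<in> M \<Longrightarrow> \<tau> (\<iota> c * A) = c * \<tau> A"
    and trace_1 [simp]: "\<tau> 1 = 1"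
    and trace_commute: "A \<in> M \<Longrightarrow> B \<in> M \<Longrightarrow> \<tau> (A * B) = \<tau> (B * A)"
    and trace_star_real: "A \<in> M \<Longrightarrow> Im (\<tau> (star A * A)) = 0"
    and trace_star_nonneg: "A \<in> M \<Longrightarrow> 0 \<le> Re (\<tau> (star A * A))"
    and trace_faithful: "A \<in> M \<Longrightarrow> \<tau> (star A * A) = 0 \<Longrightarrow> A = 0"
begin

lemma scalar_mult_simps [simp]: "\<iota> c * \<iota> d = \<iota> (c * d)" "\<iota> c * (\<iota> d * A) = \<iota> (c * d) * A"
  by (simp_all add: scalar_mult mult.assoc)

lemma scalar_left_comm: "A \<in> M \<Longrightarrow> A * (\<iota> c * B) = \<iota> c * (A * B)"
  by (metis mult.assoc scalar_comm)

lemma one_M [simp]: "1 \<in> M" using scalar_M[of 1] by simp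

lemma scalar_0 [simp]: "\<iota> 0 = 0"
  using scalar_add[of 0 0] by simp

lemma scalar_uminus: "\<iota> (- c) = - \<iota> c"
  using scalar_add[of c "- c"] by (simp add: eq_neg_iff_add_eq_0 add.commute)

lemma zero_M [simp]: "0 \<in> M" using scalar_M[of 0] by simp

lemma uminus_eq: "- A = \<iota> (-1) * A"
  by (simp add: scalar_uminus)

lemma uminus_M [simp]: "A \<in> M \<Longrightarrow> - A \<in> M"
  by (simp add: uminus_eq)

lemma diff_M [simp]: "A \<in> M \<Longrightarrow> B \<in> M \<Longrightarrow> A - B \<in> M"
  unfolding diff_conv_add_uminus by (intro add_M uminus_M)

lemma sum_M [simp]: "(\<And>i. i \<in> I \<Longrightarrow> f i \<in> M) \<Longrightarrow> sum f I \<in> M"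
  by (induction I rule: infinite_finite_induct) auto

lemma star_1 [simp]: "star 1 = 1" using star_scalar[of 1] by simp

lemma star_0 [simp]: "star 0 = 0" using star_scalar[of 0] by simp

lemma star_uminus [simp]: "A \<in> M \<Longrightarrow> star (- A) = - star A"
  using star_add[of A "- A"] by (simp add: eq_neg_iff_add_eq_0 add.commute)

lemma star_diff [simp]: "A \<in> M \<Longrightarrow> B \<in> M \<Longrightarrow> star (A - B) = star A - star B"
  using star_add[of A "- B"] by simp

lemma trace_0 [simp]: "\<tau> 0 = 0" using trace_scalar[of 1 0] by simp

lemma trace_uminus [simp]: "A \<in> M \<Longrightarrow> \<tau> (- A) = - \<tau> A"
  using trace_add[of A "- A"] by (simp add: eq_neg_iff_add_eq_0 add.commute)

lemma trace_diff [simp]: "A \<in> M \<Longrightarrow> B \<in> M \<Longrightarrow> \<tau> (A - B) = \<tau> A - \<tau> B"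
  using trace_add[of A "- B"] by simp

lemma trace_iota [simp]: "\<tau> (\<iota> c) = c"
  using trace_scalar[of 1 c] by simp

lemma star_mult_self_0: "A \<in> M \<Longrightarrow> star A * A = 0 \<Longrightarrow> A = 0"
  by (metis trace_0 trace_faithful)

lemma sa_square_0: "A \<in> M \<Longrightarrow> star A = A \<Longrightarrow> A * A = 0 \<Longrightarrow> A = 0"
  by (metis star_mult_self_0)

lemma star_eq_0: "A \<in> M \<Longrightarrow> star A = 0 \<Longrightarrow> A = 0"
  by (metis star_0 star_star)

section \<open>The trace norm and Cauchy-Schwarz\<close>

definition nrm2 :: "'a \<Rightarrow> real" where "nrm2 A = Re (\<tau> (star A * A))"

lemma trace_star_self: "A \<in> M \<Longrightarrow> \<tau> (star A * A) = complex_of_real (nrm2 A)"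
  by (simp add: nrm2_def trace_star_real complex_eq_iff)

lemma nrm2_nonneg: "A \<in> M \<Longrightarrow> 0 \<le> nrm2 A"
  by (simp add: nrm2_def trace_star_nonneg)

lemma nrm2_eq_0: "A \<in> M \<Longrightarrow> nrm2 A = 0 \<Longrightarrow> A = 0"
  by (metis of_real_0 trace_faithful trace_star_self)

text \<open>Polarization: \<open>\<tau>\<close> is real on \<open>star B * B\<close> for
  \<open>B = A + \<iota> c\<close>. The choice \<open>c = 1\<close> compares imaginary parts,
  \<open>c = \<i>\<close> real parts.\<close>

lemma trace_star: assumes "A \<in> M" shows "\<tau> (star A) = cnj (\<tau> A)"
proof -
  have *: "Im (cnj c * \<tau> A) + Im (c * \<tau> (star A)) = 0" for c
  proof -
    have "star (A + \<iota> c) * (A + \<iota> c) = star A * A + \<iota> c * star A + \<iota> (cnj c) * A + \<iota> (cnj c * c)"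
      using assms by (simp add: algebra_simps scalar_comm[of "star A"])
    then have "\<tau> (star (A + \<iota> c) * (A + \<iota> c)) = \<tau> (star A * A) + c * \<tau> (star A) + cnj c * \<tau> A + cnj c * c"
      using assms by simp
    with trace_star_real[OF add_M[OF assms scalar_M, of c]]
    have "Im (\<tau> (star A * A) + c * \<tau> (star A) + cnj c * \<tau> A + cnj c * c) = 0" by (simp only:)
    then show ?thesis using trace_star_real[OF assms] by (simp add: algebra_simps)
  qed
  from *[of 1] *[of \<i>] show ?thesis by (simp add: complex_eq_iff)
qed

lemma trace_sa_real: "A \<in> M \<Longrightarrow> star A = A \<Longrightarrow> \<tau> A = complex_of_real (Re (\<tau> A))"
  using trace_star[of A] by (simp add: complex_eq_iff)

lemma trace_cauchy_schwarz:
  assumes A: "A \<in> M" and B: "B \<in> M"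
  shows "(cmod (\<tau> (star A * B)))\<^sup>2 \<le> nrm2 A * nrm2 B"
proof (cases "nrm2 A = 0")
  case True
  then show ?thesis using nrm2_eq_0[OF A] by simp
next
  case False
  then have pos: "nrm2 A > 0" using nrm2_nonneg[OF A] by simp
  define c where "c = \<tau> (star A * B)"
  define t where "t = 1 / nrm2 A"
  have cc: "\<tau> (star B * A) = cnj c"
    using trace_star[of "star A * B"] A B by (simp add: c_def)
  let ?d = "complex_of_real t * c"
  have "star (B - \<iota> ?d * A) * (B - \<iota> ?d * A) =
     star B * B - \<iota> ?d * (star B * A) - \<iota> (cnj ?d) * (star A * B) + \<iota> (cnj ?d * ?d) * (star A * A)"
    using A B by (simp add: algebra_simps scalar_left_comm[of "star A"] scalar_left_comm[of "star B"])
  then have "\<tau> (star (B - \<iota> ?d * A) * (B - \<iota> ?d * A)) =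
     \<tau> (star B * B) - ?d * cnj c - cnj ?d * c + (cnj ?d * ?d) * \<tau> (star A * A)"
    using A B by (simp add: cc c_def)
  also have "\<dots> = \<tau> (star B * B) - 2 * t * (c * cnj c) + t * t * (c * cnj c) * \<tau> (star A * A)"
    by (simp add: algebra_simps)
  also have "c * cnj c = of_real ((cmod c)\<^sup>2)" by (simp add: complex_norm_square [symmetric])
  also have "\<tau> (star B * B) - 2 * t * \<dots> + t * t * \<dots> * \<tau> (star A * A)
      = of_real (nrm2 B - 2 * t * (cmod c)\<^sup>2 + t\<^sup>2 * (cmod c)\<^sup>2 * nrm2 A)"
    by (simp add: trace_star_self[OF A] trace_star_self[OF B] power2_eq_square)
  finally have "nrm2 (B - \<iota> ?d * A) = nrm2 B - 2 * t * (cmod c)\<^sup>2 + t\<^sup>2 * (cmod c)\<^sup>2 * nrm2 A"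
    by (simp only: nrm2_def Re_complex_of_real)
  moreover have "0 \<le> nrm2 (B - \<iota> ?d * A)" using A B by (intro nrm2_nonneg) simp
  moreover have "t\<^sup>2 * (cmod c)\<^sup>2 * nrm2 A = t * (cmod c)\<^sup>2"
    using pos by (simp add: t_def power2_eq_square)
  ultimately have "t * (cmod c)\<^sup>2 \<le> nrm2 B" by linarith
  then show ?thesis using pos by (simp add: t_def c_def field_simps)
qed

section \<open>Projections and their traces\<close>

definition proj :: "'a \<Rightarrow> bool" where "proj p \<longleftrightarrow> p \<in> M \<and> star p = p \<and> p * p = p"

lemma projD: "proj p \<Longrightarrow> p \<in> M" "proj p \<Longrightarrow> star p = p" "proj p \<Longrightarrow> p * p = p"
  by (auto simp: proj_def)

lemma proj_idem: "proj p \<Longrightarrow> p * (p * A) = p * A"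
  by (metis mult.assoc projD(3))

lemma proj_0 [simp]: "proj 0" by (simp add: proj_def)

lemma proj_1 [simp]: "proj 1" by (simp add: proj_def)

definition tr :: "'a \<Rightarrow> real" where "tr A = Re (\<tau> A)"

lemma proj_trace: "proj p \<Longrightarrow> \<tau> p = complex_of_real (tr p)"
  unfolding tr_def using trace_sa_real projD by blast

lemma proj_nrm2: "proj p \<Longrightarrow> nrm2 p = tr p"
  by (simp add: nrm2_def tr_def projD)

lemma proj_tr_nonneg: "proj p \<Longrightarrow> 0 \<le> tr p"
  by (metis proj_nrm2 nrm2_nonneg projD(1))

lemma proj_tr_eq_0: "proj p \<Longrightarrow> tr p = 0 \<Longrightarrow> p = 0"
  by (metis proj_nrm2 nrm2_eq_0 projD(1))

lemma proj_tr_pos: "proj p \<Longrightarrow> p \<noteq> 0 \<Longrightarrow> 0 < tr p"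
  using proj_tr_nonneg proj_tr_eq_0 by fastforce

lemma proj_commute: "proj p \<Longrightarrow> proj q \<Longrightarrow> p * q = q \<Longrightarrow> q * p = q"
  by (metis projD(1) projD(2) star_mult)

lemma proj_orth: "proj p \<Longrightarrow> proj q \<Longrightarrow> p * q = 0 \<Longrightarrow> q * p = 0"
  by (metis projD(1) projD(2) star_mult star_0)

lemma proj_add: "proj p \<Longrightarrow> proj q \<Longrightarrow> p * q = 0 \<Longrightarrow> proj (p + q)"
  using proj_orth[of p q] by (auto simp: proj_def algebra_simps)

lemma proj_diff: "proj p \<Longrightarrow> proj q \<Longrightarrow> p * q = q \<Longrightarrow> proj (p - q)"
  using proj_commute[of p q] by (auto simp: proj_def algebra_simps)

lemma tr_diff: "A \<in> M \<Longrightarrow> B \<in> M \<Longrightarrow> tr (A - B) = tr A - tr B"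
  by (simp add: tr_def)

lemma tr_add: "A \<in> M \<Longrightarrow> B \<in> M \<Longrightarrow> tr (A + B) = tr A + tr B"
  by (simp add: tr_def)

lemma tr_1 [simp]: "tr 1 = 1" by (simp add: tr_def)

lemma proj_tr_mono: "proj p \<Longrightarrow> proj q \<Longrightarrow> p * q = q \<Longrightarrow> tr q \<le> tr p"
  using proj_tr_nonneg[OF proj_diff[of p q]] by (simp add: tr_diff projD)

lemma proj_tr_le_1: "proj p \<Longrightarrow> tr p \<le> 1"
  using proj_tr_mono[of 1 p] by simp

lemma sub_trans: "proj p \<Longrightarrow> proj q \<Longrightarrow> proj r \<Longrightarrow> p * q = q \<Longrightarrow> q * r = r \<Longrightarrow> p * r = r"
  by (metis mult.assoc)

lemma proj_trace_bound: "proj p \<Longrightarrow> b \<in> M \<Longrightarrow> (cmod (\<tau> (p * b)))\<^sup>2 \<le> tr p * nrm2 b"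
  using trace_cauchy_schwarz[of p b] by (simp add: projD proj_nrm2)

text \<open>By Cauchy-Schwarz the trace of \<open>d n\<close> controls
  \<open>\<tau> (d n * b)\<close> for each fixed \<open>b\<close>. Convergence of one number, the
  trace, thus gives convergence of all functionals used later.\<close>

lemma proj_trace_tendsto_0:
  assumes p: "\<And>n. proj (d n)" and b: "b \<in> M" and lim: "(\<lambda>n. tr (d n)) \<longlonglongrightarrow> 0"
  shows "(\<lambda>n. \<tau> (d n * b)) \<longlonglongrightarrow> 0"
proof -
  have "(\<lambda>n. tr (d n) * nrm2 b) \<longlonglongrightarrow> 0" using tendsto_mult_right[OF lim, of "nrm2 b"] by simp
  then have "(\<lambda>n. (cmod (\<tau> (d n * b)))\<^sup>2) \<longlonglongrightarrow> 0"
    by (rule tendsto_sandwich[OF _ _ tendsto_const, rotated 2])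
       (simp_all add: p b proj_trace_bound always_eventually)
  then have "(\<lambda>n. sqrt ((cmod (\<tau> (d n * b)))\<^sup>2)) \<longlonglongrightarrow> sqrt 0" by (rule tendsto_real_sqrt)
  then have "(\<lambda>n. cmod (\<tau> (d n * b))) \<longlonglongrightarrow> 0" by simp
  then show ?thesis by (rule tendsto_norm_zero_cancel)
qed

text \<open>Scalar compressions are hereditary, since \<open>s * A * s\<close> only sees
  \<open>r * A * r\<close>. Several elements can therefore be treated one after another.\<close>

lemma compress_sub:
  assumes "proj r" "proj s" "r * s = s" "A \<in> M" "r * A * r = \<iota> l * r"
  shows "s * A * s = \<iota> l * s"
proof -
  have sr: "s * r = s" using proj_commute assms by blast
  have "s * A * s = s * r * A * (r * s)" using sr assms by simp
  also have "\<dots> = s * (r * A * r) * s" by (simp add: mult.assoc)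
  also have "\<dots> = \<iota> l * s" using assms sr by (simp add: scalar_left_comm[of s] projD mult.assoc)
  finally show ?thesis .
qed

section \<open>Partial isometries\<close>

definition partial_isometry :: "'a \<Rightarrow> bool" where
  "partial_isometry v \<longleftrightarrow> v \<in> M \<and> proj (star v * v)"

text \<open>The usual extension order of partial isometries, written without vectors: agreement on
  the initial projection of \<open>v\<close>, and inclusion of the initial projections.\<close>

definition extends :: "'a \<Rightarrow> 'a \<Rightarrow> bool" where
  "extends w v \<longleftrightarrow> w * (star v * v) = v \<and> star w * w * (star v * v) = star v * v"

lemma partial_isometryD: "partial_isometry v \<Longrightarrow> v \<in> M" "partial_isometry v \<Longrightarrow> proj (star v * v)"
  by (auto simp: partial_isometry_def)

text \<open>The element \<open>star (v - v * p) * (v - v * p)\<close> expands to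
  \<open>p - p - p + p\<close>, and faithfulness of the trace finishes.\<close>

lemma mult_source_eq:
  assumes "v \<in> M" "star v * v = p" "proj p" shows "v * p = v"
proof -
  have "star (v - v * p) * (v - v * p) = star v * v - star v * v * p - p * (star v * v) + p * (star v * v) * p"
    using assms(1) projD[OF assms(3)] by (simp add: algebra_simps)
  also have "\<dots> = 0" unfolding assms(2) using assms(3) by (simp add: projD)
  finally have "v - v * p = 0"
    by (rule star_mult_self_0[rotated]) (use assms in \<open>auto simp: projD\<close>)
  then show ?thesis by simp
qed

lemma partial_isometry_mult: "partial_isometry v \<Longrightarrow> v * (star v * v) = v"
  using mult_source_eq partial_isometryD by blast

lemma range_proj: assumes "partial_isometry v" shows "proj (v * star v)"
proof -
  have "v * star v * (v * star v) = v * (star v * v) * star v" by (simp add: mult.assoc)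
  then show ?thesis using assms partial_isometry_mult[OF assms]
    by (simp add: proj_def partial_isometryD)
qed

lemma tr_range: "v \<in> M \<Longrightarrow> tr (v * star v) = tr (star v * v)"
  unfolding tr_def by (subst trace_commute) auto

lemma extends_refl: "partial_isometry v \<Longrightarrow> extends v v"
  by (simp add: extends_def partial_isometry_mult projD partial_isometryD)

lemma extends_trans:
  assumes "extends w v" "extends x w" shows "extends x v"
proof -
  have "x * (star v * v) = x * (star w * w * (star v * v))" using assms(1) by (simp add: extends_def)
  also have "\<dots> = x * (star w * w) * (star v * v)" by (simp add: mult.assoc)
  also have "\<dots> = v" using assms by (simp add: extends_def)
  finally have 1: "x * (star v * v) = v" .
  have "star x * x * (star v * v) = star x * x * (star w * w * (star v * v))"
    using assms(1) by (simp add: extends_def)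
  also have "\<dots> = star x * x * (star w * w) * (star v * v)" by (simp add: mult.assoc)
  also have "\<dots> = star v * v" using assms by (simp add: extends_def)
  finally show ?thesis using 1 by (simp add: extends_def)
qed

lemma extends_tr: "partial_isometry v \<Longrightarrow> partial_isometry w \<Longrightarrow> extends w v \<Longrightarrow> tr (star v * v) \<le> tr (star w * w)"
  by (intro proj_tr_mono) (auto simp: extends_def partial_isometryD)

lemma proj_partial_isometry: "proj p \<Longrightarrow> partial_isometry p"
  by (simp add: partial_isometry_def projD)

lemma proj_extends: "proj p \<Longrightarrow> proj q \<Longrightarrow> extends q p \<longleftrightarrow> q * p = p"
  by (simp add: extends_def projD mult.assoc)

lemma partial_isometry_add:
  assumes v: "partial_isometry v" and w: "partial_isometry w"
    and src: "star w * w * (star v * v) = 0" and rng: "star w * v = 0"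
  shows "partial_isometry (v + w)" "star (v + w) * (v + w) = star v * v + star w * w"
    "extends (v + w) v"
proof -
  have M: "v \<in> M" "w \<in> M" using v w by (auto simp: partial_isometryD)
  have vw: "star v * w = 0" using rng M by (metis star_0 star_M star_mult star_star)
  show s: "star (v + w) * (v + w) = star v * v + star w * w"
    using M rng vw by (simp add: algebra_simps)
  have src': "star v * v * (star w * w) = 0"
    using proj_orth partial_isometryD v w src by blast
  show "partial_isometry (v + w)"
    unfolding partial_isometry_def s using M v w src' by (auto intro!: proj_add dest: partial_isometryD)
  have "w * (star v * v) = w * (star w * w) * (star v * v)" using w by (simp add: partial_isometry_mult)
  also have "\<dots> = 0" using src by (simp add: mult.assoc)
  finally show "extends (v + w) v"
    unfolding extends_def s using v w src
    by (simp add: distrib_right partial_isometry_mult projD(3) partial_isometryD)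
qed

end

section \<open>Scalar compressions\<close>

text \<open>The operator facts that the argument needs, in algebraic form. The last clause of
  \<open>range_projection\<close> makes \<open>r\<close> the smallest projection fixing
  \<open>V\<close>. In \<open>fourth_root\<close>, \<open>c\<close> plays the role of the square
  root of the absolute value of \<open>D\<close>. Triviality of the centre enters as
  \<open>prime\<close>, and normality of the trace as the limit in
  \<open>partial_isometry_limit\<close>.\<close>

locale tracial_factor = tracial_algebra +
  assumes range_projection: "V \<in> M \<Longrightarrow> \<exists>r. proj r \<and> r * V = V \<and> (\<forall>b\<in>M. b * V = 0 \<longrightarrow> b * r = 0)"
    and fourth_root: "D \<in> M \<Longrightarrow> \<exists>c\<in>M. star c = c \<and> c * c * (c * c) = star D * D \<and>
          (\<forall>b\<in>M. b * (star D * D) = star D * D * b \<longrightarrow> b * c = c * b)"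
    and prime: "A \<in> M \<Longrightarrow> B \<in> M \<Longrightarrow> A \<noteq> 0 \<Longrightarrow> B \<noteq> 0 \<Longrightarrow> \<exists>z\<in>M. A * z * B \<noteq> 0"
    and partial_isometry_limit: "(\<And>n. partial_isometry (v n)) \<Longrightarrow> (\<And>m n. m \<le> n \<Longrightarrow> extends (v n) (v m)) \<Longrightarrow>
          \<exists>u. partial_isometry u \<and> (\<forall>n::nat. extends u (v n)) \<and>
            (\<lambda>n. \<tau> (star (v n) * v n)) \<longlonglongrightarrow> \<tau> (star u * u)"
    and infinite_dim: \<comment> \<open>indexed by pairs because the matrix units \<open>w * star w'\<close> are\<close>
      "finite I \<Longrightarrow> (\<And>i::'a \<times> 'a. i \<in> I \<Longrightarrow> f i \<in> M) \<Longrightarrow> \<exists>m\<in>M. \<forall>c. m \<noteq> (\<Sum>i\<in>I. \<iota> (c i) * f i)"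
begin

text \<open>With \<open>h = \<bar>a\<bar>\<close>, the elements \<open>h + a\<close> and \<open>h - a\<close> are orthogonal and carry the positive and
  the negative part of the form \<open>a\<close>; mixing the two parts produces an isotropic vector \<open>V\<close>.\<close>
lemma isotropic:
  assumes a: "a \<in> M" "star a = a" "\<tau> a = 0" "a \<noteq> 0" and e: "proj e" "e * a = a"
  shows "\<exists>V\<in>M. V \<noteq> 0 \<and> star V * a * V = 0 \<and> e * V = V"
proof -
  obtain c where c: "c \<in> M" "star c = c" "c * c * (c * c) = a * a" "a * c = c * a"
    using fourth_root[OF a(1)] a by (auto simp: mult.assoc)
  define h where "h = c * c"
  have h: "h \<in> M" "star h = h" "h * h = a * a" "a * h = h * a" "h * c = c * h"
    using c by (simp_all add: h_def) (metis mult.assoc)+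
  have eh: "e * h = h"
  proof -
    have ae: "a * e = a" using e a by (metis projD star_mult)
    have "star (h * (1 - e)) * (h * (1 - e)) = (1 - e) * (h * h) * (1 - e)"
      using h(1,2) e by (simp add: mult.assoc projD)
    also have "\<dots> = (1 - e) * a * (a * (1 - e))" unfolding h(3) by (simp only: mult.assoc)
    also have "\<dots> = 0" using ae by (simp add: right_diff_distrib)
    finally have "h * (1 - e) = 0"
      by (rule star_mult_self_0[rotated]) (use h e in \<open>auto simp: projD\<close>)
    then have "h * e = h" by (simp add: algebra_simps)
    then show ?thesis using h e by (metis projD star_mult)
  qed
  define P where "P = h + a"
  define N where "N = h - a"
  have PN: "P \<in> M" "N \<in> M" "star P = P" "star N = N"
    using a h by (simp_all add: P_def N_def)
  have PN0: "P * N = 0" "N * P = 0" using h by (simp_all add: P_def N_def algebra_simps)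
  have aP: "a * P = h * P" and aN: "a * N = - (h * N)"
    using h by (simp_all add: P_def N_def algebra_simps)
  have cP: "c * P = P * c" and cN: "c * N = N * c"
    using c h by (simp_all add: P_def N_def algebra_simps)
  \<comment> \<open>This is where trace zero forces both signs to occur: if \<open>P\<close> or
    \<open>N\<close> vanished, \<open>h\<close> would be \<open>- a\<close> or \<open>a\<close> and
    have trace zero, so \<open>h = star c * c\<close> would vanish by faithfulness.\<close>
  have h0: "a = 0" if "\<tau> h = 0"
  proof -
    have "c = 0" using that c trace_faithful[of c] by (simp add: h_def)
    then have "star a * a = 0" using c a by simp
    then show ?thesis using a star_mult_self_0 by blast
  qed
  have P0: "c * P \<noteq> 0"
  proof
    assume "c * P = 0"
    then have "h * P = 0" by (simp add: h_def mult.assoc)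
    then have "P * P = 0" using aP by (simp add: P_def distrib_right)
    then have "P = 0" using PN sa_square_0 by blast
    then have "h = - a" by (simp add: P_def eq_neg_iff_add_eq_0)
    then show False using h0 a by simp
  qed
  have N0: "N * c \<noteq> 0"
  proof
    assume "N * c = 0"
    then have "c * N = 0" using cN by simp
    then have "h * N = 0" by (simp add: h_def mult.assoc)
    then have "N * N = 0" using aN by (simp add: N_def left_diff_distrib)
    then have "N = 0" using PN sa_square_0 by blast
    then show False using h0 a by (simp add: N_def)
  qed
  obtain z where z: "z \<in> M" "c * P * z * (N * c) \<noteq> 0"
    using prime[of "c * P" "N * c"] P0 N0 c PN by auto
  \<comment> \<open>Primeness links the two parts: \<open>D\<close> is a nonzero passage from the
    negative to the positive side.\<close>
  define D where "D = c * P * z * (N * c)"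
  have D: "D \<in> M" "D \<noteq> 0" "star D = c * N * star z * (P * c)"
    using z c PN by (simp_all add: D_def mult.assoc)
  obtain c' where c': "c' \<in> M" "star c' = c'" "c' * c' * (c' * c') = star D * D"
    using fourth_root[OF D(1)] by blast
  define k where "k = c' * c'"
  have k: "k \<in> M" "star k = k" "k * k = star D * D" using c' by (simp_all add: k_def)
  \<comment> \<open>The right factors are chosen so that \<open>c * P * R = D * k\<close> and
    \<open>c * N * S = star D * D\<close>. For both values \<open>Z\<close>,
    \<open>star Z * Z\<close> is the square of \<open>star D * D\<close>, because
    \<open>k * k = star D * D\<close>; hence the positive and the negative contribution of
    \<open>V\<close> cancel.\<close>
  define R where "R = z * (N * c) * k"
  define S where "S = star z * (P * c) * D"
  have RS: "R \<in> M" "S \<in> M" using z c k D PN by (simp_all add: R_def S_def)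
  have cPR: "c * P * R = D * k" by (simp add: D_def R_def mult.assoc)
  have cNS: "c * N * S = star D * D" by (simp add: D(3) S_def mult.assoc)
  define V where "V = P * R + N * S"
  have V: "V \<in> M" using PN RS by (simp add: V_def)
  have aV: "a * V = h * (P * R) - h * (N * S)"
    using aP aN by (simp add: V_def distrib_left mult.assoc[symmetric])
  have 1: "star (P * R) * (h * (P * R)) = star (c * P * R) * (c * P * R)"
    using c PN RS by (simp add: h_def mult.assoc)
  have 2: "star (N * S) * (h * (N * S)) = star (c * N * S) * (c * N * S)"
    using c PN RS by (simp add: h_def mult.assoc)
  have Ph: "P * h = h * P" using h by (simp add: P_def algebra_simps)
  have Nh: "N * h = h * N" using h by (simp add: N_def algebra_simps)
  have 3: "star (P * R) * (h * (N * S)) = 0"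
  proof -
    have "star (P * R) * (h * (N * S)) = star R * (P * h * N) * S"
      using PN RS by (simp add: mult.assoc)
    also have "P * h * N = 0" by (simp only: Ph mult.assoc PN0) simp
    finally show ?thesis by simp
  qed
  have 4: "star (N * S) * (h * (P * R)) = 0"
  proof -
    have "star (N * S) * (h * (P * R)) = star S * (N * h * P) * R"
      using PN RS by (simp add: mult.assoc)
    also have "N * h * P = 0" by (simp only: Nh mult.assoc PN0) simp
    finally show ?thesis by simp
  qed
  have sV: "star V = star (P * R) + star (N * S)" unfolding V_def using PN RS by (intro star_add) auto
  have kk: "star (D * k) * (D * k) = star D * D * (star D * D)"
  proof -
    have "star (D * k) * (D * k) = k * (star D * D) * k" using D k by (simp add: mult.assoc)
    then show ?thesis by (simp add: k(3)[symmetric] mult.assoc)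
  qed
  have "star V * a * V = star V * (a * V)" by (simp add: mult.assoc)
  also have "\<dots> = star (c * P * R) * (c * P * R) - star (c * N * S) * (c * N * S)"
    unfolding aV sV distrib_right right_diff_distrib 1 2 3 4 by simp
  also have "\<dots> = 0" unfolding cPR cNS kk using D(1) by simp
  finally have iso: "star V * a * V = 0" .
  have "V \<noteq> 0"
  proof
    assume "V = 0"
    then have "P * V = 0" by simp
    then have "P * (P * R) = 0" by (simp add: V_def distrib_left mult.assoc[symmetric] PN0)
    then have "star (P * R) * (P * R) = 0" using PN RS by (simp add: mult.assoc)
    then have "P * R = 0" by (rule star_mult_self_0[rotated]) (use PN RS in auto)
    then have "D * k = 0" using cPR by (simp add: mult.assoc)
    then have "(star D * D) * (star D * D) = 0" using kk by simp
    then have "star D * D = 0" by (rule sa_square_0[rotated 2]) (use D(1) in auto)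
    then show False using D star_mult_self_0 by blast
  qed
  moreover have "e * V = V"
    by (simp add: V_def P_def N_def distrib_left distrib_right left_diff_distrib right_diff_distrib
        mult.assoc[symmetric] eh e)
  ultimately show ?thesis using V iso by blast
qed

text \<open>Subtracting the mean of \<open>x\<close> over \<open>e\<close> leaves an element
  \<open>a\<close> of trace zero. If it is nonzero, an isotropic \<open>V\<close> exists, and
  \<open>a\<close> compresses to zero on the range projection of \<open>V\<close>.\<close>

lemma scalar_compression_sa:
  assumes e: "proj e" "e \<noteq> 0" and x: "x \<in> M" "star x = x"
  shows "\<exists>r l. proj r \<and> r \<noteq> 0 \<and> e * r = r \<and> r * x * r = \<iota> l * r"
proof -
  define l where "l = \<tau> (e * x * e) / \<tau> e"
  define a where "a = e * x * e - \<iota> l * e"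
  have te: "\<tau> e \<noteq> 0" using e proj_tr_pos[OF e] by (simp add: proj_trace)
  have l: "cnj l = l"
    using trace_star[of "e * x * e"] trace_star[of e] e x
    by (simp add: l_def projD mult.assoc)
  have a: "a \<in> M" "star a = a" "\<tau> a = 0" "e * a = a"
    using e x l te proj_idem[of e]
    by (simp_all add: a_def l_def projD mult.assoc algebra_simps scalar_comm[of e] scalar_left_comm[of e])
  have ae: "a * e = a" using a e by (metis projD star_mult)
  show ?thesis
  proof (cases "a = 0")
    case True
    then have "e * x * e = \<iota> l * e" by (simp add: a_def)
    then show ?thesis using e projD by blast
  next
    case False
    then obtain V where V: "V \<in> M" "V \<noteq> 0" "star V * a * V = 0" "e * V = V"
      using isotropic a e by blast
    obtain r where r: "proj r" "r * V = V" "\<And>b. b \<in> M \<Longrightarrow> b * V = 0 \<Longrightarrow> b * r = 0"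
      using range_projection V by blast
    \<comment> \<open>From \<open>V\<close> to \<open>r\<close> on each side:
      \<open>star V * a\<close> annihilates \<open>V\<close>, hence \<open>r\<close>; after taking
      adjoints \<open>r * a\<close> annihilates \<open>V\<close>, hence \<open>r\<close>.\<close>
    have "star V * a * r = 0" using r(3)[of "star V * a"] V a by simp
    then have "star (star V * a * r) = 0" by simp
    then have "r * a * V = 0" using V a r by (simp add: projD mult.assoc)
    then have rar: "r * a * r = 0" using r a by (simp add: projD)
    have "(1 - e) * r = 0" using r(3)[of "1 - e"] V e by (simp add: left_diff_distrib projD)
    then have er: "e * r = r" by (simp add: left_diff_distrib)
    then have re: "r * e = r" using proj_commute e r by blast
    have "r * x * r = r * e * x * (e * r)" using er re by simp
    also have "\<dots> = r * (a + \<iota> l * e) * r" by (simp add: a_def mult.assoc)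
    also have "\<dots> = r * (\<iota> l * e) * r" using rar by (simp add: algebra_simps)
    also have "\<dots> = \<iota> l * r" using r er re by (simp add: scalar_left_comm[of r] projD mult.assoc)
    finally have "r * x * r = \<iota> l * r" .
    moreover have "r \<noteq> 0" using r V by auto
    ultimately show ?thesis using r er by blast
  qed
qed

text \<open>Real and imaginary part are compressed in turn, the second one below the projection
  found for the first.\<close>

lemma scalar_compression_single:
  assumes e: "proj e" "e \<noteq> 0" and x: "x \<in> M"
  shows "\<exists>r l. proj r \<and> r \<noteq> 0 \<and> e * r = r \<and> r * x * r = \<iota> l * r"
proof -
  obtain r l where r: "proj r" "r \<noteq> 0" "e * r = r" "r * (x + star x) * r = \<iota> l * r"
    using scalar_compression_sa[OF e, of "x + star x"] x by (auto simp: add.commute)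
  have x2: "star (\<iota> \<i> * (x - star x)) = \<iota> \<i> * (x - star x)"
    using x by (simp add: algebra_simps scalar_comm[of x] scalar_comm[of "star x"] scalar_uminus)
  obtain s m where s: "proj s" "s \<noteq> 0" "r * s = s" "s * (\<iota> \<i> * (x - star x)) * s = \<iota> m * s"
    using scalar_compression_sa[OF r(1,2) _ x2] x by auto
  have 1: "s * (x + star x) * s = \<iota> l * s" using compress_sub[OF r(1) s(1,3) _ r(4)] x by simp
  have "x + x = (x + star x) + \<iota> (-\<i>) * (\<iota> \<i> * (x - star x))" by simp
  then have "\<iota> (1/2) * (x + x) = \<iota> (1/2) * ((x + star x) + \<iota> (-\<i>) * (\<iota> \<i> * (x - star x)))"
    by (rule arg_cong)
  moreover have "\<iota> (1/2) * (x + x) = x"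
  proof -
    have "\<iota> (1/2) * (x + x) = (\<iota> (1/2) + \<iota> (1/2)) * x" by (simp add: algebra_simps)
    also have "\<dots> = x" by (simp add: scalar_add[symmetric])
    finally show ?thesis .
  qed
  ultimately have "x = \<iota> (1/2) * ((x + star x) + \<iota> (-\<i>) * (\<iota> \<i> * (x - star x)))" by (simp only:)
  then have "x = \<iota> (1/2) * (x + star x) + \<iota> (-\<i>/2) * (\<iota> \<i> * (x - star x))"
    unfolding distrib_left[of "\<iota> (1/2)"] by simp
  then have "s * x * s = s * (\<iota> (1/2) * (x + star x) + \<iota> (-\<i>/2) * (\<iota> \<i> * (x - star x))) * s"
    by (rule arg_cong)
  also have "\<dots> = \<iota> (1/2) * (s * (x + star x) * s) + \<iota> (-\<i>/2) * (s * (\<iota> \<i> * (x - star x)) * s)"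
    using s by (simp only: distrib_left[of s] distrib_right[of _ _ s] mult.assoc scalar_left_comm[OF projD(1)[OF s(1)]])
  also have "\<dots> = \<iota> (1/2 * l + -\<i>/2 * m) * s" unfolding 1 s(4)
    by (simp only: scalar_add distrib_right scalar_mult_simps)
  finally show ?thesis using s r e sub_trans[of e r s] by blast
qed

lemma scalar_compression:
  assumes "finite X" "X \<subseteq> M" and e: "proj e" "e \<noteq> 0"
  shows "\<exists>r. proj r \<and> r \<noteq> 0 \<and> e * r = r \<and> (\<forall>x\<in>X. \<exists>l. r * x * r = \<iota> l * r)"
  using assms(1,2)
proof (induction X rule: finite_induct)
  case empty
  then show ?case using e projD by blast
next
  case (insert x X)
  then obtain r where r: "proj r" "r \<noteq> 0" "e * r = r" "\<forall>x\<in>X. \<exists>l. r * x * r = \<iota> l * r" by auto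
  obtain s l where s: "proj s" "s \<noteq> 0" "r * s = s" "s * x * s = \<iota> l * s"
    using scalar_compression_single[OF r(1,2), of x] insert.prems by auto
  have "\<exists>l. s * y * s = \<iota> l * s" if "y \<in> X" for y
    using r(4) that compress_sub[OF r(1) s(1,3)] insert.prems by blast
  then show ?case using s r e sub_trans[of e r s] by blast
qed

section \<open>Absence of minimal projections\<close>

text \<open>Taking traces in \<open>star D * D = \<iota> l * r\<close> gives
  \<open>l * tr r = nrm2 D > 0\<close>. So \<open>l\<close> is positive without any order on
  \<open>M\<close>, and \<open>D\<close> can be rescaled.\<close>

lemma normalize:
  assumes D: "D \<in> M" "D \<noteq> 0" and r: "proj r" and DD: "star D * D = \<iota> l * r"
  shows "\<exists>m. star (\<iota> m * D) * (\<iota> m * D) = r"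
proof -
  have "nrm2 D \<noteq> 0" using D nrm2_eq_0 by blast
  then have n: "nrm2 D > 0" using nrm2_nonneg[OF D(1)] by simp
  have "l * \<tau> r = complex_of_real (nrm2 D)"
    using trace_star_self[OF D(1)] DD r by (simp add: projD)
  then have l: "l * complex_of_real (tr r) = complex_of_real (nrm2 D)"
    using r by (simp add: proj_trace)
  then have "tr r \<noteq> 0" using n by auto
  then have t: "tr r > 0" using proj_tr_nonneg[OF r] by simp
  define s where "s = sqrt (tr r / nrm2 D)"
  have "s * s = tr r / nrm2 D" using n t by (simp add: s_def)
  then have ss: "complex_of_real s * complex_of_real s = complex_of_real (tr r / nrm2 D)"
    by (metis of_real_mult)
  have "star (\<iota> s * D) * (\<iota> s * D) = \<iota> (complex_of_real s * complex_of_real s) * (star D * D)"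
    using D(1) by (simp add: mult.assoc scalar_left_comm[of "star D"])
  also have "\<dots> = \<iota> (complex_of_real (tr r / nrm2 D) * l) * r" by (simp add: DD ss)
  also have "complex_of_real (tr r / nrm2 D) * l = 1"
    using l n by (simp add: field_simps)
  finally show ?thesis by auto
qed

text \<open>Partial isometries with minimal initial projection \<open>p\<close> and orthogonal
  ranges can be added to a family until the ranges sum to \<open>1\<close>, which happens at finite
  size since each range has trace \<open>tr p\<close>. Then the products \<open>w * star w'\<close>
  span \<open>M\<close>, against infinite dimension.\<close>

lemma no_minimal_projection:
  assumes p: "proj p" "p \<noteq> 0"
  shows "\<exists>q. proj q \<and> q \<noteq> 0 \<and> q \<noteq> p \<and> p * q = q"
proof (rule ccontr)
  assume minimal: "\<nexists>q. proj q \<and> q \<noteq> 0 \<and> q \<noteq> p \<and> p * q = q"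
  \<comment> \<open>The nonzero projection below \<open>p\<close> on which \<open>m\<close> becomes
    scalar is \<open>p\<close> itself, by minimality.\<close>
  have scal: "\<exists>l. p * m * p = \<iota> l * p" if "m \<in> M" for m
    using scalar_compression_single[OF p that] minimal by metis
  define ON where "ON W \<longleftrightarrow> finite W \<and> W \<subseteq> M \<and> (\<forall>w\<in>W. star w * w = p) \<and>
    (\<forall>w\<in>W. \<forall>w'\<in>W. w \<noteq> w' \<longrightarrow> star w * w' = 0)" for W
  define E where "E W = (\<Sum>w\<in>W. w * star w)" for W
  have EW: "proj (E W) \<and> tr (E W) = card W * tr p" if "ON W" for W
  proof -
    have "finite W" using that by (simp add: ON_def)
    then show ?thesis using that
    proof (induction W rule: finite_induct)
      case empty
      then show ?case by (simp add: E_def tr_def)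
    next
      case (insert w W)
      then have IH: "proj (E W)" "tr (E W) = card W * tr p" by (auto simp: ON_def)
      have w: "w \<in> M" "star w * w = p" using insert.prems by (auto simp: ON_def)
      then have pw: "proj (w * star w)" using p range_proj by (simp add: partial_isometry_def)
      have 0: "w * star w * (w' * star w') = 0" if "w' \<in> W" for w'
      proof -
        have "w * star w * (w' * star w') = w * (star w * w') * star w'" by (simp add: mult.assoc)
        also have "star w * w' = 0"
        proof -
          have "w \<noteq> w'" using insert.hyps that by blast
          then show ?thesis using insert.prems that by (simp add: ON_def)
        qed
        finally show ?thesis by simp
      qed
      have "w * star w * E W = 0"
        unfolding E_def sum_distrib_left using 0 by (intro sum.neutral) blast
      moreover have "E (insert w W) = w * star w + E W" using insert.hyps by (simp add: E_def)
      ultimately show ?case using proj_add[OF pw IH(1)] insert.hyps IH pw w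
        by (simp add: tr_add projD tr_range algebra_simps)
    qed
  qed
  \<comment> \<open>Primeness gives a nonzero \<open>D\<close> from \<open>p\<close> into the
    complement of the ranges. As \<open>star D * D\<close> is a multiple of \<open>p\<close>, a
    multiple of \<open>D\<close> is a new member.\<close>
  have step: "\<exists>w. w \<notin> W \<and> ON (insert w W)" if W: "ON W" "E W \<noteq> 1" for W
  proof -
    have pE: "proj (E W)" using EW W by blast
    obtain z where z: "z \<in> M" "(1 - E W) * z * p \<noteq> 0"
      using prime[of "1 - E W" p] W p pE by (auto simp: projD)
    define D where "D = (1 - E W) * z * p"
    have D: "D \<in> M" using z p pE by (simp add: D_def projD)
    have "star D * D = p * (star z * (1 - E W) * ((1 - E W) * z)) * p"
      using z p pE by (simp add: D_def projD mult.assoc)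
    then obtain l where "star D * D = \<iota> l * p" 
      using scal[of "star z * (1 - E W) * ((1 - E W) * z)"] z pE by (auto simp: projD)
    then obtain m where m: "star (\<iota> m * D) * (\<iota> m * D) = p"
      using normalize[OF D _ p(1)] z by (auto simp: D_def)
    define w where "w = \<iota> m * D"
    have w: "w \<in> M" "star w * w = p" using D m by (simp_all add: w_def)
    have orth: "star w' * w = 0" if "w' \<in> W" for w'
    proof -
      have w': "w' \<in> M" "star w' * w' = p" using W that by (auto simp: ON_def)
      have "star w' * E W = (\<Sum>w\<in>W. star w' * (w * star w))" by (simp add: E_def sum_distrib_left)
      also have "\<dots> = (\<Sum>w\<in>W. if w = w' then star w' else 0)"
      proof (rule sum.cong[OF HOL.refl])
        fix w assume "w \<in> W"
        show "star w' * (w * star w) = (if w = w' then star w' else 0)"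
        proof (cases "w = w'")
          case True
          have "w' * p = w'" using mult_source_eq w' p by blast
          then have "star (w' * p) = star w'" by simp
          then show ?thesis using True w' p by (simp add: mult.assoc[symmetric] projD)
        next
          case False
          then have "star w' * w = 0" using W that \<open>w \<in> W\<close> unfolding ON_def by metis
          then show ?thesis using False by (simp add: mult.assoc[symmetric])
        qed
      qed
      also have "\<dots> = star w'" using W that by (simp add: ON_def)
      finally have "star w' * (1 - E W) = 0" by (simp add: right_diff_distrib)
      then have "star w' * D = 0" by (simp add: D_def mult.assoc[symmetric])
      then show ?thesis using w' by (simp add: w_def scalar_left_comm)
    qed
    have "w \<notin> W" using orth w p by auto
    moreover have "star w * w' = 0" if "w' \<in> W" for w'
    proof -
      have "star (star w' * w) = 0" using orth[OF that] by simp
      then show ?thesis using that w W by (simp add: ON_def subset_iff)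
    qed
    ultimately have "w \<notin> W \<and> ON (insert w W)" using W orth w unfolding ON_def by auto
    then show ?thesis by blast
  qed
  have "\<exists>W. ON W \<and> E W = 1"
  proof (rule ccontr)
    assume no: "\<nexists>W. ON W \<and> E W = 1"
    have ex: "\<exists>W. ON W \<and> card W = n" for n
    proof (induction n)
      case 0
      then show ?case by (intro exI[of _ "{}"]) (simp add: ON_def)
    next
      case (Suc n)
      then obtain W where "ON W" "card W = n" by blast
      then show ?case using step[of W] no by (metis ON_def card_insert_disjoint)
    qed
    obtain n where n: "1 < real n * tr p" using proj_tr_pos[OF p] ex_less_of_nat_mult by blast
    obtain W where "ON W" "card W = n" using ex by blast
    then have "real n * tr p \<le> 1" using EW[of W] proj_tr_le_1 by metis
    then show False using n by simp
  qed
  then obtain W where W: "ON W" "E W = 1" by blast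
  have WM: "w \<in> M" "star w * w = p" "w * p = w" "p * star w = star w" if "w \<in> W" for w
  proof -
    show w: "w \<in> M" "star w * w = p" using W that by (auto simp: ON_def)
    show 1: "w * p = w" using mult_source_eq w p by blast
    show "p * star w = star w" using arg_cong[OF 1, of star] w p by (simp add: projD)
  qed
  have "\<exists>m\<in>M. \<forall>c. m \<noteq> (\<Sum>i\<in>W \<times> W. \<iota> (c i) * (fst i * star (snd i)))"
    using W WM by (intro infinite_dim) (auto simp: ON_def)
  then obtain m where m: "m \<in> M" "\<And>c. m \<noteq> (\<Sum>i\<in>W \<times> W. \<iota> (c i) * (fst i * star (snd i)))" by blast
  have "\<forall>i\<in>W \<times> W. \<exists>l. p * (star (fst i) * m * snd i) * p = \<iota> l * p"
    using scal m WM by auto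
  then obtain c where c: "\<And>i. i \<in> W \<times> W \<Longrightarrow> p * (star (fst i) * m * snd i) * p = \<iota> (c i) * p"
    by metis
  \<comment> \<open>Matrix expansion of \<open>m\<close>: writing \<open>1 = E W\<close> on both
    sides leaves the entries \<open>star w * m * w'\<close>, which are scalars after compression by
    \<open>p\<close>.\<close>
  have "m = E W * m * E W" using W by simp
  also have "\<dots> = (\<Sum>w\<in>W. \<Sum>w'\<in>W. w * star w * m * (w' * star w'))"
    by (simp add: E_def sum_distrib_right[where r = m] sum_product)
  also have "\<dots> = (\<Sum>i\<in>W \<times> W. fst i * star (fst i) * m * (snd i * star (snd i)))"
    by (simp add: sum.cartesian_product split_def)
  also have "\<dots> = (\<Sum>i\<in>W \<times> W. \<iota> (c i) * (fst i * star (snd i)))"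
  proof (rule sum.cong[OF HOL.refl])
    fix i assume i: "i \<in> W \<times> W"
    obtain w w' where ww: "i = (w, w')" "w \<in> W" "w' \<in> W" using i by auto
    have "w * star w * m * (w' * star w') = (w * p) * star w * m * (w' * (p * star w'))"
      using ww WM by simp
    also have "\<dots> = w * (p * (star w * m * w') * p) * star w'" by (simp add: mult.assoc)
    also have "\<dots> = w * (\<iota> (c i) * p) * star w'" using c[OF i] ww by simp
    also have "\<dots> = \<iota> (c i) * (w * star w')"
      using ww WM by (simp add: mult.assoc scalar_left_comm[of w])
    finally show "fst i * star (fst i) * m * (snd i * star (snd i)) = \<iota> (c i) * (fst i * star (snd i))"
      using ww by simp
  qed
  finally show False using m by blast
qed

text \<open>Of a proper subprojection \<open>s\<close> of \<open>q\<close> and its complement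
  \<open>q - s\<close>, one has at most half the trace of \<open>q\<close>.\<close>

lemma small_projection:
  assumes p: "proj p" "p \<noteq> 0"
  shows "\<exists>q. proj q \<and> q \<noteq> 0 \<and> p * q = q \<and> tr q \<le> tr p / 2 ^ n"
proof (induction n)
  case 0
  then show ?case using p projD by (intro exI[of _ p]) simp
next
  case (Suc n)
  then obtain q where q: "proj q" "q \<noteq> 0" "p * q = q" "tr q \<le> tr p / 2 ^ n" by blast
  obtain s where s: "proj s" "s \<noteq> 0" "s \<noteq> q" "q * s = s" using no_minimal_projection[OF q(1,2)] by blast
  have d: "proj (q - s)" "q - s \<noteq> 0" "q * (q - s) = q - s" "tr (q - s) = tr q - tr s"
    using s q proj_diff by (auto simp: projD right_diff_distrib tr_diff)
  have "\<exists>t. proj t \<and> t \<noteq> 0 \<and> q * t = t \<and> tr t \<le> tr q / 2"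
  proof (cases "tr s \<le> tr q / 2")
    case True then show ?thesis using s by blast
  next
    case False then show ?thesis using d by (intro exI[of _ "q - s"]) auto
  qed
  then obtain t where "proj t" "t \<noteq> 0" "q * t = t" "tr t \<le> tr q / 2" by blast
  then show ?case using q p sub_trans[of p q t] by (intro exI[of _ t]) auto
qed

text \<open>An increasing sequence of projections is a chain for \<open>extends\<close>, and the
  initial projection of its limit is the supremum. Convergence against every \<open>b\<close> holds
  because the trace of \<open>s - q n\<close> tends to \<open>0\<close>; the last clause expresses
  minimality of \<open>s\<close>.\<close>

lemma proj_sup:
  assumes q: "\<And>n::nat. proj (q n)" and inc: "\<And>m n. m \<le> n \<Longrightarrow> q n * q m = q m"
  shows "\<exists>s. proj s \<and> (\<forall>n. s * q n = q n) \<and> (\<forall>b\<in>M. (\<lambda>n. \<tau> (q n * b)) \<longlonglongrightarrow> \<tau> (s * b)) \<and>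
           (\<forall>b\<in>M. (\<forall>n. b * q n = 0) \<longrightarrow> b * s = 0)"
proof -
  have "\<exists>u. partial_isometry u \<and> (\<forall>n. extends u (q n)) \<and> (\<lambda>n. \<tau> (star (q n) * q n)) \<longlonglongrightarrow> \<tau> (star u * u)"
    using q inc by (intro partial_isometry_limit) (auto simp: proj_partial_isometry proj_extends)
  then obtain u where u: "partial_isometry u" "\<And>n. extends u (q n)"
    "(\<lambda>n. \<tau> (star (q n) * q n)) \<longlonglongrightarrow> \<tau> (star u * u)" by blast
  define s where "s = star u * u"
  have s: "proj s" using u by (simp add: s_def partial_isometryD)
  have sq: "s * q n = q n" for n
    using u(2)[of n] projD[OF q[of n]] by (simp add: extends_def s_def)
  define d where "d n = s - q n" for n
  have d: "proj (d n)" for n unfolding d_def using s q sq by (intro proj_diff)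
  have "(\<lambda>n. \<tau> (q n)) \<longlonglongrightarrow> \<tau> s" using u(3) q by (simp add: s_def projD)
  then have "(\<lambda>n. \<tau> s - \<tau> (q n)) \<longlonglongrightarrow> \<tau> s - \<tau> s" by (intro tendsto_diff tendsto_const)
  then have "(\<lambda>n. Re (\<tau> s - \<tau> (q n))) \<longlonglongrightarrow> Re 0" by (intro tendsto_Re) simp
  then have trd: "(\<lambda>n. tr (d n)) \<longlonglongrightarrow> 0" using s q by (simp add: d_def tr_def projD)
  have lim: "(\<lambda>n. \<tau> (d n * b)) \<longlonglongrightarrow> 0" if "b \<in> M" for b
    using proj_trace_tendsto_0[OF d that trd] .
  have "(\<lambda>n. \<tau> (q n * b)) \<longlonglongrightarrow> \<tau> (s * b)" if "b \<in> M" for b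
  proof -
    have "(\<lambda>n. \<tau> (s * b) - \<tau> (d n * b)) \<longlonglongrightarrow> \<tau> (s * b) - 0"
      using lim[OF that] by (intro tendsto_diff tendsto_const)
    then show ?thesis using that s q by (simp add: d_def left_diff_distrib projD)
  qed
  moreover have "b * s = 0" if b: "b \<in> M" "\<And>n. b * q n = 0" for b
  proof -
    \<comment> \<open>Since \<open>b\<close> annihilates \<open>q n\<close>, it only sees the
      difference \<open>d n\<close>, whose contribution tends to \<open>0\<close>; the left side
      does not depend on \<open>n\<close>.\<close>
    have "\<tau> (star (b * s) * (b * s)) = \<tau> (d n * (star b * b))" for n
    proof -
      have "b * s = b * d n" using b by (simp add: d_def right_diff_distrib)
      then have "star (b * s) * (b * s) = d n * (star b * b * d n)"
        using b(1) d[of n] by (simp add: projD mult.assoc)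
      then have "\<tau> (star (b * s) * (b * s)) = \<tau> (star b * b * d n * d n)"
        using b(1) d[of n] by (simp add: trace_commute[of "d n"] projD)
      also have "\<dots> = \<tau> (d n * (star b * b))"
        using b(1) d[of n] by (simp add: trace_commute[of "d n"] projD mult.assoc)
      finally show ?thesis .
    qed
    then have "(\<lambda>n. \<tau> (star (b * s) * (b * s))) \<longlonglongrightarrow> 0" using lim[of "star b * b"] b(1) by simp
    then have "\<tau> (star (b * s) * (b * s)) = 0" by (simp add: LIMSEQ_const_iff)
    then show ?thesis using b(1) s trace_faithful by (simp add: projD del: star_mult)
  qed
  ultimately show ?thesis using s sq by blast
qed

text \<open>A subprojection of maximal trace, among those with at most half the trace of
  \<open>p\<close>, reaches one half: otherwise a projection below \<open>p - q\<close> with trace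
  smaller than the deficit could be added.\<close>

lemma trace_halving:
  assumes p: "proj p"
  shows "\<exists>q. proj q \<and> p * q = q \<and> tr q = tr p / 2"
proof -
  define Z where "Z = {q. proj q \<and> p * q = q \<and> tr q \<le> tr p / 2}"
  have Z0: "0 \<in> Z" using proj_tr_nonneg[OF p] by (simp add: Z_def tr_def)
  obtain q where q: "q \<in> Z" "\<And>q'. q' \<in> Z \<Longrightarrow> q' * q = q \<Longrightarrow> tr q' = tr q"
  proof (rule exhaustion[where Z = Z and R = "\<lambda>x y. y * x = x" and \<mu> = tr and K = "tr p / 2"])
    show "0 \<in> Z" by fact
    show "x * x = x" if "x \<in> Z" for x using that by (auto simp: Z_def projD)
    show "z * x = x" if "y * x = x" "z * y = y" for x y z :: 'a using that by (metis mult.assoc)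
    show "tr x \<le> tr y" if "x \<in> Z" "y \<in> Z" "y * x = x" for x y
      using that by (auto simp: Z_def intro: proj_tr_mono)
    show "tr x \<le> tr p / 2" if "x \<in> Z" for x using that by (auto simp: Z_def)
  next
    fix f :: "nat \<Rightarrow> 'a" assume f: "\<And>n. f n \<in> Z" "\<And>m n. m \<le> n \<Longrightarrow> f n * f m = f m"
    obtain s where s: "proj s" "\<And>n. s * f n = f n" "\<And>b. b \<in> M \<Longrightarrow> (\<lambda>n. \<tau> (f n * b)) \<longlonglongrightarrow> \<tau> (s * b)"
      "\<And>b. b \<in> M \<Longrightarrow> (\<And>n. b * f n = 0) \<Longrightarrow> b * s = 0"
      using proj_sup[of f] f by (auto simp: Z_def)
    have "(1 - p) * s = 0" using f(1) p by (intro s(4)) (auto simp: Z_def projD left_diff_distrib)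
    then have "p * s = s" by (simp add: left_diff_distrib)
    moreover have "(\<lambda>n. tr (f n)) \<longlonglongrightarrow> tr s"
      unfolding tr_def using tendsto_Re[OF s(3)[of 1]] by simp
    then have "tr s \<le> tr p / 2" using f(1) by (intro LIMSEQ_le_const2) (auto simp: Z_def)
    ultimately show "\<exists>z\<in>Z. \<forall>n. z * f n = f n" using s by (auto simp: Z_def)
  qed (blast intro: that)
  have q': "proj q" "p * q = q" "tr q \<le> tr p / 2" using q(1) by (auto simp: Z_def)
  have "tr q = tr p / 2"
  proof (rule ccontr)
    assume "tr q \<noteq> tr p / 2"
    then have lt: "tr q < tr p / 2" using q' by simp
    then have "tr p \<noteq> tr q" using proj_tr_nonneg[OF p] by auto
    then have e: "proj (p - q)" "p - q \<noteq> 0" using proj_diff p q' by auto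
    \<comment> \<open>This \<open>n\<close> makes \<open>tr (p - q) / 2 ^ n\<close> smaller than the
      deficit; the \<open>+ 1\<close> keeps the denominator positive.\<close>
    obtain n where n: "(1/2) ^ n < (tr p / 2 - tr q) / (tr (p - q) + 1)"
      using real_arch_pow_inv[of "(tr p / 2 - tr q) / (tr (p - q) + 1)" "1/2"] lt proj_tr_nonneg[OF e(1)] by auto
    obtain r where r: "proj r" "r \<noteq> 0" "(p - q) * r = r" "tr r \<le> tr (p - q) / 2 ^ n"
      using small_projection[OF e] by blast
    have "tr (p - q) / 2 ^ n \<le> (tr (p - q) + 1) * (1/2) ^ n" by (simp add: field_simps power_one_over)
    also have "\<dots> < tr p / 2 - tr q"
      using n proj_tr_nonneg[OF e(1)] by (simp add: field_simps)
    finally have small: "tr r < tr p / 2 - tr q" using r by simp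
    have "q * (p - q) = 0" using q' p proj_commute[of p q] by (simp add: right_diff_distrib projD)
    then have qr: "q * r = 0" using r(3) by (metis mult.assoc mult_zero_left)
    have "p * (p - q) = p - q" using p q' by (simp add: right_diff_distrib projD)
    then have pr: "p * r = r" using r(3) by (metis mult.assoc)
    have "q + r \<in> Z" using q' r small qr pr proj_add by (auto simp: Z_def distrib_left tr_add projD)
    moreover have "(q + r) * q = q" using q' r qr proj_orth[of q r] by (simp add: distrib_right projD)
    ultimately have "tr (q + r) = tr q" using q by blast
    then show False using proj_tr_pos[OF r(1,2)] q' r by (simp add: tr_add projD)
  qed
  then show ?thesis using q' by blast
qed

section \<open>Lyapunov convexity\<close>

text \<open>Real values make bisection possible. The imaginary part of a functional is recovered, up
  to sign, from the element \<open>\<iota> \<i> * b\<close>.\<close>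

definition rtr :: "'a \<Rightarrow> 'a \<Rightarrow> real" where "rtr b q = Re (\<tau> (q * b))"

lemma rtr_add: "b \<in> M \<Longrightarrow> p \<in> M \<Longrightarrow> q \<in> M \<Longrightarrow> rtr b (p + q) = rtr b p + rtr b q"
  by (simp add: rtr_def distrib_right)

lemma rtr_diff: "b \<in> M \<Longrightarrow> p \<in> M \<Longrightarrow> q \<in> M \<Longrightarrow> rtr b (p - q) = rtr b p - rtr b q"
  by (simp add: rtr_def left_diff_distrib)

lemma rtr_0: "rtr b 0 = 0"
  by (simp add: rtr_def)

lemma rtr_1: "rtr 1 q = tr q"
  by (simp add: rtr_def tr_def)

lemma sub_orth:
  fixes p q q' :: 'a
  shows "p * q = 0 \<Longrightarrow> q * q' = q' \<Longrightarrow> p * q' = 0"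
  by (metis mult.assoc mult_zero_left)

lemma orth_sub: "proj p \<Longrightarrow> proj p' \<Longrightarrow> p * q = 0 \<Longrightarrow> p * p' = p' \<Longrightarrow> p' * q = 0"
  by (metis mult.assoc mult_zero_right proj_commute)

definition halves :: "'a set \<Rightarrow> 'a \<Rightarrow> 'a \<Rightarrow> bool" where
  "halves B p q \<longleftrightarrow> proj q \<and> p * q = q \<and> (\<forall>b\<in>B. rtr b q = rtr b p / 2)"

text \<open>A projection \<open>m + r\<close> with too small a value on the new functional is moved towards
  \<open>m + s\<close>, whose value is too large, by exchanging halves of \<open>r\<close> and \<open>s\<close>; bisection makes \<open>r\<close> and
  \<open>s\<close> tend to \<open>0\<close>.\<close>
lemma halving_step:
  assumes IH: "\<And>p. proj p \<Longrightarrow> \<exists>q. halves B p q"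
    and B: "B \<subseteq> M" "1 \<in> B" and c: "c \<in> M" and p: "proj p"
    and q0: "halves B p q0" "rtr c q0 \<le> rtr c p / 2"
  shows "\<exists>q. halves (insert c B) p q"
proof -
  define T where "T = rtr c p / 2"
  \<comment> \<open>Invariant of the bisection: \<open>m + r\<close> and \<open>m + s\<close> both
    halve every functional of \<open>B\<close>, and their values on \<open>c\<close> enclose the
    target \<open>T\<close>. The part \<open>m\<close> is settled, while \<open>r\<close> and
    \<open>s\<close> are still to be exchanged.\<close>
  define P where "P = (\<lambda>(m, r, s). proj m \<and> proj r \<and> proj s \<and> m * r = 0 \<and> m * s = 0 \<and> r * s = 0 \<and>
    p * m = m \<and> p * r = r \<and> p * s = s \<and>
    (\<forall>b\<in>B. rtr b m + rtr b r = rtr b p / 2 \<and> rtr b r = rtr b s) \<and>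
    rtr c m + rtr c r \<le> T \<and> T \<le> rtr c m + rtr c s)"
  define Q where "Q = (\<lambda>(m::'a, r::'a, s::'a) (m'::'a, r'::'a, s'::'a). m' * m = m \<and> tr r' = tr r / 2)"
  have "\<exists>f. \<forall>n::nat. P (f n) \<and> Q (f n) (f (Suc n))"
  proof (rule dependent_nat_choice[where P = "\<lambda>n. P" and Q = "\<lambda>n. Q"])
    have q: "proj q0" "p * q0 = q0" "\<And>b. b \<in> B \<Longrightarrow> rtr b q0 = rtr b p / 2"
      using q0 by (auto simp: halves_def)
    have pm: "proj (p - q0)" using proj_diff p q by blast
    have "rtr b (p - q0) = rtr b p / 2" if "b \<in> B" for b
      using that q p B by (subst rtr_diff) (auto simp: projD subset_iff)
    then have "\<forall>b\<in>B. rtr b q0 = rtr b (p - q0)" using q(3) by (metis (full_types))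
    moreover have "T \<le> rtr c (p - q0)" using q0(2) q(1) p c by (simp add: rtr_diff projD T_def)
    moreover have "q0 * (p - q0) = 0"
      using q p proj_commute[of p q0] by (simp add: right_diff_distrib projD)
    moreover have "p * (p - q0) = p - q0" using q p by (simp add: right_diff_distrib projD)
    ultimately have "P (0, q0, p - q0)"
      using q pm q0(2) by (simp add: P_def T_def rtr_0)
    then show "\<exists>x. P x" by blast
  next
    fix x :: "'a \<times> 'a \<times> 'a" and n :: nat
    assume "P x"
    obtain m r s where x: "x = (m, r, s)" by (cases x) auto
    have a: "proj m" "proj r" "proj s" "m * r = 0" "m * s = 0" "r * s = 0"
      "p * m = m" "p * r = r" "p * s = s"
      "\<And>b. b \<in> B \<Longrightarrow> rtr b m + rtr b r = rtr b p / 2" "\<And>b. b \<in> B \<Longrightarrow> rtr b r = rtr b s"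
      "rtr c m + rtr c r \<le> T" "T \<le> rtr c m + rtr c s"
      using \<open>P x\<close> by (auto simp: P_def x)
    obtain r1 where r1: "proj r1" "r * r1 = r1" "\<And>b. b \<in> B \<Longrightarrow> rtr b r1 = rtr b r / 2"
      using IH[OF a(2)] by (auto simp: halves_def)
    obtain s1 where s1: "proj s1" "s * s1 = s1" "\<And>b. b \<in> B \<Longrightarrow> rtr b s1 = rtr b s / 2"
      using IH[OF a(3)] by (auto simp: halves_def)
    define r2 where "r2 = r - r1"
    define s2 where "s2 = s - s1"
    have r2: "proj r2" "r * r2 = r2" "\<And>b. b \<in> M \<Longrightarrow> rtr b r2 = rtr b r - rtr b r1"
      using proj_diff[OF a(2) r1(1,2)] r1 a(2) by (auto simp: r2_def right_diff_distrib projD rtr_diff)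
    have s2: "proj s2" "s * s2 = s2" "\<And>b. b \<in> M \<Longrightarrow> rtr b s2 = rtr b s - rtr b s1"
      using proj_diff[OF a(3) s1(1,2)] s1 a(3) by (auto simp: s2_def right_diff_distrib projD rtr_diff)
    have rr: "r2 * r1 = 0" "r1 * r2 = 0"
      using r1 a proj_commute[of r r1] by (simp_all add: r2_def left_diff_distrib right_diff_distrib projD)
    have ss: "s2 * s1 = 0" "s1 * s2 = 0"
      using s1 a proj_commute[of s s1] by (simp_all add: s2_def left_diff_distrib right_diff_distrib projD)
    have mr: "m * r1 = 0" "m * r2 = 0" "m * s1 = 0" "m * s2 = 0"
      using sub_orth a r1 r2 s1 s2 by blast+
    have rs: "r1 * s1 = 0" "r1 * s2 = 0" "r2 * s1 = 0" "r2 * s2 = 0"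
      using sub_orth[of _ s] orth_sub[of r _ s] a r1 r2 s1 s2 by blast+
    have sr: "s1 * r1 = 0" "s2 * r1 = 0" "s1 * r2 = 0" "s2 * r2 = 0"
      using rs proj_orth r1 r2 s1 s2 by blast+
    have pp: "p * r1 = r1" "p * r2 = r2" "p * s1 = s1" "p * s2 = s2"
      using sub_trans p a r1 r2 s1 s2 by blast+
    have m1: "proj (m + s1)" "proj (m + r1)" using proj_add a s1 r1 mr by blast+
    have mm: "(m + s1) * m = m" "(m + r1) * m = m"
      using mr proj_orth[of m] a s1 r1 by (simp_all add: distrib_right projD)
    have trh: "tr r1 = tr r / 2" "tr r2 = tr r / 2"
      using r1(3)[OF B(2)] r2(3)[of 1] by (simp_all add: rtr_1)
    have BM: "\<And>b. b \<in> B \<Longrightarrow> b \<in> M" using B by blast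
    have Bf: "rtr b (m + s1) + rtr b r1 = rtr b p / 2 \<and> rtr b r1 = rtr b s2"
      "rtr b (m + r1) + rtr b r2 = rtr b p / 2 \<and> rtr b r2 = rtr b s1" if b: "b \<in> B" for b
    proof -
      note v = a(10)[OF b] a(11)[OF b] r1(3)[OF b] s1(3)[OF b] r2(3)[OF BM[OF b]] s2(3)[OF BM[OF b]]
      have e: "rtr b (m + s1) = rtr b m + rtr b s1" "rtr b (m + r1) = rtr b m + rtr b r1"
        using BM[OF b] a r1 s1 by (auto intro!: rtr_add simp: projD)
      show "rtr b (m + s1) + rtr b r1 = rtr b p / 2 \<and> rtr b r1 = rtr b s2"
        unfolding e using v by (intro conjI) linarith+
      show "rtr b (m + r1) + rtr b r2 = rtr b p / 2 \<and> rtr b r2 = rtr b s1"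
        unfolding e using v by (intro conjI) linarith+
    qed
    have ec: "rtr c (m + s1) = rtr c m + rtr c s1" "rtr c (m + r1) = rtr c m + rtr c r1"
      using c a r1 s1 by (auto intro!: rtr_add simp: projD)
    note vc = a(12,13) r2(3)[OF c] s2(3)[OF c]
    \<comment> \<open>The candidate between the two ends is \<open>m + r1 + s1\<close>. If its value
      is at most \<open>T\<close> it becomes the lower end, with \<open>s1\<close> moved into
      \<open>m\<close>; otherwise it becomes the upper end, with \<open>r1\<close> moved into
      \<open>m\<close>.\<close>
    show "\<exists>y. P y \<and> Q x y"
    proof (cases "rtr c m + rtr c r1 + rtr c s1 \<le> T")
      case True
      have "P (m + s1, r1, s2)"
        using a(1-9) r1(1,2) s2(1,2) m1 mr rs sr ss pp True vc
        unfolding P_def prod.case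
        by (intro conjI) ((rule ballI, erule Bf(1)) | (simp add: distrib_left distrib_right ec))+
      moreover have "Q x (m + s1, r1, s2)" using mm trh by (simp add: Q_def x)
      ultimately show ?thesis by blast
    next
      case False
      have "P (m + r1, r2, s1)"
        using a(1-9) r2(1,2) s1(1,2) m1 mr rs sr rr pp False vc
        unfolding P_def prod.case
        by (intro conjI) ((rule ballI, erule Bf(2)) | (simp add: distrib_left distrib_right ec))+
      moreover have "Q x (m + r1, r2, s1)" using mm trh by (simp add: Q_def x)
      ultimately show ?thesis by blast
    qed
  qed
  then obtain f where f: "\<And>n. P (f n)" "\<And>n. Q (f n) (f (Suc n))" by blast
  define m where "m n = fst (f n)" for n
  define r where "r n = fst (snd (f n))" for n
  define s where "s n = snd (snd (f n))" for n
  have fn: "f n = (m n, r n, s n)" for n by (simp add: m_def r_def s_def)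
  have a: "proj (m n)" "proj (r n)" "proj (s n)" "p * m n = m n"
      "\<And>b. b \<in> B \<Longrightarrow> rtr b (m n) + rtr b (r n) = rtr b p / 2" "\<And>b. b \<in> B \<Longrightarrow> rtr b (r n) = rtr b (s n)"
      "rtr c (m n) + rtr c (r n) \<le> T" "T \<le> rtr c (m n) + rtr c (s n)" for n
    using f(1)[of n] by (auto simp: P_def fn)
  have step: "m (Suc n) * m n = m n" "tr (r (Suc n)) = tr (r n) / 2" for n
    using f(2)[of n] by (auto simp: Q_def fn)
  have inc: "m n * m k = m k" if "k \<le> n" for k n
    using that
  proof (induction n rule: dec_induct)
    case base
    then show ?case using a projD by blast
  next
    case (step n)
    then show ?case using \<open>m (Suc n) * m n = m n\<close> by (metis mult.assoc)
  qed
  \<comment> \<open>As \<open>1\<close> belongs to \<open>B\<close>, halving a piece halves its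
    trace. So \<open>r\<close> and \<open>s\<close> disappear in the limit, and both ends of the
    bisection converge to the values of the supremum of the \<open>m n\<close>.\<close>
  have "tr (r n) = tr (r 0) * (1/2) ^ n" for n
    by (induction n) (use step in auto)
  then have eq: "(\<lambda>n. tr (r n)) = (\<lambda>n. tr (r 0) * (1/2) ^ n)" by (rule ext)
  have "(\<lambda>n. tr (r 0) * (1/2) ^ n) \<longlonglongrightarrow> tr (r 0) * 0"
    by (intro tendsto_mult tendsto_const LIMSEQ_realpow_zero) auto
  then have r0: "(\<lambda>n. tr (r n)) \<longlonglongrightarrow> 0" unfolding eq[symmetric] by simp
  moreover have "tr (s n) = tr (r n)" for n using a(6)[OF B(2), of n] by (simp add: rtr_1)
  ultimately have s0: "(\<lambda>n. tr (s n)) \<longlonglongrightarrow> 0" by simp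
  have lr: "(\<lambda>n. rtr b (r n)) \<longlonglongrightarrow> 0" if "b \<in> M" for b
    unfolding rtr_def using tendsto_Re[OF proj_trace_tendsto_0[OF a(2) that r0]] by simp
  have ls: "(\<lambda>n. rtr b (s n)) \<longlonglongrightarrow> 0" if "b \<in> M" for b
    unfolding rtr_def using tendsto_Re[OF proj_trace_tendsto_0[OF a(3) that s0]] by simp
  obtain q where q: "proj q" "\<And>n. q * m n = m n" "\<And>b. b \<in> M \<Longrightarrow> (\<lambda>n. \<tau> (m n * b)) \<longlonglongrightarrow> \<tau> (q * b)"
      "\<And>b. b \<in> M \<Longrightarrow> (\<And>n. b * m n = 0) \<Longrightarrow> b * q = 0"
    using proj_sup[of m] a inc by blast
  have lm: "(\<lambda>n. rtr b (m n)) \<longlonglongrightarrow> rtr b q" if "b \<in> M" for b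
    unfolding rtr_def using tendsto_Re[OF q(3)[OF that]] .
  have "(1 - p) * q = 0" using a p by (intro q(4)) (auto simp: projD left_diff_distrib)
  then have pq: "p * q = q" by (simp add: left_diff_distrib)
  have "rtr b q = rtr b p / 2" if "b \<in> B" for b
  proof -
    have b: "b \<in> M" using that B by blast
    have "(\<lambda>n. rtr b (m n) + rtr b (r n)) \<longlonglongrightarrow> rtr b q + 0" by (intro tendsto_add lm lr b)
    then show ?thesis using a(5)[OF that] by (simp add: LIMSEQ_const_iff)
  qed
  moreover have "rtr c q = rtr c p / 2"
  proof (rule antisym)
    have "(\<lambda>n. rtr c (m n) + rtr c (r n)) \<longlonglongrightarrow> rtr c q + 0" by (intro tendsto_add lm lr c)
    then have "rtr c q + 0 \<le> T" by (rule LIMSEQ_le_const2) (use a in blast)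
    then show "rtr c q \<le> rtr c p / 2" by (simp add: T_def)
    have "(\<lambda>n. rtr c (m n) + rtr c (s n)) \<longlonglongrightarrow> rtr c q + 0" by (intro tendsto_add lm ls c)
    then have "T \<le> rtr c q + 0" by (rule LIMSEQ_le_const) (use a in blast)
    then show "rtr c p / 2 \<le> rtr c q" by (simp add: T_def)
  qed
  ultimately have "halves (insert c B) p q" using q(1) pq by (simp add: halves_def)
  then show ?thesis by blast
qed

text \<open>Functionals are added one at a time, starting from the halving of the trace. The element
  \<open>1\<close> stays in the family because \<open>halving_step\<close> needs the exchanged
  pieces to shrink in trace.\<close>

lemma lyapunov_halving:
  assumes "finite B" "B \<subseteq> M" "proj p"
  shows "\<exists>q. halves (insert 1 B) p q"
  using assms
proof (induction B arbitrary: p rule: finite_induct)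
  case empty
  then show ?case using trace_halving[of p] by (auto simp: halves_def rtr_1)
next
  case (insert c B)
  have IH: "\<And>p. proj p \<Longrightarrow> \<exists>q. halves (insert 1 B) p q" and c: "c \<in> M"
    and B: "insert 1 B \<subseteq> M" "1 \<in> insert 1 B"
    using insert by auto
  obtain q where q: "halves (insert 1 B) p q" using IH insert.prems by blast
  \<comment> \<open>The complement \<open>p - q\<close> halves the same functionals and lies on the
    other side of the target for \<open>c\<close>, so one of the two is a valid lower end.\<close>
  have "\<exists>q. halves (insert 1 B) p q \<and> rtr c q \<le> rtr c p / 2"
  proof (cases "rtr c q \<le> rtr c p / 2")
    case True then show ?thesis using q by blast
  next
    case False
    have p: "proj p" and q': "proj q" "p * q = q" using q insert.prems by (auto simp: halves_def)
    have "rtr b (p - q) = rtr b p / 2" if "b \<in> insert 1 B" for b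
    proof -
      have "rtr b (p - q) = rtr b p - rtr b q" using that B p q' by (intro rtr_diff) (auto simp: projD)
      also have "rtr b q = rtr b p / 2" using that q unfolding halves_def by blast
      finally show ?thesis by simp
    qed
    then have "halves (insert 1 B) p (p - q)"
      using proj_diff p q' unfolding halves_def by (auto simp: right_diff_distrib projD)
    moreover have "rtr c (p - q) \<le> rtr c p / 2" using False c p q' by (simp add: rtr_diff projD)
    ultimately show ?thesis by blast
  qed
  then obtain q where "halves (insert 1 B) p q" "rtr c q \<le> rtr c p / 2" by blast
  then have "\<exists>q. halves (insert c (insert 1 B)) p q"
    using halving_step[OF IH B c] insert.prems by blast
  then show ?case by (simp add: insert_commute)
qed

text \<open>Each complex condition is two real ones, for \<open>b\<close> and for
  \<open>\<iota> \<i> * b\<close>. This is the value one half in Lyapunov's theorem for the vector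
  measure formed by the functionals \<open>q \<mapsto> \<tau> (q * b)\<close>.\<close>

lemma lyapunov:
  assumes "finite B" "B \<subseteq> M" "proj p"
  shows "\<exists>q. proj q \<and> p * q = q \<and> tr q = tr p / 2 \<and> (\<forall>b\<in>B. \<tau> (q * b) = \<tau> (p * b) / 2)"
proof -
  have "\<exists>q. halves (insert 1 (B \<union> (\<lambda>b. \<iota> \<i> * b) ` B)) p q"
    using assms by (intro lyapunov_halving) auto
  then obtain q where q: "proj q" "p * q = q" "rtr 1 q = rtr 1 p / 2"
    "\<And>b. b \<in> B \<Longrightarrow> rtr b q = rtr b p / 2" "\<And>b. b \<in> B \<Longrightarrow> rtr (\<iota> \<i> * b) q = rtr (\<iota> \<i> * b) p / 2"
    by (auto simp: halves_def)
  have I: "rtr (\<iota> \<i> * b) r = - Im (\<tau> (r * b))" if "b \<in> B" "proj r" for b r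
    using that assms by (simp add: rtr_def projD scalar_left_comm[of r] subset_iff)
  have "\<tau> (q * b) = \<tau> (p * b) / 2" if "b \<in> B" for b
    using q(4,5)[OF that] I[OF that q(1)] I[OF that assms(3)]
    by (simp add: complex_eq_iff rtr_def)
  then show ?thesis using q by (auto simp: rtr_1)
qed

lemma dyadic_fraction:
  assumes "finite B" "B \<subseteq> M" "proj p"
  shows "\<exists>q. proj q \<and> p * q = q \<and> tr q = tr p / 2 ^ n \<and> (\<forall>b\<in>B. \<tau> (q * b) = \<tau> (p * b) / 2 ^ n)"
proof (induction n)
  case 0
  then show ?case using assms projD by auto
next
  case (Suc n)
  then obtain q where q: "proj q" "p * q = q" "tr q = tr p / 2 ^ n" "\<And>b. b \<in> B \<Longrightarrow> \<tau> (q * b) = \<tau> (p * b) / 2 ^ n"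
    by blast
  obtain s where s: "proj s" "q * s = s" "tr s = tr q / 2" "\<And>b. b \<in> B \<Longrightarrow> \<tau> (s * b) = \<tau> (q * b) / 2"
    using lyapunov[OF assms(1,2) q(1)] by blast
  show ?case using q s sub_trans[OF assms(3) q(1) s(1)] by (intro exI[of _ s]) auto
qed

text \<open>The symmetry is \<open>+1\<close> on a projection \<open>q\<close> that halves all
  functionals on \<open>p\<close>, and \<open>-1\<close> on \<open>p - q\<close>; the two
  contributions cancel.\<close>

lemma balanced_symmetry:
  assumes "finite B" "B \<subseteq> M" and p: "proj p"
  shows "\<exists>\<epsilon>\<in>M. star \<epsilon> = \<epsilon> \<and> \<epsilon> * \<epsilon> = p \<and> p * \<epsilon> = \<epsilon> \<and> (\<forall>b\<in>B. \<tau> (\<epsilon> * b) = 0)"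
proof -
  obtain q where q: "proj q" "p * q = q" "\<And>b. b \<in> B \<Longrightarrow> \<tau> (q * b) = \<tau> (p * b) / 2"
    using lyapunov[OF assms] by blast
  have qp: "q * p = q" using proj_commute p q by blast
  show ?thesis
  proof (intro bexI[of _ "q + q - p"] conjI ballI)
    fix b assume b: "b \<in> B"
    then have "b \<in> M" using assms by blast
    moreover have "\<tau> (p * b) = \<tau> (q * b) + \<tau> (q * b)" unfolding q(3)[OF b] by simp
    ultimately show "\<tau> ((q + q - p) * b) = 0"
      using q(1) p by (simp add: projD left_diff_distrib distrib_right)
  qed (use p q qp in \<open>auto simp: projD algebra_simps\<close>)
qed

section \<open>Comparison of projections\<close>

text \<open>Primeness gives a nonzero \<open>D = q * z * p\<close>. Instead of taking its polar
  decomposition, \<open>star D * D\<close> is compressed to a scalar on a projection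
  \<open>r\<close> below the range of \<open>star D\<close>, where \<open>D\<close> is a multiple of
  a partial isometry.\<close>

lemma equivalent_subprojections:
  assumes p: "proj p" "p \<noteq> 0" and q: "proj q" "q \<noteq> 0"
  shows "\<exists>w. partial_isometry w \<and> w \<noteq> 0 \<and> p * (star w * w) = star w * w \<and> q * w = w"
proof -
  obtain z where z: "z \<in> M" "q * z * p \<noteq> 0" using prime[of q p] p q by (auto simp: projD)
  define D where "D = q * z * p"
  have D: "D \<in> M" "D \<noteq> 0" using z p q by (auto simp: D_def projD)
  obtain s where s: "proj s" "s * star D = star D" "\<And>b. b \<in> M \<Longrightarrow> b * star D = 0 \<Longrightarrow> b * s = 0"
    using range_projection[of "star D"] D by auto
  have "s \<noteq> 0" using s(2) D star_eq_0 by auto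
  then obtain r l where r: "proj r" "r \<noteq> 0" "s * r = r" "r * (star D * D) * r = \<iota> l * r"
    using scalar_compression_single[OF s(1), of "star D * D"] D by auto
  \<comment> \<open>As \<open>r\<close> lies below the range projection of \<open>star D\<close>, it
    cannot be annihilated by \<open>D\<close>.\<close>
  have "D * r \<noteq> 0"
  proof
    assume "D * r = 0"
    then have "star (D * r) = 0" by simp
    then have "r * star D = 0" using D r by (simp add: projD)
    then have "r * s = 0" using s r projD by blast
    then show False using r s proj_orth by metis
  qed
  moreover have "star (D * r) * (D * r) = \<iota> l * r" using r D by (simp add: projD mult.assoc)
  ultimately obtain m where m: "star (\<iota> m * (D * r)) * (\<iota> m * (D * r)) = r"
    using normalize[of "D * r" r l] r D by (auto simp: projD)
  define w where "w = \<iota> m * (D * r)"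
  have w: "w \<in> M" "star w * w = r" using m r D by (simp_all add: w_def projD)
  have "(1 - p) * star D = 0" using z p q by (simp add: D_def left_diff_distrib projD mult.assoc proj_idem)
  then have "(1 - p) * s = 0" using s p by (simp add: projD)
  then have "p * s = s" by (simp add: left_diff_distrib)
  then have "p * r = r" using r(3) by (metis mult.assoc)
  moreover have "q * w = w"
    using q by (simp add: w_def D_def scalar_left_comm[of q] projD mult.assoc proj_idem)
  moreover have "partial_isometry w" using w r by (simp add: partial_isometry_def)
  moreover have "w \<noteq> 0" using w r by auto
  ultimately show ?thesis using w by blast
qed

text \<open>Among partial isometries from below \<open>p\<close> into \<open>q\<close>, one of
  maximal initial trace has range \<open>q\<close>: a remainder in \<open>q\<close> forces one in
  \<open>p\<close> by the trace hypothesis, and equivalent subprojections of the two remainders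
  would extend it.\<close>

lemma comparison:
  assumes p: "proj p" and q: "proj q" and le: "tr q \<le> tr p"
  shows "\<exists>w. partial_isometry w \<and> w * star w = q \<and> p * (star w * w) = star w * w"
proof -
  define Z where "Z = {w. partial_isometry w \<and> p * (star w * w) = star w * w \<and> q * w = w}"
  have Z0: "0 \<in> Z" by (simp add: Z_def partial_isometry_def)
  obtain w where wZ: "w \<in> Z" and w: "\<And>w'. w' \<in> Z \<Longrightarrow> extends w' w \<Longrightarrow> tr (star w' * w') = tr (star w * w)"
  proof (rule exhaustion[where Z = Z and R = "\<lambda>x y. extends y x" and \<mu> = "\<lambda>w. tr (star w * w)" and K = 1])
    show "0 \<in> Z" by fact
    show "extends x x" if "x \<in> Z" for x using that by (auto simp: Z_def intro: extends_refl)
    show "extends z x" if "extends y x" "extends z y" for x y z :: 'a using that extends_trans by blast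
    show "tr (star x * x) \<le> tr (star y * y)" if "x \<in> Z" "y \<in> Z" "extends y x" for x y
      using that by (auto simp: Z_def intro: extends_tr)
    show "tr (star x * x) \<le> 1" if "x \<in> Z" for x
      using that by (auto simp: Z_def intro: proj_tr_le_1 partial_isometryD)
  next
    fix f :: "nat \<Rightarrow> 'a" assume f: "\<And>n. f n \<in> Z" "\<And>m n. m \<le> n \<Longrightarrow> extends (f n) (f m)"
    obtain u where u: "partial_isometry u" "\<And>n. extends u (f n)"
      "(\<lambda>n. \<tau> (star (f n) * f n)) \<longlonglongrightarrow> \<tau> (star u * u)"
      using partial_isometry_limit[of f] f by (auto simp: Z_def)
    have fn: "partial_isometry (f n)" "p * (star (f n) * f n) = star (f n) * f n" "q * f n = f n" for n
      using f(1)[of n] by (auto simp: Z_def)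
    define P where "P n = star (f n) * f n" for n
    have P: "proj (P n)" for n using fn by (simp add: P_def partial_isometryD)
    have uP: "u * P n = f n" "star u * u * P n = P n" for n using u(2)[of n] by (auto simp: extends_def P_def)
    have PP: "P n * P m = P m" if "m \<le> n" for m n using f(2)[OF that] by (simp add: extends_def P_def)
    obtain s where s: "proj s" "\<And>n. s * P n = P n" "\<And>b. b \<in> M \<Longrightarrow> (\<lambda>n. \<tau> (P n * b)) \<longlonglongrightarrow> \<tau> (s * b)"
      "\<And>b. b \<in> M \<Longrightarrow> (\<And>n. b * P n = 0) \<Longrightarrow> b * s = 0"
      using proj_sup[of P] P PP by blast
    let ?S = "star u * u"
    have S: "proj ?S" "u \<in> M" using u by (auto simp: partial_isometryD)
    \<comment> \<open>The supremum \<open>s\<close> of the initial projections lies below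
      \<open>star u * u\<close> and has the same trace, so they coincide. This carries the bounds by
      \<open>p\<close> and \<open>q\<close> from the sequence to \<open>u\<close>.\<close>
    have "(1 - ?S) * s = 0" using S uP by (intro s(4)) (auto simp: projD left_diff_distrib)
    then have Ss: "?S * s = s" by (simp add: left_diff_distrib)
    have "(\<lambda>n. \<tau> (P n)) \<longlonglongrightarrow> \<tau> s" using s(3)[of 1] by simp
    then have "\<tau> s = \<tau> ?S" using u(3) LIMSEQ_unique by (auto simp: P_def)
    then have "tr (?S - s) = 0" using S s by (simp add: tr_def projD)
    then have "?S - s = 0" using proj_tr_eq_0[OF proj_diff[OF S(1) s(1) Ss]] by blast
    then have sS: "s = ?S" by simp
    have "(1 - p) * s = 0" using fn p by (intro s(4)) (auto simp: projD left_diff_distrib P_def)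
    then have 1: "p * ?S = ?S" by (simp add: left_diff_distrib sS)
    have "(1 - q) * u * s = 0"
      using fn q S uP by (intro s(4)) (auto simp: projD left_diff_distrib mult.assoc)
    then have "q * u = u"
      using partial_isometry_mult[OF u(1)] by (simp add: sS mult.assoc left_diff_distrib)
    then show "\<exists>z\<in>Z. \<forall>n. extends z (f n)" using u 1 by (auto simp: Z_def)
  qed (blast intro: that)
  have w': "partial_isometry w" "w \<in> M" "proj (star w * w)" "p * (star w * w) = star w * w" "q * w = w"
    using wZ by (auto simp: Z_def partial_isometryD)
  have R: "proj (w * star w)" using range_proj w' by blast
  have qR: "q * (w * star w) = w * star w" using w' by (simp add: mult.assoc[symmetric])
  have "q - w * star w = 0"
  proof (rule ccontr)
    assume ne: "q - w * star w \<noteq> 0"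
    have e: "proj (q - w * star w)" using proj_diff q R qR by blast
    have "tr q - tr (w * star w) > 0" using proj_tr_pos[OF e ne] q w' by (simp add: tr_diff projD)
    then have "tr (p - star w * w) > 0" using le p w' by (simp add: tr_diff tr_range projD)
    then have d: "proj (p - star w * w)" "p - star w * w \<noteq> 0"
      using proj_diff p w' by (auto simp: tr_def)
    obtain t where t: "partial_isometry t" "t \<noteq> 0" "(p - star w * w) * (star t * t) = star t * t"
      "(q - w * star w) * t = t"
      using equivalent_subprojections[OF d e ne] by blast
    have t': "t \<in> M" "proj (star t * t)" using t by (auto simp: partial_isometryD)
    have "star w * w * (p - star w * w) = 0"
      using w' p proj_commute[of p "star w * w"] by (simp add: right_diff_distrib projD)
    then have wt: "star w * w * (star t * t) = 0" using sub_orth t(3) by blast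
    have "star w * (q - w * star w) = 0"
    proof -
      have "star w * q = star w" using star_mult[of q w] w' q by (simp add: projD)
      moreover have "star w * (w * star w) = star w"
        using arg_cong[OF partial_isometry_mult[OF w'(1)], of star] w' by (simp add: mult.assoc)
      ultimately show ?thesis by (simp add: right_diff_distrib)
    qed
    then have "star w * t = 0" using sub_orth t(4) by blast
    then have tw: "star t * w = 0" using w' t' by (metis star_0 star_M star_mult star_star)
    note add = partial_isometry_add[OF w'(1) t(1) proj_orth[OF w'(3) t'(2) wt] tw]
    have "p * (p - star w * w) = p - star w * w" using p w' by (simp add: right_diff_distrib projD)
    then have pt: "p * (star t * t) = star t * t" using t(3) by (metis mult.assoc)
    have "q * (q - w * star w) = q - w * star w" using q qR by (simp add: right_diff_distrib projD)
    then have qt: "q * t = t" using t(4) by (metis mult.assoc)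
    have "w + t \<in> Z" using add pt qt w' by (simp add: Z_def distrib_left)
    then have "tr (star (w + t) * (w + t)) = tr (star w * w)" using w add(3) by blast
    then have "tr (star t * t) = 0" unfolding add(2) using w' t' by (simp add: tr_add)
    then have "star t * t = 0" using t' proj_tr_eq_0 by blast
    then show False using t t' star_mult_self_0 by blast
  qed
  then show ?thesis using w' by (intro exI[of _ w]) auto
qed

section \<open>Balanced partial isometries\<close>

text \<open>Here \<open>d n\<close> stands on both sides of \<open>x\<close>. Cauchy-Schwarz splits
  the trace into the squared trace norms of \<open>star x * d n\<close> and \<open>d n * a\<close>;
  by traciality each of them is a functional of a single \<open>d n\<close>.\<close>

lemma trace_sandwich_tendsto_0:
  assumes d: "\<And>n. proj (d n)" and x: "x \<in> M" and a: "a \<in> M" and lim: "(\<lambda>n. tr (d n)) \<longlonglongrightarrow> 0"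
  shows "(\<lambda>n. \<tau> (d n * x * d n * a)) \<longlonglongrightarrow> 0"
proof -
  have n: "nrm2 (star z * d n) = Re (\<tau> (d n * (z * star z)))" if "z \<in> M" for z n
  proof -
    have "\<tau> (d n * (z * (star z * d n))) = \<tau> (d n * (z * star z))"
      using that d trace_commute[of "d n * z * star z" "d n"] by (simp add: projD mult.assoc proj_idem)
    then show ?thesis using that d by (simp add: nrm2_def projD mult.assoc)
  qed
  have l: "(\<lambda>n. nrm2 (star z * d n)) \<longlonglongrightarrow> 0" if "z \<in> M" for z
    using tendsto_Re[OF proj_trace_tendsto_0[OF d _ lim, of "z * star z"]] that by (simp add: n)
  have eq: "nrm2 (d n * a) = nrm2 (star a * d n)" for n
  proof -
    have "\<tau> (star a * (d n * a)) = \<tau> (d n * a * star a)"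
      using a d trace_commute[of "star a" "d n * a"] by (simp add: projD)
    then have "nrm2 (d n * a) = Re (\<tau> (d n * (a * star a)))"
      using a d by (simp add: nrm2_def projD mult.assoc proj_idem)
    then show ?thesis unfolding n[OF a] .
  qed
  have "(\<lambda>n. nrm2 (star x * d n) * nrm2 (d n * a)) \<longlonglongrightarrow> 0 * 0"
    unfolding eq using x a by (intro tendsto_mult l)
  then have l0: "(\<lambda>n. nrm2 (star x * d n) * nrm2 (d n * a)) \<longlonglongrightarrow> 0" by simp
  have "(cmod (\<tau> (d n * x * d n * a)))\<^sup>2 \<le> nrm2 (star x * d n) * nrm2 (d n * a)" for n
    using trace_cauchy_schwarz[of "star x * d n" "d n * a"] x a d
    by (simp add: projD mult.assoc proj_idem)
  then have "(\<lambda>n. (cmod (\<tau> (d n * x * d n * a)))\<^sup>2) \<longlonglongrightarrow> 0"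
    by (intro tendsto_sandwich[OF _ _ tendsto_const l0]) (simp_all add: always_eventually)
  then have "(\<lambda>n. sqrt ((cmod (\<tau> (d n * x * d n * a)))\<^sup>2)) \<longlonglongrightarrow> sqrt 0" by (rule tendsto_real_sqrt)
  then have "(\<lambda>n. cmod (\<tau> (d n * x * d n * a))) \<longlonglongrightarrow> 0" by simp
  then show ?thesis by (rule tendsto_norm_zero_cancel)
qed

text \<open>The condition without \<open>x\<close> is the instance \<open>x = 1\<close> of the other
  one, which lets a single limit argument serve both.\<close>

definition balanced :: "'a set \<Rightarrow> 'a set \<Rightarrow> 'a \<Rightarrow> bool" where
  "balanced X Y v \<longleftrightarrow> partial_isometry v \<and> (\<forall>y\<in>Y. \<tau> (y * (v * star v)) = 0) \<and>
     (\<forall>x\<in>X. \<forall>y\<in>Y. \<tau> (y * (v * x * star v)) = 0)"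

text \<open>The conditions are quadratic in \<open>v\<close>. With \<open>f n = u * p n\<close> and
  \<open>d n = P - p n\<close>, the value at \<open>u\<close> differs from the value
  \<open>0\<close> at \<open>f n\<close> by two terms linear in \<open>d n\<close> and one
  containing it twice, and \<open>tr (d n)\<close> tends to \<open>0\<close>.\<close>

lemma balanced_limit:
  assumes X: "X \<subseteq> M" and Y: "Y \<subseteq> M"
    and f: "\<And>n. balanced X Y (f n)" "\<And>m n. m \<le> n \<Longrightarrow> extends (f n) (f m)"
  shows "\<exists>u. balanced X Y u \<and> (\<forall>n::nat. extends u (f n))"
proof -
  obtain u where u: "partial_isometry u" "\<And>n. extends u (f n)"
    "(\<lambda>n. \<tau> (star (f n) * f n)) \<longlonglongrightarrow> \<tau> (star u * u)"
    using partial_isometry_limit[of f] f by (auto simp: balanced_def)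
  define p where "p n = star (f n) * f n" for n
  have p: "proj (p n)" for n using f(1)[of n] by (simp add: p_def balanced_def partial_isometryD)
  define P where "P = star u * u"
  have P: "proj P" "u \<in> M" "u * P = u" using u by (auto simp: P_def partial_isometryD partial_isometry_mult)
  have up: "u * p n = f n" "P * p n = p n" for n using u(2)[of n] by (auto simp: extends_def p_def P_def)
  define d where "d n = P - p n" for n
  have d: "proj (d n)" for n unfolding d_def using P p up by (intro proj_diff)
  have "(\<lambda>n. Re (\<tau> P - \<tau> (p n))) \<longlonglongrightarrow> Re (\<tau> P - \<tau> P)"
    using u(3) by (intro tendsto_intros) (simp add: p_def P_def)
  then have trd: "(\<lambda>n. tr (d n)) \<longlonglongrightarrow> 0" using P p by (simp add: d_def tr_def projD)
  have sf: "star (f n) = p n * star u" for n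
    using arg_cong[OF up(1)[of n], of star] P p by (simp add: projD)
  have Pu: "P * star u = star u" using star_mult[of u P] P by (simp add: projD)
  have *: "\<tau> (y * (u * x * star u)) = 0"
    if x: "x \<in> M" and y: "y \<in> M" and 0: "\<And>n. \<tau> (y * (f n * x * star (f n))) = 0" for x y
  proof -
    define a where "a = star u * y * u"
    have a: "a \<in> M" using y P by (simp add: a_def)
    have eq: "\<tau> (y * (u * x * star u)) = \<tau> (d n * (x * P * a)) + \<tau> (d n * (a * P * x)) - \<tau> (d n * x * d n * a)" for n
    proof -
      have "u * (P * x * P) * star u = u * P * x * (P * star u)" by (simp only: mult.assoc)
      then have "\<tau> (y * (u * x * star u)) = \<tau> (y * (u * (P * x * P) * star u))"
        by (simp only: P(3) Pu)
      also have "\<dots> = \<tau> (y * u * (P * x * P * star u))" by (simp add: mult.assoc)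
      also have "\<dots> = \<tau> (P * x * P * star u * (y * u))"
        using x y P by (intro trace_commute) (auto simp: projD)
      also have "\<dots> = \<tau> (P * x * P * a)" by (simp add: a_def mult.assoc)
      finally have 1: "\<tau> (y * (u * x * star u)) = \<tau> (P * x * P * a)" .
      have "f n * x * star (f n) = u * p n * x * (p n * star u)" by (simp only: sf up(1))
      then have "y * (f n * x * star (f n)) = y * u * (p n * x * p n * star u)"
        by (simp only: mult.assoc)
      then have "0 = \<tau> (y * u * (p n * x * p n * star u))" using 0[of n] by (simp only:)
      also have "\<dots> = \<tau> (p n * x * p n * star u * (y * u))"
        using x y P p by (intro trace_commute) (auto simp: projD)
      also have "\<dots> = \<tau> (p n * x * p n * a)" by (simp add: a_def mult.assoc)
      finally have 2: "\<tau> (p n * x * p n * a) = 0" by simp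
      have "P * x * P * a = p n * x * p n * a + d n * (x * P * a) + P * x * d n * a - d n * x * d n * a"
        by (simp add: d_def algebra_simps)
      then have "\<tau> (P * x * P * a) = \<tau> (p n * x * p n * a) + \<tau> (d n * (x * P * a)) + \<tau> (P * x * d n * a) - \<tau> (d n * x * d n * a)"
        using x a P p d by (simp add: projD)
      moreover have "\<tau> (P * x * d n * a) = \<tau> (d n * (a * P * x))"
        using trace_commute[of "P * x" "d n * a"] x a P d by (simp add: projD mult.assoc)
      ultimately show ?thesis using 1 2 by simp
    qed
    have "(\<lambda>n. \<tau> (d n * (x * P * a)) + \<tau> (d n * (a * P * x)) - \<tau> (d n * x * d n * a)) \<longlonglongrightarrow> 0 + 0 - 0"
      using x a P d trd by (intro tendsto_intros proj_trace_tendsto_0 trace_sandwich_tendsto_0) (auto simp: projD)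
    then have "(\<lambda>n::nat. \<tau> (y * (u * x * star u))) \<longlonglongrightarrow> 0" unfolding eq[symmetric] by simp
    then show ?thesis by (simp add: LIMSEQ_const_iff)
  qed
  have "balanced X Y u"
    unfolding balanced_def
  proof (intro conjI ballI)
    show "\<tau> (y * (u * star u)) = 0" if "y \<in> Y" for y
      using *[of 1 y] that Y f(1) by (auto simp: balanced_def)
    show "\<tau> (y * (u * x * star u)) = 0" if "x \<in> X" "y \<in> Y" for x y
      using *[of x y] that X Y f(1) by (auto simp: balanced_def)
  qed fact
  then show ?thesis using u(2) by blast
qed

text \<open>The new block starts at a projection compressing \<open>X\<close> to scalars and ends at a projection
  on which \<open>Y\<close> has trace zero, so it contributes nothing by itself. A symmetry
  inside the block enters linearly in the cross terms, which it can therefore be chosen to kill.\<close>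
lemma balanced_extension:
  assumes X: "finite X" "X \<subseteq> M" and Y: "finite Y" "Y \<subseteq> M" "\<And>y. y \<in> Y \<Longrightarrow> \<tau> y = 0"
    and v: "balanced X Y v" "star v * v \<noteq> 1"
  shows "\<exists>v'. balanced X Y v' \<and> extends v' v \<and> tr (star v * v) < tr (star v' * v')"
proof -
  have vp: "partial_isometry v" "v \<in> M" "proj (star v * v)" "proj (v * star v)"
    using v by (auto simp: balanced_def partial_isometryD range_proj)
  define e where "e = 1 - star v * v"
  define f where "f = 1 - v * star v"
  have e: "proj e" "e \<noteq> 0" using vp v proj_diff[of 1 "star v * v"] by (auto simp: e_def)
  have f: "proj f" using vp proj_diff[of 1 "v * star v"] by (auto simp: f_def)
  \<comment> \<open>Finiteness enters here: by traciality, room left in the initial space means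
    equal room left in the range.\<close>
  have "tr f = tr e" using vp by (simp add: e_def f_def tr_diff tr_range)
  then have trf: "tr f > 0" using proj_tr_pos e by simp
  obtain r where r: "proj r" "r \<noteq> 0" "e * r = r" "\<And>x. x \<in> X \<Longrightarrow> \<exists>l. r * x * r = \<iota> l * r"
    using scalar_compression[OF X e] by blast
  have trr: "tr r > 0" using proj_tr_pos r by blast
  \<comment> \<open>This \<open>k\<close> makes the dyadic part of \<open>f\<close> smaller in trace
    than \<open>r\<close>, as \<open>comparison\<close> requires.\<close>
  obtain k where k: "(1/2) ^ k < tr r / tr f"
    using real_arch_pow_inv[of "tr r / tr f" "1/2"] trf trr by auto
  obtain q where q: "proj q" "f * q = q" "tr q = tr f / 2 ^ k" "\<And>y. y \<in> Y \<Longrightarrow> \<tau> (q * y) = \<tau> (f * y) / 2 ^ k"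
    using dyadic_fraction[OF Y(1,2) f] by blast
  have qY: "\<tau> (y * q) = 0" if y: "y \<in> Y" for y
  proof -
    have yM: "y \<in> M" using y Y by blast
    have "\<tau> (y * (v * star v)) = 0" using v y by (simp add: balanced_def)
    then have "\<tau> (v * star v * y) = 0" using trace_commute[of y "v * star v"] yM vp by simp
    then have "\<tau> (f * y) = 0" using yM vp Y(3)[OF y] by (simp add: f_def left_diff_distrib)
    then show ?thesis using q(4)[OF y] trace_commute[of y q] yM q by (simp add: projD)
  qed
  have "tr f / 2 ^ k < tr r" using k trf by (simp add: field_simps power_one_over)
  then have "tr q < tr r" using q(3) by simp
  then obtain w0 where w0: "partial_isometry w0" "w0 * star w0 = q" "r * (star w0 * w0) = star w0 * w0"
    using comparison[OF r(1) q(1)] by auto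
  define s where "s = star w0 * w0"
  have s: "proj s" "w0 \<in> M" "r * s = s" "w0 * s = w0"
    using w0 by (auto simp: s_def partial_isometryD partial_isometry_mult)
  have "tr s = tr q" using tr_range[of w0] w0 s by (simp add: s_def)
  then have trs: "tr s > 0" using q(3) trf by simp
  \<comment> \<open>For \<open>w = w0 * \<epsilon>\<close>, cyclic permutation turns the cross terms
    \<open>\<tau> (y * (v * x * star w))\<close> and \<open>\<tau> (y * (w * x * star v))\<close>
    into \<open>\<tau> (\<epsilon> * b)\<close> with \<open>b\<close> of these two kinds.\<close>
  define B where "B = (\<lambda>(x, y). star w0 * y * v * x) ` (X \<times> Y) \<union> (\<lambda>(x, y). x * star v * y * w0) ` (X \<times> Y)"
  have B: "finite B" "B \<subseteq> M" using X(1) Y(1) s(2) vp(2) subsetD[OF X(2)] subsetD[OF Y(2)]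
    by (auto simp: B_def)
  obtain \<epsilon> where eps: "\<epsilon> \<in> M" "star \<epsilon> = \<epsilon>" "\<epsilon> * \<epsilon> = s" "s * \<epsilon> = \<epsilon>" "\<And>b. b \<in> B \<Longrightarrow> \<tau> (\<epsilon> * b) = 0"
    using balanced_symmetry[OF B s(1)] by blast
  have eps': "\<epsilon> * s = \<epsilon>" using star_mult[of s \<epsilon>] eps(1,2,4) s(1) by (simp add: projD)
  define w where "w = w0 * \<epsilon>"
  have sw: "star w = \<epsilon> * star w0" using eps s by (simp add: w_def)
  have wM: "w \<in> M" using eps s by (simp add: w_def)
  have sww: "star w * w = s"
  proof -
    have "star w * w = \<epsilon> * s * \<epsilon>" unfolding sw by (simp add: w_def s_def mult.assoc)
    then show ?thesis using eps eps' by simp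
  qed
  have wws: "w * star w = q"
  proof -
    have "w * star w = w0 * (\<epsilon> * \<epsilon>) * star w0" unfolding sw by (simp add: w_def mult.assoc)
    then show ?thesis using eps s w0 by simp
  qed
  have w: "partial_isometry w" using wM sww s by (simp add: partial_isometry_def)
  have es: "e * s = s" using r s by (metis mult.assoc)
  have pe: "star v * v * e = 0" using vp(3) by (simp add: e_def right_diff_distrib projD)
  have ps: "star v * v * s = 0" using sub_orth pe es by blast
  have src: "star w * w * (star v * v) = 0" unfolding sww using proj_orth[OF vp(3) s(1) ps] .
  have fv: "f * v = 0" using partial_isometry_mult[OF vp(1)] by (simp add: f_def left_diff_distrib mult.assoc)
  have "q * f = q" using proj_commute f q by blast
  then have qv: "q * v = 0" using fv by (metis mult.assoc mult_zero_right)
  have wq: "w * s = w" using eps' by (simp add: w_def mult.assoc)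
  have "star w * q = star w" unfolding wws[symmetric]
    using arg_cong[OF partial_isometry_mult[OF w], of star] wM by (simp add: mult.assoc)
  then have rng: "star w * v = 0" using qv by (metis mult.assoc mult_zero_right)
  note add = partial_isometry_add[OF vp(1) w src rng]
  have ssw: "s * star w = star w" using star_mult[of w s] wM s wq by (simp add: projD)
  have vw: "v * star w = 0"
  proof -
    have "v * star w = v * (star v * v) * (s * star w)"
      by (simp only: ssw partial_isometry_mult[OF vp(1)])
    also have "\<dots> = v * (star v * v * s) * star w" by (simp add: mult.assoc)
    finally show ?thesis using ps by simp
  qed
  have wv: "w * star v = 0" using arg_cong[OF vw, of star] wM vp by simp
  have "balanced X Y (v + w)"
    unfolding balanced_def
  proof (intro conjI ballI)
    fix y assume y: "y \<in> Y"
    then have yM: "y \<in> M" using Y by blast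
    have "(v + w) * star (v + w) = v * star v + q"
      using vp wM vw wv by (simp add: distrib_left distrib_right wws)
    then show "\<tau> (y * ((v + w) * star (v + w))) = 0"
      using v y qY[OF y] yM vp q by (simp add: distrib_left projD balanced_def)
    fix x assume x: "x \<in> X"
    then have xM: "x \<in> M" using X by blast
    obtain l where "r * x * r = \<iota> l * r" using r x by blast
    then have l: "s * x * s = \<iota> l * s" using compress_sub r s xM by blast
    have "w * x * star w = w * s * x * (s * star w)"
      by (simp only: wq ssw)
    also have "\<dots> = w * (s * x * s) * star w" by (simp add: mult.assoc)
    also have "\<dots> = \<iota> l * (w * s * star w)" unfolding l using wM by (simp add: scalar_left_comm[of w] mult.assoc)
    finally have wxw: "w * x * star w = \<iota> l * q" by (simp add: wq wws)
    have c1: "\<tau> (y * (v * x * star w)) = 0"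
    proof -
      have "\<tau> (y * (v * x * star w)) = \<tau> (y * v * x * \<epsilon> * star w0)" by (simp add: sw mult.assoc)
      also have "\<dots> = \<tau> (star w0 * (y * v * x * \<epsilon>))"
        using yM xM vp eps s by (intro trace_commute) auto
      also have "\<dots> = \<tau> (star w0 * y * v * x * \<epsilon>)" by (simp add: mult.assoc)
      also have "\<dots> = \<tau> (\<epsilon> * (star w0 * y * v * x))"
        using yM xM vp eps s by (intro trace_commute) auto
      also have "\<dots> = 0" using x y by (intro eps(5)) (auto simp: B_def)
      finally show ?thesis .
    qed
    have c2: "\<tau> (y * (w * x * star v)) = 0"
    proof -
      have "\<tau> (y * (w * x * star v)) = \<tau> (y * w0 * (\<epsilon> * x * star v))" by (simp add: w_def mult.assoc)
      also have "\<dots> = \<tau> (\<epsilon> * x * star v * (y * w0))"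
        using yM xM vp eps s by (intro trace_commute) auto
      also have "\<dots> = \<tau> (\<epsilon> * (x * star v * y * w0))" by (simp add: mult.assoc)
      also have "\<dots> = 0" using x y by (intro eps(5)) (auto simp: B_def)
      finally show ?thesis .
    qed
    have c3: "\<tau> (y * (w * x * star w)) = 0"
      unfolding wxw using qY[OF y] yM q by (simp add: scalar_left_comm[of y] projD)
    have c0: "\<tau> (y * (v * x * star v)) = 0" using v x y by (simp add: balanced_def)
    have "y * ((v + w) * x * star (v + w)) = y * (v * x * star v) + y * (v * x * star w)
        + y * (w * x * star v) + y * (w * x * star w)"
      using vp wM by (simp add: algebra_simps)
    then show "\<tau> (y * ((v + w) * x * star (v + w))) = 0"
      using c0 c1 c2 c3 yM xM vp wM by simp
  qed (fact add(1))
  moreover have "tr (star v * v) < tr (star (v + w) * (v + w))"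
    unfolding add(2) using vp s trs by (simp add: tr_add projD sww)
  ultimately show ?thesis using add(3) by blast
qed

text \<open>By \<open>balanced_extension\<close>, a balanced partial isometry of maximal initial
  trace is an isometry. Its range then has trace \<open>1\<close>, so the complement of the range
  vanishes and it is unitary.\<close>

theorem orthogonalizing_unitary:
  assumes X: "finite X" "X \<subseteq> M" and Y: "finite Y" "Y \<subseteq> M" "\<And>y. y \<in> Y \<Longrightarrow> \<tau> y = 0"
  shows "\<exists>u\<in>M. star u * u = 1 \<and> u * star u = 1 \<and> (\<forall>x\<in>X. \<forall>y\<in>Y. \<tau> (y * (u * x * star u)) = 0)"
proof -
  define Z where "Z = Collect (balanced X Y)"
  have Z0: "0 \<in> Z" by (simp add: Z_def balanced_def partial_isometry_def)
  have ZP: "partial_isometry x" if "x \<in> Z" for x using that by (simp add: Z_def balanced_def)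
  obtain u where uZ: "u \<in> Z" and u: "\<And>w. w \<in> Z \<Longrightarrow> extends w u \<Longrightarrow> tr (star w * w) = tr (star u * u)"
  proof (rule exhaustion[where Z = Z and R = "\<lambda>x y. extends y x" and \<mu> = "\<lambda>w. tr (star w * w)" and K = 1])
    show "0 \<in> Z" by fact
    show "extends x x" if "x \<in> Z" for x using that ZP by (auto intro: extends_refl)
    show "extends z x" if "extends y x" "extends z y" for x y z :: 'a using that extends_trans by blast
    show "tr (star x * x) \<le> tr (star y * y)" if "x \<in> Z" "y \<in> Z" "extends y x" for x y
      using that ZP by (auto intro: extends_tr)
    show "tr (star x * x) \<le> 1" if "x \<in> Z" for x
      using that ZP by (auto intro: proj_tr_le_1 partial_isometryD)
  next
    fix f :: "nat \<Rightarrow> 'a" assume "\<And>n. f n \<in> Z" "\<And>m n. m \<le> n \<Longrightarrow> extends (f n) (f m)"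
    then show "\<exists>z\<in>Z. \<forall>n. extends z (f n)" using balanced_limit[of X Y f] X Y by (auto simp: Z_def)
  qed (blast intro: that)
  have uu: "star u * u = 1"
  proof (rule ccontr)
    assume "star u * u \<noteq> 1"
    then obtain w where "balanced X Y w" "extends w u" "tr (star u * u) < tr (star w * w)"
      using balanced_extension[OF X Y] uZ by (auto simp: Z_def)
    then show False using u[of w] by (simp add: Z_def)
  qed
  have uP: "partial_isometry u" "u \<in> M" using ZP uZ partial_isometryD by auto
  then have "proj (1 - u * star u)" using proj_diff[of 1 "u * star u"] range_proj by simp
  moreover have "tr (1 - u * star u) = 0" using uP uu by (simp add: tr_diff tr_range)
  ultimately have "1 - u * star u = 0" by (rule proj_tr_eq_0)
  then have "u * star u = 1" by simp
  then show ?thesis using uu uP uZ by (auto simp: Z_def balanced_def)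
qed

end

section \<open>Operators on a Hilbert space\<close>

locale hilbert_space =
  fixes sc :: "complex \<Rightarrow> 'h::ab_group_add \<Rightarrow> 'h" and ip :: "'h \<Rightarrow> 'h \<Rightarrow> complex"
  assumes complex_hilbert: "complex_hilbert sc ip"
begin

sublocale vector_space sc
  using complex_hilbert by (simp add: complex_hilbert_def)

abbreviation nrm :: "'h \<Rightarrow> real" where "nrm \<equiv> hnorm ip"

abbreviation bop :: "('h \<Rightarrow> 'h) \<Rightarrow> bool" where "bop \<equiv> bounded_op sc ip"

lemmas ip_axioms = complex_hilbert [unfolded complex_hilbert_def, THEN conjunct2]

lemma ip_commute: "ip x y = cnj (ip y x)"
  by (rule ip_axioms [THEN conjunct1, THEN spec, THEN spec])

lemma ip_add_right: "ip x (y + z) = ip x y + ip x z"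
  using ip_axioms [THEN conjunct2, THEN conjunct1] by blast

lemma ip_scale_right: "ip x (sc c y) = c * ip x y"
  using ip_axioms [THEN conjunct2, THEN conjunct2, THEN conjunct1] by blast

lemma ip_nonneg: "0 \<le> Re (ip x x)"
  using ip_axioms [THEN conjunct2, THEN conjunct2, THEN conjunct2, THEN conjunct1] by blast

lemma ip_eq_0: "ip x x = 0 \<Longrightarrow> x = 0"
  using ip_axioms [THEN conjunct2, THEN conjunct2, THEN conjunct2, THEN conjunct2, THEN conjunct1] by blast

lemma complete:
  assumes "\<And>e. e > 0 \<Longrightarrow> \<exists>N. \<forall>m\<ge>N. \<forall>n\<ge>N. nrm (X m - X n) < e"
  shows "\<exists>L. (\<lambda>n::nat. nrm (X n - L)) \<longlonglongrightarrow> 0"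
  using ip_axioms [THEN conjunct2, THEN conjunct2, THEN conjunct2, THEN conjunct2, THEN conjunct2] assms
  by blast

lemma ip_add_left: "ip (x + y) z = ip x z + ip y z"
  by (metis ip_commute ip_add_right complex_cnj_add)

lemma ip_scale_left: "ip (sc c x) y = cnj c * ip x y"
  by (metis ip_commute ip_scale_right complex_cnj_mult)

lemma ip_zero_right [simp]: "ip x 0 = 0"
  using ip_add_right[of x 0 0] by simp

lemma ip_zero_left [simp]: "ip 0 x = 0"
  using ip_add_left[of 0 0 x] by simp

lemma ip_minus_right: "ip x (- y) = - ip x y"
  using ip_add_right[of x y "- y"] by (simp add: eq_neg_iff_add_eq_0 add.commute)

lemma ip_minus_left: "ip (- x) y = - ip x y"
  using ip_add_left[of x "- x" y] by (simp add: eq_neg_iff_add_eq_0 add.commute)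

lemma ip_diff_right: "ip x (y - z) = ip x y - ip x z"
  using ip_add_right[of x y "- z"] by (simp add: ip_minus_right)

lemma ip_diff_left: "ip (x - y) z = ip x z - ip y z"
  using ip_add_left[of x "- y" z] by (simp add: ip_minus_left)

lemmas ip_simps = ip_add_left ip_add_right ip_diff_left ip_diff_right ip_scale_left ip_scale_right
  ip_minus_left ip_minus_right

lemma nrm_nonneg [simp]: "0 \<le> nrm x"
  by (simp add: hnorm_def ip_nonneg)

lemma nrm_sq: "(nrm x)\<^sup>2 = Re (ip x x)"
  by (simp add: hnorm_def ip_nonneg)

lemma ip_self: "ip x x = complex_of_real ((nrm x)\<^sup>2)"
  using ip_commute[of x x] by (simp add: nrm_sq complex_eq_iff)

lemma nrm_eq_0: "nrm x = 0 \<Longrightarrow> x = 0"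
  using ip_self[of x] ip_eq_0[of x] by simp

lemma nrm_0 [simp]: "nrm 0 = 0"
  by (simp add: hnorm_def)

lemma ip_ext: "(\<And>y. ip y x = ip y z) \<Longrightarrow> x = z"
  using ip_eq_0[of "x - z"] by (simp add: ip_simps)

lemma ip_ext_left: "(\<And>y. ip x y = ip z y) \<Longrightarrow> x = z"
  by (metis ip_commute ip_ext)

lemma nrm_scale: "nrm (sc c x) = cmod c * nrm x"
proof -
  have "(nrm (sc c x))\<^sup>2 = Re (cnj c * c * ip x x)" by (simp add: nrm_sq ip_simps mult.assoc mult.left_commute)
  also have "cnj c * c = complex_of_real ((cmod c)\<^sup>2)" by (metis complex_norm_square mult.commute)
  also have "Re (complex_of_real ((cmod c)\<^sup>2) * ip x x) = (cmod c * nrm x)\<^sup>2"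
    by (simp add: nrm_sq power_mult_distrib)
  finally show ?thesis by (simp add: power2_eq_iff_nonneg)
qed

lemma nrm_minus: "nrm (- x) = nrm x"
  by (simp add: hnorm_def ip_simps)

lemma nrm_minus_commute: "nrm (x - y) = nrm (y - x)"
  using nrm_minus[of "x - y"] by simp

text \<open>With a real multiple of \<open>ip l z\<close> as coefficient, the mixed terms become
  real multiples of a squared modulus. The optimal \<open>t\<close> gives Cauchy-Schwarz; a small
  \<open>t\<close> gives orthogonality at a nearest point.\<close>

lemma nrm_diff_scale_sq:
  "(nrm (z - sc (complex_of_real t * ip l z) l))\<^sup>2
     = (nrm z)\<^sup>2 - 2 * t * (cmod (ip l z))\<^sup>2 + t\<^sup>2 * (cmod (ip l z))\<^sup>2 * (nrm l)\<^sup>2"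
proof -
  define c where "c = ip l z"
  have cc: "cnj c * c = complex_of_real ((cmod c)\<^sup>2)" by (metis complex_norm_square mult.commute)
  have zl: "ip z l = cnj c" by (simp add: c_def ip_commute[of z l])
  have "ip (z - sc (complex_of_real t * c) l) (z - sc (complex_of_real t * c) l)
      = ip z z - 2 * t * (cnj c * c) + t * t * (cnj c * c) * ip l l"
    by (simp add: ip_simps zl c_def[symmetric] algebra_simps)
  also have "\<dots> = complex_of_real ((nrm z)\<^sup>2 - 2 * t * (cmod c)\<^sup>2 + t\<^sup>2 * (cmod c)\<^sup>2 * (nrm l)\<^sup>2)"
    unfolding cc ip_self by (simp add: power2_eq_square)
  finally show ?thesis by (simp only: nrm_sq[of "z - _"] c_def Re_complex_of_real)
qed

lemma cauchy_schwarz: "cmod (ip x y) \<le> nrm x * nrm y"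
proof (cases "nrm x = 0")
  case True
  then show ?thesis using nrm_eq_0[of x] by simp
next
  case False
  then have p: "nrm x > 0" using nrm_nonneg[of x] by linarith
  have "0 \<le> (nrm y)\<^sup>2 - 2 * (1 / (nrm x)\<^sup>2) * (cmod (ip x y))\<^sup>2 + (1 / (nrm x)\<^sup>2)\<^sup>2 * (cmod (ip x y))\<^sup>2 * (nrm x)\<^sup>2"
    unfolding nrm_diff_scale_sq[symmetric] by simp
  also have "\<dots> = (nrm y)\<^sup>2 - (cmod (ip x y))\<^sup>2 / (nrm x)\<^sup>2"
    using p by (simp add: field_simps power2_eq_square)
  finally have "(cmod (ip x y))\<^sup>2 \<le> (nrm x * nrm y)\<^sup>2" using p by (simp add: field_simps)
  then show ?thesis by (rule power2_le_imp_le) simp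
qed

lemma nrm_triangle: "nrm (x + y) \<le> nrm x + nrm y"
proof -
  have "(nrm (x + y))\<^sup>2 = (nrm x)\<^sup>2 + 2 * Re (ip x y) + (nrm y)\<^sup>2"
    using ip_commute[of y x] by (simp add: nrm_sq ip_simps)
  also have "\<dots> \<le> (nrm x)\<^sup>2 + 2 * (nrm x * nrm y) + (nrm y)\<^sup>2"
    using cauchy_schwarz[of x y] complex_Re_le_cmod[of "ip x y"] by linarith
  also have "\<dots> = (nrm x + nrm y)\<^sup>2" by (simp add: power2_eq_square algebra_simps)
  finally show ?thesis by (rule power2_le_imp_le) simp
qed

lemma nrm_triangle_diff: "nrm (x - z) \<le> nrm (x - y) + nrm (y - z)"
  using nrm_triangle[of "x - y" "y - z"] by simp

lemma parallelogram: "(nrm (x + y))\<^sup>2 + (nrm (x - y))\<^sup>2 = 2 * (nrm x)\<^sup>2 + 2 * (nrm y)\<^sup>2"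
  by (simp add: nrm_sq ip_simps)

text \<open>The type \<open>'h\<close> carries no topology, so convergence is stated through norms
  of differences.\<close>

definition tends :: "(nat \<Rightarrow> 'h) \<Rightarrow> 'h \<Rightarrow> bool" where
  "tends X L \<longleftrightarrow> (\<lambda>n. nrm (X n - L)) \<longlonglongrightarrow> 0"

lemma tendsI: "(\<And>n. nrm (X n - L) \<le> e n) \<Longrightarrow> e \<longlonglongrightarrow> 0 \<Longrightarrow> tends X L"
  unfolding tends_def by (rule tendsto_sandwich[OF _ _ tendsto_const]) (auto intro!: always_eventually)

lemma tends_const: "tends (\<lambda>n. x) x"
  by (simp add: tends_def)

lemma tends_add: "tends X x \<Longrightarrow> tends Y y \<Longrightarrow> tends (\<lambda>n. X n + Y n) (x + y)"
proof (rule tendsI)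
  show "nrm (X n + Y n - (x + y)) \<le> nrm (X n - x) + nrm (Y n - y)" for n
    using nrm_triangle[of "X n - x" "Y n - y"] by (simp add: algebra_simps)
  assume "tends X x" "tends Y y"
  then show "(\<lambda>n. nrm (X n - x) + nrm (Y n - y)) \<longlonglongrightarrow> 0"
    unfolding tends_def using tendsto_add_zero by blast
qed

lemma tends_ip: assumes "tends X x" "tends Y y" shows "(\<lambda>n. ip (X n) (Y n)) \<longlonglongrightarrow> ip x y"
proof -
  have "(\<lambda>n. ip (X n - x) (Y n - y) + ip (X n - x) y + ip x (Y n - y)) \<longlonglongrightarrow> 0 + 0 + 0"
  proof (intro tendsto_add)
    have n: "(\<lambda>n. nrm (X n - x)) \<longlonglongrightarrow> 0" "(\<lambda>n. nrm (Y n - y)) \<longlonglongrightarrow> 0"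
      using assms by (auto simp: tends_def)
    show "(\<lambda>n. ip (X n - x) (Y n - y)) \<longlonglongrightarrow> 0"
      by (rule Lim_null_comparison[where g = "\<lambda>n. nrm (X n - x) * nrm (Y n - y)"])
        (use n tendsto_mult_zero cauchy_schwarz in \<open>auto intro!: always_eventually\<close>)
    show "(\<lambda>n. ip (X n - x) y) \<longlonglongrightarrow> 0"
      by (rule Lim_null_comparison[where g = "\<lambda>n. nrm (X n - x) * nrm y"])
        (use n tendsto_mult_left_zero cauchy_schwarz in \<open>auto intro!: always_eventually\<close>)
    show "(\<lambda>n. ip x (Y n - y)) \<longlonglongrightarrow> 0"
      by (rule Lim_null_comparison[where g = "\<lambda>n. nrm x * nrm (Y n - y)"])
        (use n tendsto_mult_right_zero cauchy_schwarz in \<open>auto intro!: always_eventually\<close>)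
  qed
  then have "(\<lambda>n. ip (X n) (Y n) - ip x y) \<longlonglongrightarrow> 0"
    by (simp add: ip_simps)
  then show ?thesis by (simp add: LIM_zero_iff)
qed

lemma tends_nrm: assumes "tends X x" shows "(\<lambda>n. nrm (X n)) \<longlonglongrightarrow> nrm x"
  unfolding hnorm_def by (intro tendsto_real_sqrt tendsto_Re tends_ip assms)

lemma tends_unique: assumes "tends X x" "tends X y" shows "x = y"
proof (rule ip_ext)
  fix z
  show "ip z x = ip z y"
    using LIMSEQ_unique[OF tends_ip[OF tends_const assms(1)] tends_ip[OF tends_const assms(2)]] .
qed

section \<open>Bounded operators\<close>

lemma bop_add: "bop T \<Longrightarrow> T (x + y) = T x + T y"
  and bop_scale: "bop T \<Longrightarrow> T (sc c x) = sc c (T x)"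
  by (auto simp: bounded_op_def)

lemma bop_0: "bop T \<Longrightarrow> T 0 = 0"
  using bop_add[of T 0 0] by simp

lemma bop_minus: "bop T \<Longrightarrow> T (- x) = - T x"
  using bop_add[of T x "- x"] by (simp add: bop_0 eq_neg_iff_add_eq_0 add.commute)

lemma bop_diff: "bop T \<Longrightarrow> T (x - y) = T x - T y"
  using bop_add[of T x "- y"] by (simp add: bop_minus)

lemma bop_bound: assumes "bop T" obtains K where "K > 0" "\<And>x. nrm (T x) \<le> K * nrm x"
proof -
  obtain K where K: "\<And>x. nrm (T x) \<le> K * nrm x" using assms by (auto simp: bounded_op_def)
  have "nrm (T x) \<le> (\<bar>K\<bar> + 1) * nrm x" for x
    using K[of x] mult_right_mono[of K "\<bar>K\<bar> + 1" "nrm x"] by fastforce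
  then show thesis using that[of "\<bar>K\<bar> + 1"] by auto
qed

lemma bopI:
  assumes "\<And>x y. T (x + y) = T x + T y" "\<And>c x. T (sc c x) = sc c (T x)" "\<And>x. nrm (T x) \<le> K * nrm x"
  shows "bop T"
  using assms unfolding bounded_op_def by blast

lemma tends_bop: assumes "bop T" "tends X x" shows "tends (\<lambda>n. T (X n)) (T x)"
proof -
  obtain K where K: "K > 0" "\<And>x. nrm (T x) \<le> K * nrm x" using bop_bound assms by blast
  show ?thesis
  proof (rule tendsI)
    show "nrm (T (X n) - T x) \<le> K * nrm (X n - x)" for n
      using K(2)[of "X n - x"] bop_diff[OF assms(1)] by simp
    show "(\<lambda>n. K * nrm (X n - x)) \<longlonglongrightarrow> 0"
      using assms(2) unfolding tends_def by (rule tendsto_mult_right_zero)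
  qed
qed

lemma bop_comp: assumes "bop S" "bop T" shows "bop (S \<circ> T)"
proof -
  obtain K where K: "K > 0" "\<And>x. nrm (S x) \<le> K * nrm x" using bop_bound assms by blast
  obtain L where L: "L > 0" "\<And>x. nrm (T x) \<le> L * nrm x" using bop_bound assms by blast
  have "nrm ((S \<circ> T) x) \<le> (K * L) * nrm x" for x
    using order_trans[OF K(2)[of "T x"] mult_left_mono[OF L(2)[of x], of K]] K(1) by (simp add: mult.assoc)
  then show ?thesis using assms by (intro bopI) (simp_all add: bop_add bop_scale)
qed

lemma bop_plus: assumes "bop S" "bop T" shows "bop (S + T)"
proof -
  obtain K where K: "K > 0" "\<And>x. nrm (S x) \<le> K * nrm x" using bop_bound assms by blast
  obtain L where L: "L > 0" "\<And>x. nrm (T x) \<le> L * nrm x" using bop_bound assms by blast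
  have "nrm ((S + T) x) \<le> (K + L) * nrm x" for x
    using nrm_triangle[of "S x" "T x"] K(2)[of x] L(2)[of x] by (simp add: algebra_simps)
  then show ?thesis using assms
    by (intro bopI[where K = "K + L"]) (simp_all add: bop_add bop_scale scale_right_distrib algebra_simps)
qed

lemma bop_sc: "bop (sc c)"
  by (rule bopI[where K = "cmod c"]) (simp_all add: scale_right_distrib nrm_scale mult.commute)

section \<open>Closed subspaces and orthogonal projections\<close>

definition closed_subspace :: "'h set \<Rightarrow> bool" where
  "closed_subspace K \<longleftrightarrow> 0 \<in> K \<and> (\<forall>x\<in>K. \<forall>y\<in>K. x + y \<in> K) \<and> (\<forall>c. \<forall>x\<in>K. sc c x \<in> K) \<and>
     (\<forall>X L. (\<forall>n. X n \<in> K) \<longrightarrow> tends X L \<longrightarrow> L \<in> K)"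

lemma closed_subspace_diff: "closed_subspace K \<Longrightarrow> x \<in> K \<Longrightarrow> y \<in> K \<Longrightarrow> x - y \<in> K"
  using scale_minus_left[of 1 y] unfolding closed_subspace_def
  by (metis diff_conv_add_uminus scale_one)

lemma closed_subspace_kernel:
  assumes "\<And>T. T \<in> S \<Longrightarrow> bop T" shows "closed_subspace {x. \<forall>T\<in>S. T x = 0}"
  unfolding closed_subspace_def
proof (intro conjI allI ballI impI)
  fix X L assume X: "\<forall>n. X n \<in> {x. \<forall>T\<in>S. T x = 0}" and L: "tends X L"
  have "T L = 0" if "T \<in> S" for T
  proof -
    have "tends (\<lambda>n. T (X n)) (T L)" using tends_bop assms L that by blast
    moreover have "(\<lambda>n. T (X n)) = (\<lambda>n. 0)" using X that by auto
    ultimately show ?thesis using tends_unique tends_const by metis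
  qed
  then show "L \<in> {x. \<forall>T\<in>S. T x = 0}" by blast
qed (use assms in \<open>auto simp: bop_0 bop_add bop_scale\<close>)

text \<open>A sequence minimizing the distance from \<open>x\<close> to \<open>K\<close> is Cauchy
  by the parallelogram law; its limit is the foot of the perpendicular.\<close>

lemma orthogonal_projection_exists:
  assumes K: "closed_subspace K"
  shows "\<exists>k\<in>K. \<forall>l\<in>K. ip l (x - k) = 0"
proof -
  have K0: "0 \<in> K" and Kadd: "\<And>x y. x \<in> K \<Longrightarrow> y \<in> K \<Longrightarrow> x + y \<in> K"
    and Ksc: "\<And>c x. x \<in> K \<Longrightarrow> sc c x \<in> K" and Klim: "\<And>X L. (\<And>n. X n \<in> K) \<Longrightarrow> tends X L \<Longrightarrow> L \<in> K"
    using K unfolding closed_subspace_def by blast+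
  define S where "S = (\<lambda>k. (nrm (x - k))\<^sup>2) ` K"
  define d where "d = Inf S"
  have bdd: "bdd_below S" by (auto simp: S_def intro!: bdd_belowI[where m = 0])
  have ne: "S \<noteq> {}" using K0 by (auto simp: S_def)
  have dle: "d \<le> (nrm (x - k))\<^sup>2" if "k \<in> K" for k
    unfolding d_def using that bdd by (intro cInf_lower) (auto simp: S_def)
  have "\<exists>k\<in>K. (nrm (x - k))\<^sup>2 < d + 1 / Suc n" for n
  proof -
    have "Inf S < d + 1 / Suc n" by (simp add: d_def)
    then obtain s where "s \<in> S" "s < d + 1 / Suc n" using cInf_lessD[OF ne] by blast
    then show ?thesis by (auto simp: S_def)
  qed
  then obtain k where k: "\<And>n. k n \<in> K" "\<And>n. (nrm (x - k n))\<^sup>2 < d + 1 / Suc n" by metis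
  have close: "(nrm (k m - k n))\<^sup>2 \<le> 2 / Suc m + 2 / Suc n" for m n
  proof -
    \<comment> \<open>The midpoint \<open>h\<close> lies in \<open>K\<close>, so its squared
      distance to \<open>x\<close> is at least \<open>d\<close>; the parallelogram law turns this
      into closeness of \<open>k m\<close> and \<open>k n\<close>.\<close>
    define h where "h = sc (1/2) (k m + k n)"
    have "sc 2 (x - h) = (x - k m) + (x - k n)"
    proof -
      have "sc 2 h = k m + k n" by (simp add: h_def)
      moreover have "sc 2 x = x + x" using scale_left_distrib[of 1 1 x] by simp
      ultimately show ?thesis by (simp add: scale_right_diff_distrib algebra_simps)
    qed
    then have "nrm ((x - k m) + (x - k n)) = 2 * nrm (x - h)" by (metis nrm_scale norm_numeral)
    then have "4 * (nrm (x - h))\<^sup>2 + (nrm (k m - k n))\<^sup>2 = 2 * (nrm (x - k m))\<^sup>2 + 2 * (nrm (x - k n))\<^sup>2"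
      using parallelogram[of "x - k m" "x - k n"] nrm_minus_commute[of "k m" "k n"]
      by (simp add: power_mult_distrib)
    moreover have "d \<le> (nrm (x - h))\<^sup>2" using k by (intro dle) (simp add: h_def Ksc Kadd)
    ultimately show ?thesis using k(2)[of m] k(2)[of n]
      by linarith
  qed
  have "\<exists>L. (\<lambda>n. nrm (k n - L)) \<longlonglongrightarrow> 0"
  proof (rule complete)
    fix e :: real assume e: "e > 0"
    obtain N where N: "inverse (real (Suc N)) < e\<^sup>2 / 4" using reals_Archimedean[of "e\<^sup>2 / 4"] e by auto
    show "\<exists>N. \<forall>m\<ge>N. \<forall>n\<ge>N. nrm (k m - k n) < e"
    proof (intro exI allI impI)
      fix m n assume mn: "N \<le> m" "N \<le> n"
      have "2 / real (Suc m) \<le> 2 / Suc N" "2 / real (Suc n) \<le> 2 / Suc N"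
        using mn by (auto intro!: divide_left_mono)
      then have "(nrm (k m - k n))\<^sup>2 \<le> 4 * inverse (real (Suc N))"
        using close[of m n] by (simp add: inverse_eq_divide)
      also have "\<dots> < e\<^sup>2" using N by simp
      finally show "nrm (k m - k n) < e" using e by (intro power2_less_imp_less[of _ e]) auto
    qed
  qed
  then obtain L where L: "tends k L" by (auto simp: tends_def)
  have LK: "L \<in> K" using Klim k L by blast
  have "tends (\<lambda>n. x - k n) (x - L)"
    using L unfolding tends_def by (simp add: nrm_minus_commute algebra_simps)
  then have "(\<lambda>n. (nrm (x - k n))\<^sup>2) \<longlonglongrightarrow> (nrm (x - L))\<^sup>2" by (intro tendsto_power tends_nrm)
  moreover have "(\<lambda>n. d + 1 / Suc n) \<longlonglongrightarrow> d + 0"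
    using LIMSEQ_inverse_real_of_nat by (intro tendsto_add tendsto_const) (simp add: inverse_eq_divide)
  ultimately have Ld: "(nrm (x - L))\<^sup>2 \<le> d"
    using k(2) by (intro LIMSEQ_le[of _ _ "\<lambda>n. d + 1 / Suc n" d]) (auto intro: less_imp_le)
  have "ip l (x - L) = 0" if l: "l \<in> K" for l
  proof (rule ccontr)
    assume ne: "ip l (x - L) \<noteq> 0"
    define a where "a = (cmod (ip l (x - L)))\<^sup>2"
    \<comment> \<open>Moving \<open>L\<close> along \<open>l\<close> with this \<open>t\<close>
      would lower the squared distance: \<open>t * (nrm l)\<^sup>2 < 1\<close>, so the linear gain
      beats the quadratic loss. The \<open>+ 1\<close> keeps the denominator positive.\<close>
    define t where "t = 1 / ((nrm l)\<^sup>2 + 1)"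
    have a: "a > 0" using ne by (simp add: a_def)
    have "(nrm l)\<^sup>2 + 1 > 0" using zero_le_power2[of "nrm l"] by linarith
    then have t: "t > 0" "t * (nrm l)\<^sup>2 < 1" by (simp_all add: t_def)
    have "L + sc (complex_of_real t * ip l (x - L)) l \<in> K" using LK l Kadd Ksc by blast
    then have "d \<le> (nrm (x - (L + sc (complex_of_real t * ip l (x - L)) l)))\<^sup>2" by (rule dle)
    then have "d \<le> (nrm (x - L - sc (complex_of_real t * ip l (x - L)) l))\<^sup>2" by (simp add: algebra_simps)
    then have "2 * t * a \<le> t * a * (t * (nrm l)\<^sup>2)"
      unfolding nrm_diff_scale_sq using Ld by (simp add: a_def power2_eq_square algebra_simps)
    also have "\<dots> \<le> t * a * 1" using t a by (intro mult_left_mono) auto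
    finally show False using t a by (simp add: mult_pos_pos)
  qed
  then show ?thesis using LK by blast
qed

definition proj_on :: "'h set \<Rightarrow> 'h \<Rightarrow> 'h" where
  "proj_on K x = (SOME k. k \<in> K \<and> (\<forall>l\<in>K. ip l (x - k) = 0))"

lemma proj_on:
  assumes "closed_subspace K"
  shows "proj_on K x \<in> K" "l \<in> K \<Longrightarrow> ip l (x - proj_on K x) = 0"
  using someI_ex[of "\<lambda>k. k \<in> K \<and> (\<forall>l\<in>K. ip l (x - k) = 0)"] orthogonal_projection_exists[OF assms, of x]
  unfolding proj_on_def by blast+

lemma proj_on_eqI:
  assumes K: "closed_subspace K" and k: "k \<in> K" "\<And>l. l \<in> K \<Longrightarrow> ip l (x - k) = 0"
  shows "proj_on K x = k"
proof -
  have "proj_on K x - k \<in> K" using closed_subspace_diff proj_on K k by blast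
  then have "ip (proj_on K x - k) (x - k) - ip (proj_on K x - k) (x - proj_on K x) = 0"
    using proj_on(2)[OF K] k(2) by simp
  then have "ip (proj_on K x - k) ((x - k) - (x - proj_on K x)) = 0" by (simp only: ip_diff_right)
  then have "ip (proj_on K x - k) (proj_on K x - k) = 0" by simp
  then show ?thesis using ip_eq_0 by fastforce
qed

lemma proj_on_id: "closed_subspace K \<Longrightarrow> x \<in> K \<Longrightarrow> proj_on K x = x"
  by (rule proj_on_eqI) auto

lemma proj_on_orth: "closed_subspace K \<Longrightarrow> (\<And>l. l \<in> K \<Longrightarrow> ip l x = 0) \<Longrightarrow> proj_on K x = 0"
  by (rule proj_on_eqI) (auto simp: closed_subspace_def)

lemma proj_on_sym: assumes K: "closed_subspace K" shows "ip (proj_on K x) y = ip x (proj_on K y)"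
proof -
  have 1: "ip (proj_on K x) (y - proj_on K y) = 0" using proj_on K by blast
  have "ip (proj_on K y) (x - proj_on K x) = 0" using proj_on K by blast
  then have 2: "ip (x - proj_on K x) (proj_on K y) = 0" by (metis ip_commute complex_cnj_zero)
  from 1 2 show ?thesis by (simp add: ip_simps)
qed

lemma bop_proj_on: assumes K: "closed_subspace K" shows "bop (proj_on K)"
proof (rule bopI)
  show "proj_on K (x + y) = proj_on K x + proj_on K y" for x y
    by (rule ip_ext) (simp add: ip_simps proj_on_sym[OF K, symmetric])
  show "proj_on K (sc c x) = sc c (proj_on K x)" for c x
    by (rule ip_ext) (simp add: ip_simps proj_on_sym[OF K, symmetric])
  show "nrm (proj_on K x) \<le> 1 * nrm x" for x
  proof -
    have "(nrm (proj_on K x))\<^sup>2 = Re (ip x (proj_on K x))"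
      using proj_on_sym[OF K, of x "proj_on K x"] proj_on_id[OF K proj_on(1)[OF K]] by (simp add: nrm_sq)
    also have "\<dots> \<le> nrm x * nrm (proj_on K x)"
      using cauchy_schwarz complex_Re_le_cmod order_trans by blast
    finally have "nrm (proj_on K x) * nrm (proj_on K x) \<le> nrm x * nrm (proj_on K x)"
      by (simp add: power2_eq_square)
    then show ?thesis
      by (cases "nrm (proj_on K x) = 0") (use nrm_nonneg[of "proj_on K x"] in \<open>auto simp: mult_le_cancel_right\<close>)
  qed
qed

text \<open>The vector \<open>y\<close> is the component of \<open>x0\<close> orthogonal to the
  kernel of \<open>\<phi>\<close>. Since \<open>x - sc (\<phi> x / \<phi> y) y\<close> lies in the
  kernel, \<open>\<phi>\<close> is a multiple of \<open>ip y\<close>.\<close>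

lemma riesz:
  assumes add: "\<And>x y. \<phi> (x + y) = \<phi> x + \<phi> y" and scale: "\<And>c x. \<phi> (sc c x) = c * \<phi> x"
    and bdd: "\<And>x. cmod (\<phi> x) \<le> K * nrm x"
  shows "\<exists>z. \<forall>x. \<phi> x = ip z x"
proof (cases "\<forall>x. \<phi> x = 0")
  case True
  then show ?thesis by (intro exI[of _ 0]) simp
next
  case False
  then obtain x0 where x0: "\<phi> x0 \<noteq> 0" by blast
  have zero: "\<phi> 0 = 0" using add[of 0 0] by simp
  have minus: "\<phi> (x - y) = \<phi> x - \<phi> y" for x y using add[of "x - y" y] by simp
  have csub: "closed_subspace {x. \<phi> x = 0}"
    unfolding closed_subspace_def
  proof (intro conjI allI ballI impI)
    fix X L assume X: "\<forall>n. X n \<in> {x. \<phi> x = 0}" and L: "tends X L"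
    have "cmod (\<phi> L) \<le> K * nrm (X n - L)" for n
      using bdd[of "X n - L"] X by (simp add: minus)
    moreover have "(\<lambda>n. K * nrm (X n - L)) \<longlonglongrightarrow> 0"
      using L unfolding tends_def by (rule tendsto_mult_right_zero)
    ultimately have "cmod (\<phi> L) \<le> 0" by (intro LIMSEQ_le_const) auto
    then show "L \<in> {x. \<phi> x = 0}" by simp
  qed (simp_all add: zero add scale)
  define y where "y = x0 - proj_on {x. \<phi> x = 0} x0"
  have y: "\<phi> y \<noteq> 0" using x0 proj_on(1)[OF csub, of x0] by (simp add: y_def minus)
  have orth: "ip l y = 0" if "\<phi> l = 0" for l using proj_on(2)[OF csub] that by (simp add: y_def)
  have yy: "ip y y \<noteq> 0" using y zero ip_eq_0 by metis
  have "\<phi> x = ip (sc (cnj (\<phi> y / ip y y)) y) x" for x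
  proof -
    have "\<phi> (x - sc (\<phi> x / \<phi> y) y) = 0" using y by (simp add: minus scale)
    then have "cnj (ip (x - sc (\<phi> x / \<phi> y) y) y) = 0" using orth by simp
    then have "ip y (x - sc (\<phi> x / \<phi> y) y) = 0" by (metis ip_commute)
    then have "ip y x = \<phi> x / \<phi> y * ip y y" by (simp add: ip_simps)
    then show ?thesis using y yy by (simp add: ip_simps)
  qed
  then show ?thesis by blast
qed

text \<open>As \<open>adj\<close> is a definite description, any map with the defining identity
  equals it. The algebraic rules for adjoints are instances of this.\<close>

lemma adj_unique: assumes "\<And>x y. ip (S y) x = ip y (T x)" shows "adj ip T = S"
proof
  fix y
  show "adj ip T y = S y"
    unfolding adj_def by (rule the_equality) (use assms in \<open>auto intro: ip_ext_left\<close>)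
qed

lemma adj: assumes "bop T" shows "ip (adj ip T y) x = ip y (T x)"
proof -
  obtain K where K: "K > 0" "\<And>x. nrm (T x) \<le> K * nrm x" using bop_bound assms by blast
  have "\<exists>z. \<forall>x. ip y (T x) = ip z x" for y
  proof (rule riesz)
    show "cmod (ip y (T x)) \<le> (nrm y * K) * nrm x" for x
      using cauchy_schwarz[of y "T x"] mult_left_mono[OF K(2)[of x], of "nrm y"] by (simp add: mult.assoc)
  qed (simp_all add: bop_add[OF assms] bop_scale[OF assms] ip_simps)
  then obtain S where "\<And>x y. ip (S y) x = ip y (T x)" by metis
  then show ?thesis using adj_unique by metis
qed

lemma adj_right: "bop T \<Longrightarrow> ip x (adj ip T y) = ip (T x) y"
  by (metis adj ip_commute)

lemma adj_nrm: assumes T: "bop T" and K: "K \<ge> 0" "\<And>x. nrm (T x) \<le> K * nrm x" shows "nrm (adj ip T y) \<le> K * nrm y"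
proof -
  let ?z = "adj ip T y"
  have "nrm ?z * nrm ?z = Re (ip y (T ?z))" using adj[OF T, of y ?z] nrm_sq[of ?z] by (simp add: power2_eq_square)
  also have "\<dots> \<le> nrm y * nrm (T ?z)" using cauchy_schwarz complex_Re_le_cmod order_trans by blast
  also have "\<dots> \<le> nrm y * (K * nrm ?z)" using K by (intro mult_left_mono) auto
  finally have "nrm ?z * nrm ?z \<le> (K * nrm y) * nrm ?z" by (simp add: algebra_simps)
  then show ?thesis
    by (cases "nrm ?z = 0") (use nrm_nonneg[of ?z] K(1) in \<open>auto simp: mult_le_cancel_right\<close>)
qed

lemma bop_adj: assumes "bop T" shows "bop (adj ip T)"
proof -
  obtain K where K: "K > 0" "\<And>x. nrm (T x) \<le> K * nrm x" using bop_bound assms by blast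
  show ?thesis
  proof (rule bopI)
    show "adj ip T (x + y) = adj ip T x + adj ip T y" for x y
      by (rule ip_ext) (simp add: ip_simps adj_right[OF assms])
    show "adj ip T (sc c x) = sc c (adj ip T x)" for c x
      by (rule ip_ext) (simp add: ip_simps adj_right[OF assms])
    show "nrm (adj ip T x) \<le> K * nrm x" for x using adj_nrm[OF assms] K by simp
  qed
qed

lemma adj_adj: "bop T \<Longrightarrow> adj ip (adj ip T) = T"
  by (rule adj_unique) (simp add: adj_right)

lemma adj_comp: "bop S \<Longrightarrow> bop T \<Longrightarrow> adj ip (S \<circ> T) = adj ip T \<circ> adj ip S"
  by (rule adj_unique) (simp add: adj)

lemma adj_plus: "bop S \<Longrightarrow> bop T \<Longrightarrow> adj ip (S + T) = adj ip S + adj ip T"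
  by (rule adj_unique) (simp add: adj ip_simps)

lemma adj_sc: "adj ip (sc c) = sc (cnj c)"
  by (rule adj_unique) (simp add: ip_simps)

lemma commutantD: "T \<in> commutant sc ip S \<Longrightarrow> bop T" "T \<in> commutant sc ip S \<Longrightarrow> A \<in> S \<Longrightarrow> T (A x) = A (T x)"
  by (auto simp: commutant_def fun_eq_iff)

lemma commutantI: "bop T \<Longrightarrow> (\<And>A x. A \<in> S \<Longrightarrow> T (A x) = A (T x)) \<Longrightarrow> T \<in> commutant sc ip S"
  by (auto simp: commutant_def fun_eq_iff)

text \<open>Invariance of \<open>K\<close> under the adjoint makes its orthogonal complement
  invariant under \<open>T\<close>, so \<open>T\<close> respects the decomposition of
  \<open>x\<close>.\<close>

lemma proj_on_commute:
  assumes K: "closed_subspace K" and T: "bop T" "\<And>x. x \<in> K \<Longrightarrow> T x \<in> K" "\<And>x. x \<in> K \<Longrightarrow> adj ip T x \<in> K"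
  shows "proj_on K (T x) = T (proj_on K x)"
proof (rule proj_on_eqI[OF K])
  show "T (proj_on K x) \<in> K" using proj_on K T by blast
  fix l assume "l \<in> K"
  then have "ip (adj ip T l) (x - proj_on K x) = 0" using T proj_on K by blast
  then show "ip l (T x - T (proj_on K x)) = 0" by (simp add: adj T bop_diff)
qed

end

section \<open>Von Neumann algebras\<close>

lemma bounded_incseq_Cauchy:
  fixes a :: "nat \<Rightarrow> real"
  assumes "incseq a" "\<And>n. a n \<le> B" "e > 0"
  obtains N where "\<And>m n. N \<le> m \<Longrightarrow> m \<le> n \<Longrightarrow> a n - a m < e"
proof -
  obtain L where L: "a \<longlonglongrightarrow> L" "\<And>n. a n \<le> L" using incseq_convergent[OF assms(1)] assms(2) by metis
  obtain N where N: "\<And>n. N \<le> n \<Longrightarrow> norm (a n - L) < e" using LIMSEQ_D[OF L(1) assms(3)] by blast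
  have "a n - a m < e" if "N \<le> m" for m n
    using N[OF that] L(2)[of n] L(2)[of m] by (simp add: abs_if split: if_splits)
  then show thesis using that by blast
qed

context hilbert_space
begin

text \<open>A common Cauchy criterion for the square root iteration and for chains of partial
  isometries: increments of a bounded monotone real sequence control the squared distances.\<close>

lemma tends_if_dominated:
  assumes dom: "\<And>m n. m \<le> n \<Longrightarrow> (nrm (X n - X m))\<^sup>2 \<le> a n - a m"
    and a: "incseq a" "\<And>n. a n \<le> B"
  shows "\<exists>L. tends X L"
  unfolding tends_def
proof (rule complete)
  fix e :: real assume e: "e > 0"
  obtain N where N: "\<And>m n. N \<le> m \<Longrightarrow> m \<le> n \<Longrightarrow> a n - a m < e\<^sup>2"
    using bounded_incseq_Cauchy[of a B "e\<^sup>2"] a e by auto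
  have 1: "nrm (X n - X m) < e" if "N \<le> m" "m \<le> n" for m n
    using dom[OF that(2)] N[OF that] e by (intro power2_less_imp_less[of _ e]) auto
  show "\<exists>N. \<forall>m\<ge>N. \<forall>n\<ge>N. nrm (X m - X n) < e"
  proof (intro exI allI impI)
    fix m n assume "N \<le> m" "N \<le> n"
    then show "nrm (X m - X n) < e"
      using 1[of m n] 1[of n m] nrm_minus_commute[of "X m" "X n"] by (cases "m \<le> n") auto
  qed
qed

end

locale vN_algebra = hilbert_space sc ip
  for sc :: "complex \<Rightarrow> 'h::ab_group_add \<Rightarrow> 'h" and ip :: "'h \<Rightarrow> 'h \<Rightarrow> complex" +
  fixes M :: "('h \<Rightarrow> 'h) set"
  assumes vN: "von_neumann_algebra sc ip M"
begin

lemma M_bop: "T \<in> M \<Longrightarrow> bop T"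
  and M_adj: "T \<in> M \<Longrightarrow> adj ip T \<in> M"
  and bicommutant: "commutant sc ip (commutant sc ip M) = M"
  using vN by (auto simp: von_neumann_algebra_def)

text \<open>Membership through the bicommutant. The closure properties of \<open>M\<close> that
  follow, including strong limits of sequences, rest on this.\<close>

lemma M_I: "bop T \<Longrightarrow> (\<And>A x. A \<in> commutant sc ip M \<Longrightarrow> T (A x) = A (T x)) \<Longrightarrow> T \<in> M"
  by (subst bicommutant[symmetric], rule commutantI)

lemma M_commute: "T \<in> M \<Longrightarrow> A \<in> commutant sc ip M \<Longrightarrow> T (A x) = A (T x)"
  using commutantD(2)[of A M T x] by simp

lemma M_comp: "S \<in> M \<Longrightarrow> T \<in> M \<Longrightarrow> S \<circ> T \<in> M"
  by (rule M_I) (auto simp: bop_comp M_bop M_commute)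

lemma M_plus: "S \<in> M \<Longrightarrow> T \<in> M \<Longrightarrow> S + T \<in> M"
  by (rule M_I) (auto simp: bop_plus M_bop M_commute bop_add[OF commutantD(1)])

lemma M_sc: "sc c \<in> M"
  by (rule M_I) (auto simp: bop_sc bop_scale[OF commutantD(1)])

lemma id_eq_sc: "id = sc 1"
  by (simp add: fun_eq_iff)

lemma M_id: "id \<in> M"
  using M_sc[of 1] id_eq_sc by simp

lemma M_limit:
  assumes "bop T" "\<And>n. F n \<in> M" "\<And>x. tends (\<lambda>n. F n x) (T x)"
  shows "T \<in> M"
proof (rule M_I)
  fix A x assume A: "A \<in> commutant sc ip M"
  have "tends (\<lambda>n. A (F n x)) (A (T x))" using tends_bop commutantD(1) A assms by blast
  then have "tends (\<lambda>n. F n (A x)) (A (T x))" using M_commute[OF assms(2) A] by simp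
  then show "T (A x) = A (T x)" using tends_unique assms by blast
qed fact

lemma commutant_adj:
  assumes T: "T \<in> commutant sc ip M" shows "adj ip T \<in> commutant sc ip M"
proof (rule commutantI)
  note b = commutantD(1)[OF T]
  show "bop (adj ip T)" using bop_adj b by blast
  fix A x assume A: "A \<in> M"
  show "adj ip T (A x) = A (adj ip T x)"
  proof (rule ip_ext)
    fix y
    have "ip y (adj ip T (A x)) = ip (adj ip A (T y)) x" by (simp add: adj_right b adj M_bop A)
    also have "adj ip A (T y) = T (adj ip A y)" using M_commute[OF M_adj[OF A] T] .
    also have "ip \<dots> x = ip y (A (adj ip T x))" by (simp add: adj_right[symmetric] b) (simp add: adj M_bop A)
    finally show "ip y (adj ip T (A x)) = ip y (A (adj ip T x))" .
  qed
qed

text \<open>The commutant is closed under adjoints, so a closed subspace invariant under it is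
  reducing, and the projection commutes with the commutant.\<close>

lemma proj_on_M:
  assumes K: "closed_subspace K" and inv: "\<And>T x. T \<in> commutant sc ip M \<Longrightarrow> x \<in> K \<Longrightarrow> T x \<in> K"
  shows "proj_on K \<in> M"
proof (rule M_I)
  show "bop (proj_on K)" using bop_proj_on K by blast
  fix A x assume A: "A \<in> commutant sc ip M"
  show "proj_on K (A x) = A (proj_on K x)"
    using proj_on_commute[OF K] commutantD(1)[OF A] inv[OF A] inv[OF commutant_adj[OF A]] by blast
qed

text \<open>Here \<open>r\<close> is the complement of the projection onto the kernel of
  \<open>adj ip V\<close>. If \<open>b\<close> annihilates the range of \<open>V\<close>, then
  \<open>adj ip b\<close> maps into that kernel and \<open>r\<close> annihilates its values; taking
  adjoints gives the claim for \<open>b\<close>.\<close>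

lemma range_projection_exists:
  assumes V: "V \<in> M"
  shows "\<exists>r\<in>M. adj ip r = r \<and> r \<circ> r = r \<and> r \<circ> V = V \<and> (\<forall>b\<in>M. (\<forall>x. b (V x) = 0) \<longrightarrow> (\<forall>x. b (r x) = 0))"
proof -
  define K where "K = {x. \<forall>T\<in>{adj ip V}. T x = 0}"
  have K: "closed_subspace K" unfolding K_def by (rule closed_subspace_kernel) (auto simp: bop_adj M_bop V)
  have Kx: "x \<in> K \<longleftrightarrow> adj ip V x = 0" for x by (auto simp: K_def)
  define N where "N = proj_on K"
  have N: "N \<in> M"
    unfolding N_def
  proof (rule proj_on_M[OF K])
    fix T x assume T: "T \<in> commutant sc ip M" and "x \<in> K"
    then show "T x \<in> K" using M_commute[OF M_adj[OF V] T] bop_0[OF commutantD(1)[OF T]] by (simp add: Kx)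
  qed
  define r where "r = id + (sc (-1) \<circ> N)"
  have rx: "r x = x - N x" for x by (simp add: r_def)
  have r: "r \<in> M" unfolding r_def by (intro M_plus M_id M_comp M_sc N)
  have adj_r: "adj ip r = r"
    by (rule adj_unique) (simp add: rx ip_simps N_def proj_on_sym[OF K])
  have NN: "N (N x) = N x" for x unfolding N_def using proj_on_id[OF K proj_on(1)[OF K]] .
  have "r \<circ> r = r" by (simp add: fun_eq_iff rx bop_diff[OF M_bop[OF N]] NN)
  moreover have "N (V x) = 0" for x
    unfolding N_def
  proof (rule proj_on_orth[OF K])
    fix l assume "l \<in> K"
    then show "ip l (V x) = 0" using adj[OF M_bop[OF V], of l x] by (simp add: Kx)
  qed
  then have "r \<circ> V = V" by (simp add: fun_eq_iff rx)
  moreover have "b (r x) = 0" if b: "b \<in> M" "\<And>x. b (V x) = 0" for b x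
  proof (rule ip_ext)
    fix y
    have "adj ip V (adj ip b y) = 0"
      by (rule ip_ext) (simp add: adj_right M_bop V b)
    then have "N (adj ip b y) = adj ip b y" unfolding N_def using proj_on_id[OF K] by (simp add: Kx)
    then have "r (adj ip b y) = 0" by (simp add: rx)
    have "ip y (b (r x)) = ip (adj ip b y) (r x)" by (simp add: adj M_bop b)
    also have "\<dots> = ip (adj ip r (adj ip b y)) x" by (simp add: adj M_bop r)
    also have "\<dots> = 0" using \<open>r (adj ip b y) = 0\<close> by (simp add: adj_r)
    finally show "ip y (b (r x)) = ip y 0" by simp
  qed
  ultimately show ?thesis using r adj_r by blast
qed

text \<open>The fixed point \<open>y\<close> of \<open>y \<mapsto> (g + y\<^sup>2) / 2\<close> satisfies \<open>(1 - y)\<^sup>2 = 1 - g\<close>. The iteration is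
  dominated in norm by its scalar analogue started at \<open>0\<close> with \<open>g = 1\<close>, which increases and is bounded by \<open>1\<close>.\<close>
lemma square_root_of_contraction:
  assumes g: "g \<in> M" "adj ip g = g" "\<And>x. nrm (g x) \<le> nrm x"
  shows "\<exists>y\<in>M. adj ip y = y \<and> (\<forall>x. nrm (y x) \<le> nrm x) \<and> (\<forall>x. y x + y x = g x + y (y x)) \<and>
           (\<forall>b\<in>M. (\<forall>x. b (g x) = g (b x)) \<longrightarrow> (\<forall>x. b (y x) = y (b x)))"
proof -
  define Y where "Y = rec_nat (\<lambda>x::'h. 0::'h) (\<lambda>n F x. sc (1/2) (g x + F (F x)))"
  define \<eta> where "\<eta> = rec_nat (0::real) (\<lambda>n e. (1 + e\<^sup>2) / 2)"
  have Y0: "Y 0 x = 0" and YS: "Y (Suc n) x = sc (1/2) (g x + Y n (Y n x))" for n x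
    by (simp_all add: Y_def)
  have \<eta>0: "\<eta> 0 = 0" and \<eta>S: "\<eta> (Suc n) = (1 + (\<eta> n)\<^sup>2) / 2" for n
    by (simp_all add: \<eta>_def)
  have \<eta>01: "0 \<le> \<eta> n \<and> \<eta> n \<le> 1" for n
  proof (induction n)
    case (Suc n)
    then have "(\<eta> n)\<^sup>2 \<le> 1" by (simp add: power_le_one)
    then show ?case by (simp add: \<eta>S)
  qed (simp add: \<eta>0)
  have YM: "Y n \<in> M" for n
  proof (induction n)
    case 0
    have "Y 0 = sc 0" by (simp add: fun_eq_iff Y0)
    then show ?case by (simp only: M_sc)
  next
    case (Suc n)
    have "Y (Suc n) = sc (1/2) \<circ> (g + (Y n \<circ> Y n))" by (simp add: fun_eq_iff YS)
    then show ?case using M_comp[OF M_sc M_plus[OF g(1) M_comp[OF Suc Suc]]] by (simp only:)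
  qed
  note Yb = M_bop[OF YM]
  have half: "nrm (sc (1/2) x) = nrm x / 2" for x by (simp add: nrm_scale norm_divide)
  have Ynrm: "nrm (Y n x) \<le> \<eta> n * nrm x" for n x
  proof (induction n arbitrary: x)
    case 0
    then show ?case by (simp add: Y0 \<eta>0)
  next
    case (Suc n)
    have "nrm (Y n (Y n x)) \<le> \<eta> n * (\<eta> n * nrm x)"
      using order_trans[OF Suc[of "Y n x"] mult_left_mono[OF Suc[of x]]] \<eta>01 by blast
    then have "nrm (g x + Y n (Y n x)) \<le> nrm x + \<eta> n * (\<eta> n * nrm x)"
      using nrm_triangle[of "g x" "Y n (Y n x)"] g(3)[of x] by linarith
    then show ?case unfolding YS half \<eta>S by (simp add: power2_eq_square field_simps)
  qed
  have inc: "\<eta> n \<le> \<eta> (Suc n)" for n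
  proof -
    have "0 \<le> (1 - \<eta> n)\<^sup>2 / 2" by simp
    then show ?thesis by (simp add: \<eta>S power2_eq_square field_simps)
  qed
  have step: "nrm (Y (Suc n) x - Y n x) \<le> (\<eta> (Suc n) - \<eta> n) * nrm x" for n x
  proof (induction n arbitrary: x)
    case 0
    then show ?case using Ynrm[of "Suc 0" x] by (simp add: Y0 \<eta>0)
  next
    case (Suc n)
    let ?A = "Y (Suc n)" and ?B = "Y n" and ?a = "\<eta> (Suc n)" and ?b = "\<eta> n"
    \<comment> \<open>The splitting \<open>A A - B B = A (A - B) + (A - B) B\<close> gives the bound
      \<open>(a^2 - b^2) / 2\<close>, which is exactly the next increment of
      \<open>\<eta>\<close>.\<close>
    have "Y (Suc (Suc n)) x - ?A x = sc (1/2) ((?A (?A x) - ?A (?B x)) + (?A (?B x) - ?B (?B x)))"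
      by (simp add: YS[of "Suc n"] YS[of n x] scale_right_diff_distrib[symmetric])
    then have "nrm (Y (Suc (Suc n)) x - ?A x) \<le> (nrm (?A (?A x - ?B x)) + nrm (?A (?B x) - ?B (?B x))) / 2"
      using nrm_triangle[of "?A (?A x) - ?A (?B x)" "?A (?B x) - ?B (?B x)"] by (simp add: half bop_diff[OF Yb])
    also have "\<dots> \<le> (?a * ((?a - ?b) * nrm x) + (?a - ?b) * (?b * nrm x)) / 2"
    proof -
      have ab: "0 \<le> ?a - ?b" using inc by simp
      have "nrm (?A (?A x - ?B x)) \<le> ?a * nrm (?A x - ?B x)" by (rule Ynrm)
      also have "\<dots> \<le> ?a * ((?a - ?b) * nrm x)" using Suc.IH \<eta>01 by (intro mult_left_mono) auto
      finally have 1: "nrm (?A (?A x - ?B x)) \<le> ?a * ((?a - ?b) * nrm x)" .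
      have "nrm (?A (?B x) - ?B (?B x)) \<le> (?a - ?b) * nrm (?B x)" by (rule Suc.IH)
      also have "\<dots> \<le> (?a - ?b) * (?b * nrm x)" using Ynrm ab by (intro mult_left_mono) auto
      finally have 2: "nrm (?A (?B x) - ?B (?B x)) \<le> (?a - ?b) * (?b * nrm x)" .
      show ?thesis using 1 2 by simp
    qed
    also have "\<dots> = (\<eta> (Suc (Suc n)) - ?a) * nrm x"
      by (simp only: \<eta>S[of "Suc n"]) (simp add: \<eta>S[of n] power2_eq_square field_simps)
    finally show ?case .
  qed
  have mono: "incseq \<eta>" using inc by (rule incseq_SucI)
  have diff: "nrm (Y n x - Y m x) \<le> (\<eta> n - \<eta> m) * nrm x" if "m \<le> n" for m n x
    using that
  proof (induction n rule: dec_induct)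
    case (step n)
    then show ?case
      using nrm_triangle_diff[of "Y (Suc n) x" "Y m x" "Y n x"] \<open>nrm (Y (Suc n) x - Y n x) \<le> _\<close>
      by (simp add: algebra_simps)
  qed simp
  have "\<exists>L. tends (\<lambda>n. Y n x) L" for x
  proof (rule tends_if_dominated[where a = "\<lambda>n. \<eta> n * (nrm x)\<^sup>2" and B = "(nrm x)\<^sup>2"])
    fix m n :: nat assume mn: "m \<le> n"
    \<comment> \<open>Increments of \<open>\<eta>\<close> are at most \<open>1\<close>, so their
      squares do not exceed them; this yields the form that \<open>tends_if_dominated\<close>
      expects.\<close>
    have d: "0 \<le> \<eta> n - \<eta> m" "\<eta> n - \<eta> m \<le> 1" using mono mn \<eta>01[of n] \<eta>01[of m] by (auto dest: incseqD)
    have "(nrm (Y n x - Y m x))\<^sup>2 \<le> ((\<eta> n - \<eta> m) * nrm x)\<^sup>2" using diff[OF mn] by (intro power_mono) auto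
    also have "\<dots> = (\<eta> n - \<eta> m)\<^sup>2 * (nrm x)\<^sup>2" by (simp add: power_mult_distrib)
    also have "\<dots> \<le> (\<eta> n - \<eta> m) * (nrm x)\<^sup>2"
      using d by (intro mult_right_mono) (auto simp: power2_eq_square mult_left_le)
    finally show "(nrm (Y n x - Y m x))\<^sup>2 \<le> \<eta> n * (nrm x)\<^sup>2 - \<eta> m * (nrm x)\<^sup>2"
      by (simp add: algebra_simps)
  next
    show "incseq (\<lambda>n. \<eta> n * (nrm x)\<^sup>2)"
      using mono by (auto simp: incseq_def intro!: mult_right_mono)
    show "\<eta> n * (nrm x)\<^sup>2 \<le> (nrm x)\<^sup>2" for n
      using \<eta>01[of n] by (simp add: mult_left_le_one_le)
  qed
  then obtain y where y: "\<And>x. tends (\<lambda>n. Y n x) (y x)" by metis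
  have ynrm: "nrm (y x) \<le> nrm x" for x
  proof (rule LIMSEQ_le_const2[OF tends_nrm[OF y]])
    have "nrm (Y n x) \<le> nrm x" for n
      using order_trans[OF Ynrm mult_right_mono[of "\<eta> n" 1 "nrm x"]] \<eta>01 by simp
    then show "\<exists>N. \<forall>n\<ge>N. nrm (Y n x) \<le> nrm x" by blast
  qed
  have yb: "bop y"
  proof (rule bopI)
    show "nrm (y x) \<le> 1 * nrm x" for x using ynrm by simp
    show "y (u + v) = y u + y v" for u v
      using tends_unique[OF y[of "u + v"]] tends_add[OF y[of u] y[of v]] by (simp add: bop_add[OF Yb])
    show "y (sc c u) = sc c (y u)" for c u
      using tends_unique[OF y[of "sc c u"]] tends_bop[OF bop_sc y[of u]] by (simp add: bop_scale[OF Yb])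
  qed
  have yM: "y \<in> M" using M_limit[OF yb YM y] .
  have adjY: "ip (Y n u) v = ip u (Y n v)" for n u v
  proof (induction n arbitrary: u v)
    case (Suc n)
    have "ip (g u) v = ip u (g v)" using adj[OF M_bop[OF g(1)], of u v] g(2) by simp
    then show ?case using Suc by (simp add: YS ip_simps)
  qed (simp add: Y0)
  have "adj ip y = y"
  proof (rule adj_unique)
    fix u v
    show "ip (y v) u = ip v (y u)"
      using LIMSEQ_unique[OF tends_ip[OF y tends_const] ] tends_ip[OF tends_const y] by (simp add: adjY)
  qed
  moreover have "y x + y x = g x + y (y x)" for x
  proof -
    have "tends (\<lambda>n. Y n (Y n x)) (y (y x))"
    proof (rule tendsI)
      show "nrm (Y n (Y n x) - y (y x)) \<le> nrm (Y n x - y x) + nrm (Y n (y x) - y (y x))" for n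
      proof -
        have "nrm (Y n (Y n x - y x)) \<le> nrm (Y n x - y x)"
          using order_trans[OF Ynrm mult_right_mono[of "\<eta> n" 1]] \<eta>01 by simp
        then show ?thesis
          using nrm_triangle_diff[of "Y n (Y n x)" "y (y x)" "Y n (y x)"] by (simp add: bop_diff[OF Yb])
      qed
      show "(\<lambda>n. nrm (Y n x - y x) + nrm (Y n (y x) - y (y x))) \<longlonglongrightarrow> 0"
        using y[of x] y[of "y x"] unfolding tends_def by (intro tendsto_add_zero)
    qed
    then have "tends (\<lambda>n. Y (Suc n) x) (sc (1/2) (g x + y (y x)))"
      unfolding YS by (intro tends_bop[OF bop_sc] tends_add tends_const)
    moreover have "tends (\<lambda>n. Y (Suc n) x) (y x)" using y[of x] unfolding tends_def by (rule LIMSEQ_Suc)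
    ultimately have e: "y x = sc (1/2) (g x + y (y x))" using tends_unique by blast
    have "sc 2 (y x) = y x + y x" using scale_left_distrib[of 1 1 "y x"] by simp
    moreover have "sc 2 (y x) = g x + y (y x)" by (subst e) simp
    ultimately show ?thesis by simp
  qed
  moreover have "b (y x) = y (b x)" if b: "b \<in> M" "\<And>x. b (g x) = g (b x)" for b x
  proof -
    note bb = M_bop[OF b(1)]
    have bY: "b (Y n x) = Y n (b x)" for n x
      by (induction n arbitrary: x) (simp_all add: Y0 YS bop_0[OF bb] bop_scale[OF bb] bop_add[OF bb] b)
    have "tends (\<lambda>n. Y n (b x)) (b (y x))" using tends_bop[OF bb y[of x]] by (simp add: bY)
    then show ?thesis using tends_unique y by blast
  qed
  ultimately show ?thesis using yM ynrm by blast
qed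

text \<open>Division by \<open>K^2\<close> makes \<open>g = 1 - t\<close> a contraction. Two square
  roots give \<open>(1 - y)^2 = t\<close> and \<open>(1 - z)^2 = 1 - y\<close>, hence
  \<open>(1 - z)^4 = t\<close>; the factor \<open>sqrt K\<close> in \<open>c\<close> undoes the
  scaling.\<close>

lemma fourth_root_exists:
  assumes D: "D \<in> M"
  shows "\<exists>c\<in>M. adj ip c = c \<and> (\<forall>x. c (c (c (c x))) = adj ip D (D x)) \<and>
     (\<forall>b\<in>M. (\<forall>x. b (adj ip D (D x)) = adj ip D (D (b x))) \<longrightarrow> (\<forall>x. b (c x) = c (b x)))"
proof -
  note Db = M_bop[OF D]
  obtain K where K: "K > 0" "\<And>x. nrm (D x) \<le> K * nrm x" using bop_bound[OF Db] by blast
  define k where "k = complex_of_real (1 / K\<^sup>2)"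
  have ck: "cnj k = k" by (simp add: k_def)
  define t where "t x = sc k (adj ip D (D x))" for x
  define g where "g = id + (sc (- k) \<circ> (adj ip D \<circ> D))"
  have gx: "g x = x - t x" for x by (simp add: g_def t_def)
  have gM: "g \<in> M" unfolding g_def by (intro M_plus M_id M_comp M_sc M_adj D)
  have tip: "ip u (t v) = k * ip (D u) (D v)" for u v by (simp add: t_def ip_simps adj_right Db)
  have tip': "ip (t u) v = k * ip (D u) (D v)" for u v by (simp add: t_def ip_simps adj Db ck)
  have adjg: "adj ip g = g" by (rule adj_unique) (simp add: gx ip_simps tip tip')
  have "nrm (g x) \<le> nrm x" for x
  proof -
    \<comment> \<open>The norm of \<open>t x\<close> is at most \<open>nrm (D x) / K\<close>, whose
      square is \<open>ip x (t x)\<close>. So the quadratic term in the expansion of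
      \<open>(nrm (g x))\<^sup>2\<close> is absorbed by the linear one.\<close>
    have "nrm (adj ip D (D x)) \<le> K * nrm (D x)" using adj_nrm[OF Db _ K(2)] K(1) by simp
    then have "nrm (t x) \<le> (1 / K\<^sup>2) * (K * nrm (D x))"
      using K(1) unfolding t_def nrm_scale k_def by (intro mult_mono) (simp_all add: norm_divide norm_power)
    also have "\<dots> = nrm (D x) / K" using K(1) by (simp add: power2_eq_square)
    finally have "(nrm (t x))\<^sup>2 \<le> (nrm (D x) / K)\<^sup>2" by (intro power_mono) auto
    also have "\<dots> = Re (ip x (t x))" by (simp add: tip k_def nrm_sq power_divide)
    also have "\<dots> \<le> 2 * Re (ip x (t x))" using calculation by (smt (verit) zero_le_power2)
    finally have "(nrm (t x))\<^sup>2 \<le> 2 * Re (ip x (t x))" .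
    moreover have "ip (t x) x = ip x (t x)" by (simp add: tip tip')
    then have "(nrm (g x))\<^sup>2 = (nrm x)\<^sup>2 - 2 * Re (ip x (t x)) + (nrm (t x))\<^sup>2"
      by (simp add: nrm_sq gx ip_simps)
    ultimately have "(nrm (g x))\<^sup>2 \<le> (nrm x)\<^sup>2" by simp
    then show ?thesis by (rule power2_le_imp_le) simp
  qed
  then obtain y where y: "y \<in> M" "adj ip y = y" "\<And>x. nrm (y x) \<le> nrm x" "\<And>x. y x + y x = g x + y (y x)"
    "\<And>b x. b \<in> M \<Longrightarrow> (\<And>x. b (g x) = g (b x)) \<Longrightarrow> b (y x) = y (b x)"
    using square_root_of_contraction[OF gM adjg] by blast
  obtain z where z: "z \<in> M" "adj ip z = z" "\<And>x. z x + z x = y x + z (z x)"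
    "\<And>b x. b \<in> M \<Longrightarrow> (\<And>x. b (y x) = y (b x)) \<Longrightarrow> b (z x) = z (b x)"
    using square_root_of_contraction[OF y(1-3)] by blast
  note yb = M_bop[OF y(1)] and zb = M_bop[OF z(1)]
  define s where "s = complex_of_real (sqrt K)"
  have ss: "s * s = complex_of_real K" using K(1) by (simp add: s_def of_real_mult[symmetric] del: of_real_mult)
  define c where "c = sc s \<circ> (id + (sc (-1) \<circ> z))"
  have cx: "c x = sc s (x - z x)" for x by (simp add: c_def)
  have cM: "c \<in> M" unfolding c_def by (intro M_plus M_id M_comp M_sc z)
  have zip: "ip (z u) v = ip u (z v)" for u v using adj[OF zb, of u v] z(2) by simp
  have "adj ip c = c" by (rule adj_unique) (simp add: cx ip_simps zip s_def)
  moreover have "c (c (c (c x))) = adj ip D (D x)" for x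
  proof -
    have zz: "(u - z u) - z (u - z u) = u - y u" for u
      using z(3)[of u] by (simp add: bop_diff[OF zb] algebra_simps)
    have yy: "(u - y u) - y (u - y u) = u - g u" for u
      using y(4)[of u] by (simp add: bop_diff[OF yb] algebra_simps)
    have cc: "c (c u) = sc K (u - y u)" for u
    proof -
      have "c (c u) = sc (s * s) ((u - z u) - z (u - z u))"
        by (simp only: cx bop_scale[OF zb] scale_right_diff_distrib[symmetric] scale_scale)
      then show ?thesis by (simp only: ss zz)
    qed
    have "c (c (c (c x))) = sc (complex_of_real K * K) ((x - y x) - y (x - y x))"
      by (simp only: cc bop_scale[OF yb] scale_right_diff_distrib[symmetric] scale_scale)
    also have "\<dots> = sc (complex_of_real K * K * k) (adj ip D (D x))"
      by (simp add: yy gx t_def)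
    also have "complex_of_real K * K * k = 1" using K(1) by (simp add: k_def power2_eq_square)
    finally show ?thesis by simp
  qed
  moreover have "b (c x) = c (b x)" if b: "b \<in> M" "\<And>x. b (adj ip D (D x)) = adj ip D (D (b x))" for b x
  proof -
    note bb = M_bop[OF b(1)]
    have "b (g x) = g (b x)" for x by (simp add: gx t_def bop_diff[OF bb] bop_scale[OF bb] b)
    then have "b (y x) = y (b x)" for x by (rule y(5)[OF b(1)])
    then have "b (z x) = z (b x)" for x by (rule z(4)[OF b(1)])
    then show ?thesis by (simp add: cx bop_diff[OF bb] bop_scale[OF bb])
  qed
  ultimately show ?thesis using cM by (intro bexI[of _ c]) auto
qed

text \<open>The vectors killed by \<open>A z\<close> for all \<open>z\<close> in \<open>M\<close>
  form a closed subspace invariant under \<open>M\<close> and under its commutant, so its projection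
  is central, hence scalar. If \<open>A z B\<close> always vanished, it would contain
  \<open>B b\<close>, thus be everything, and \<open>A\<close> would be zero.\<close>

lemma factor_prime:
  assumes fac: "M \<inter> commutant sc ip M = {T. \<exists>c. T = (\<lambda>x. sc c x)}"
    and A: "A \<in> M" "A a \<noteq> 0" and B: "B \<in> M" "B b \<noteq> 0"
  shows "\<exists>z\<in>M. \<exists>x. A (z (B x)) \<noteq> 0"
proof (rule ccontr)
  assume "\<not> ?thesis"
  then have no: "A (z (B x)) = 0" if "z \<in> M" for z x using that by blast
  define K where "K = {x. \<forall>T\<in>{A \<circ> z |z. z \<in> M}. T x = 0}"
  have K: "closed_subspace K"
    unfolding K_def by (rule closed_subspace_kernel) (auto intro: bop_comp M_bop A)
  have Kx: "x \<in> K \<longleftrightarrow> (\<forall>z\<in>M. A (z x) = 0)" for x by (auto simp: K_def)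
  have P1: "proj_on K \<in> M"
  proof (rule proj_on_M[OF K])
    fix T x assume T: "T \<in> commutant sc ip M" and x: "x \<in> K"
    have "A (z (T x)) = 0" if z: "z \<in> M" for z
    proof -
      have "A (z (T x)) = T (A (z x))" using M_commute[OF z T] M_commute[OF A(1) T] by simp
      then show ?thesis using x z bop_0[OF commutantD(1)[OF T]] by (simp add: Kx)
    qed
    then show "T x \<in> K" by (simp add: Kx)
  qed
  have inv: "T x \<in> K" if T: "T \<in> M" and x: "x \<in> K" for T x
    unfolding Kx
  proof
    fix z assume "z \<in> M"
    then have "A ((z \<circ> T) x) = 0" using x M_comp[OF _ T] unfolding Kx by blast
    then show "A (z (T x)) = 0" by simp
  qed
  have "proj_on K \<in> commutant sc ip M"
  proof (rule commutantI)
    show "bop (proj_on K)" using bop_proj_on K by blast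
    fix T x assume T: "T \<in> M"
    show "proj_on K (T x) = T (proj_on K x)"
      using proj_on_commute[OF K M_bop[OF T]] inv[OF T] inv[OF M_adj[OF T]] by blast
  qed
  then have "proj_on K \<in> {T. \<exists>c. T = (\<lambda>x. sc c x)}" using P1 fac by blast
  then obtain c where "proj_on K = (\<lambda>x. sc c x)" by blast
  then have c: "proj_on K x = sc c x" for x by simp
  have "B b \<in> K" using no by (simp add: Kx)
  then have "sc c (B b) = B b" using proj_on_id[OF K] c by simp
  then have "sc (c - 1) (B b) = 0" by (simp add: scale_left_diff_distrib)
  then have "c = 1" using B(2) by simp
  then have "a \<in> K" using proj_on(1)[OF K, of a] c by simp
  then have "A (id a) = 0" using M_id unfolding Kx by blast
  then show False using A(2) by simp
qed

text \<open>Along the chain, \<open>v n x - v m x\<close> is orthogonal to \<open>v m x\<close>, so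
  squared distances are differences of squared norms and \<open>v n\<close> converges strongly. The
  initial projections are followed only weakly, which is the convergence that normality of the trace
  asks for.\<close>

lemma partial_isometry_limit_exists:
  fixes v :: "nat \<Rightarrow> 'h \<Rightarrow> 'h"
  assumes v: "\<And>n. v n \<in> M" and p_def: "\<And>n x. p n x = adj ip (v n) (v n x)"
    and ext: "\<And>m n x. m \<le> n \<Longrightarrow> v n (p m x) = v m x" "\<And>m n x. m \<le> n \<Longrightarrow> p n (p m x) = p m x"
  shows "\<exists>u\<in>M. (\<forall>x. adj ip u (u (adj ip u (u x))) = adj ip u (u x)) \<and>
     (\<forall>n x. u (p n x) = v n x) \<and> (\<forall>n x. adj ip u (u (p n x)) = p n x) \<and>
     (\<forall>x. nrm (adj ip u (u x)) \<le> nrm x) \<and> (\<forall>n x. nrm (p n x) \<le> nrm x) \<and>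
     (\<forall>z x. (\<lambda>n. ip z (p n x)) \<longlonglongrightarrow> ip z (adj ip u (u x)))"
proof -
  note vb = M_bop[OF v]
  have vv: "ip (v n x) (v n y) = ip x (p n y)" for n x y by (simp add: p_def adj_right[OF vb])
  have ps: "ip (p n x) y = ip x (p n y)" for n x y
    by (simp add: p_def adj[OF vb] adj_right[OF vb])
  have vn: "(nrm (v n x))\<^sup>2 = (nrm (p n x))\<^sup>2" for n x
    by (simp add: nrm_sq vv ps ext(2))
  have nvp: "nrm (v n x) = nrm (p n x)" for n x using vn[of n x] by simp
  have pc: "nrm (p n x) \<le> nrm x" for n x
  proof -
    have "nrm (p n x) * nrm (p n x) = Re (ip x (p n x))"
      using nrm_sq[of "p n x"] by (simp add: power2_eq_square ps ext(2))
    also have "\<dots> \<le> nrm x * nrm (p n x)" using cauchy_schwarz complex_Re_le_cmod order_trans by blast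
    finally show ?thesis
      by (cases "nrm (p n x) = 0") (use nrm_nonneg[of "p n x"] in \<open>auto simp: mult_le_cancel_right\<close>)
  qed
  have vc: "nrm (v n x) \<le> nrm x" for n x using pc[of n x] by (simp add: nvp)
  have dom: "(nrm (v n x - v m x))\<^sup>2 = (nrm (v n x))\<^sup>2 - (nrm (v m x))\<^sup>2" if mn: "m \<le> n" for m n x
  proof -
    have 1: "ip (v n x) (v m x) = ip (v m x) (v m x)"
      using vv[of n x "p m x"] vv[of m x x] ext[OF mn] by simp
    then have 2: "ip (v m x) (v n x) = ip (v m x) (v m x)" by (metis ip_commute)
    show ?thesis by (simp add: nrm_sq ip_simps 1 2)
  qed
  have "\<exists>L. tends (\<lambda>n. v n x) L" for x
  proof (rule tends_if_dominated[where a = "\<lambda>n. (nrm (v n x))\<^sup>2" and B = "(nrm x)\<^sup>2"])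
    show "(nrm (v n x - v m x))\<^sup>2 \<le> (nrm (v n x))\<^sup>2 - (nrm (v m x))\<^sup>2" if "m \<le> n" for m n
      using dom[OF that] by simp
    show "incseq (\<lambda>n. (nrm (v n x))\<^sup>2)"
    proof (rule incseq_SucI)
      show "(nrm (v n x))\<^sup>2 \<le> (nrm (v (Suc n) x))\<^sup>2" for n
        using dom[of n "Suc n" x] zero_le_power2[of "nrm (v (Suc n) x - v n x)"] by simp
    qed
    show "(nrm (v n x))\<^sup>2 \<le> (nrm x)\<^sup>2" for n using vc by (intro power_mono) auto
  qed
  then obtain u where u: "\<And>x. tends (\<lambda>n. v n x) (u x)" by metis
  have uc: "nrm (u x) \<le> nrm x" for x
    by (rule LIMSEQ_le_const2[OF tends_nrm[OF u]]) (use vc in blast)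
  have ub: "bop u"
  proof (rule bopI)
    show "nrm (u x) \<le> 1 * nrm x" for x using uc by simp
    show "u (x + y) = u x + u y" for x y
      using tends_unique[OF u[of "x + y"]] tends_add[OF u[of x] u[of y]] by (simp add: bop_add[OF vb])
    show "u (sc c x) = sc c (u x)" for c x
      using tends_unique[OF u[of "sc c x"]] tends_bop[OF bop_sc u[of x]] by (simp add: bop_scale[OF vb])
  qed
  have uM: "u \<in> M" using M_limit[OF ub v u] .
  define P where "P x = adj ip u (u x)" for x
  have uu: "ip (u x) (u y) = ip x (P y)" for x y by (simp add: P_def adj_right[OF ub])
  have lim: "(\<lambda>n. ip z (p n x)) \<longlonglongrightarrow> ip z (P x)" for z x
    using tends_ip[OF u[of z] u[of x]] by (simp add: vv uu)
  have up: "u (p n x) = v n x" for n x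
  proof -
    have "tends (\<lambda>k. v (k + n) (p n x)) (u (p n x))"
      using u[of "p n x"] unfolding tends_def by (rule LIMSEQ_ignore_initial_segment)
    then have "tends (\<lambda>k. v n x) (u (p n x))" by (simp add: ext(1))
    then show ?thesis using tends_unique tends_const by blast
  qed
  have Pp: "P (p n x) = p n x" for n x
  proof (rule ip_ext)
    fix z
    have "(\<lambda>k. ip z (p (k + n) (p n x))) \<longlonglongrightarrow> ip z (P (p n x))"
      by (rule LIMSEQ_ignore_initial_segment[OF lim])
    then show "ip z (P (p n x)) = ip z (p n x)" by (simp add: ext(2) LIMSEQ_const_iff)
  qed
  have Ps: "ip (P x) y = ip x (P y)" for x y by (simp add: P_def adj[OF ub] adj_right[OF ub])
  \<comment> \<open>The adjoint form of \<open>Pp\<close>. It shows that \<open>p n (P x)\<close>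
    has the weak limits \<open>P (P x)\<close> and \<open>P x\<close>, which makes \<open>P\<close>
    idempotent.\<close>
  have pP: "p n (P x) = p n x" for n x
    by (rule ip_ext) (simp add: ps[symmetric] Ps[symmetric] Pp)
  have PP: "P (P x) = P x" for x
  proof (rule ip_ext)
    fix z
    show "ip z (P (P x)) = ip z (P x)" using LIMSEQ_unique[OF lim[of z "P x"]] lim[of z x] by (simp add: pP)
  qed
  have "nrm (P x) \<le> nrm x" for x
    using adj_nrm[OF ub, of 1 "u x"] uc order_trans[OF _ uc[of x]] by (simp add: P_def)
  then show ?thesis using uM PP up Pp pc lim unfolding P_def by (intro bexI[of _ u]) simp_all
qed

end

text \<open>Additive maps form a ring, whereas composition of arbitrary functions is not distributive over
  pointwise addition. Moving \<open>M\<close> into this type makes ring arithmetic available without side conditions.\<close>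

typedef (overloaded) 'h endo = "{f :: 'h::ab_group_add \<Rightarrow> 'h. \<forall>x y. f (x + y) = f x + f y}"
  morphisms app Endo
  by (rule exI[of _ id]) simp

setup_lifting type_definition_endo

instantiation endo :: (ab_group_add) "{ring, monoid_mult}"
begin

lift_definition zero_endo :: "'a endo" is "\<lambda>x. 0" by simp
lift_definition one_endo :: "'a endo" is "\<lambda>x. x" by simp
lift_definition plus_endo :: "'a endo \<Rightarrow> 'a endo \<Rightarrow> 'a endo" is "\<lambda>f g x. f x + g x"
  by (simp add: algebra_simps)
lift_definition minus_endo :: "'a endo \<Rightarrow> 'a endo \<Rightarrow> 'a endo" is "\<lambda>f g x. f x - g x"
  by (simp add: algebra_simps)
lift_definition uminus_endo :: "'a endo \<Rightarrow> 'a endo" is "\<lambda>f x. - f x"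
  by (simp add: algebra_simps)
lift_definition times_endo :: "'a endo \<Rightarrow> 'a endo \<Rightarrow> 'a endo" is "\<lambda>f g x. f (g x)"
  by simp

instance
  by standard (transfer; simp add: fun_eq_iff algebra_simps)+

end

section \<open>The ring of a type II1 factor\<close>

lemma (in hilbert_space) module_op_scale: "module (op_scale sc)"
  by unfold_locales
    (simp_all add: op_scale_def fun_eq_iff scale_right_distrib scale_left_distrib)

lemma (in hilbert_space) bop_app_Endo: "bop T \<Longrightarrow> app (Endo T) = T"
  by (rule Endo_inverse) (simp add: bop_add)

text \<open>The operator statements above become the axioms of \<open>tracial_factor\<close> in the
  ring \<open>endo\<close>; \<open>app_inj\<close> reduces ring identities to identities of
  functions.\<close>

theorem II1_factor_tracial_factor:
  fixes sc :: "complex \<Rightarrow> 'h::ab_group_add \<Rightarrow> 'h" and ip :: "'h \<Rightarrow> 'h \<Rightarrow> complex"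
  assumes II1: "II1_factor sc ip M \<tau>"
  shows "tracial_factor {A. app A \<in> M} (\<lambda>A. Endo (adj ip (app A))) (\<lambda>c. Endo (sc c)) (\<lambda>A. \<tau> (app A))"
proof -
  have vf: "vN_factor sc ip M" and inf: "infinite_dimensional sc M"
    and trace: "faithful_normal_tracial_state sc ip M \<tau>"
    using II1 by (auto simp: II1_factor_def)
  interpret vN_algebra sc ip M
    using II1 by unfold_locales (auto simp: II1_factor_def vN_factor_def)
  have fac: "M \<inter> commutant sc ip M = {T. \<exists>c. T = (\<lambda>x. sc c x)}" using vf by (simp add: vN_factor_def)
  note tr = trace[unfolded faithful_normal_tracial_state_def]
  define N where "N = {A. app A \<in> M}"
  define st where "st = (\<lambda>A. Endo (adj ip (app A)))"
  define io where "io = (\<lambda>c. Endo (sc c))"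
  define t where "t = (\<lambda>A. \<tau> (app A))"
  have NM: "A \<in> N \<longleftrightarrow> app A \<in> M" for A by (simp add: N_def)
  have Nb: "A \<in> N \<Longrightarrow> bop (app A)" for A using M_bop by (simp add: N_def)
  have app_io: "app (io c) = sc c" for c by (simp add: io_def bop_app_Endo bop_sc)
  have app_st: "A \<in> N \<Longrightarrow> app (st A) = adj ip (app A)" for A
    by (simp add: st_def bop_app_Endo bop_adj Nb)
  have app_plus: "app (A + B) = app A + app B" for A B :: "'h endo"
    by (simp add: fun_eq_iff plus_endo.rep_eq)
  have app_times: "app (A * B) = app A \<circ> app B" for A B :: "'h endo"
    by (simp add: fun_eq_iff times_endo.rep_eq)
  have app_one: "app 1 = id" by (simp add: fun_eq_iff one_endo.rep_eq)
  have app_zero: "app 0 = 0" by (simp add: fun_eq_iff zero_endo.rep_eq)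
  have app_inj: "app A = app B \<Longrightarrow> A = B" for A B :: "'h endo" by (simp add: app_inject)
  have sN: "A \<in> N \<Longrightarrow> st A \<in> N" for A by (simp add: NM app_st M_adj)
  have mN: "A \<in> N \<Longrightarrow> B \<in> N \<Longrightarrow> A * B \<in> N" for A B by (simp add: NM app_times M_comp)
  have aN: "A \<in> N \<Longrightarrow> B \<in> N \<Longrightarrow> A + B \<in> N" for A B by (simp add: NM app_plus M_plus)
  have iN: "io c \<in> N" for c by (simp add: NM app_io M_sc)
  have ta: "tracial_algebra N st io t"
  proof
    fix A B c d
    show "io (c + d) = io c + io d"
      by (rule app_inj) (simp add: app_io app_plus fun_eq_iff scale_left_distrib)
    show "io (c * d) = io c * io d"
      by (rule app_inj) (simp add: app_io app_times fun_eq_iff)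
    show "io 1 = 1"
      by (rule app_inj) (simp add: app_io app_one fun_eq_iff)
    show "st (io c) = io (cnj c)"
      by (rule app_inj) (simp add: app_io app_st iN adj_sc)
    show "t 1 = 1" using tr by (simp add: t_def app_one)
    assume A: "A \<in> N"
    show "A * io c = io c * A"
      by (rule app_inj) (simp add: app_io app_times fun_eq_iff bop_scale Nb A)
    show "st (st A) = A"
      by (rule app_inj) (simp add: app_st sN A adj_adj Nb)
    have "app (io c * A) = op_scale sc c (app A)" by (simp add: app_io app_times op_scale_def fun_eq_iff)
    then show "t (io c * A) = c * t A" using tr A unfolding t_def by (simp add: NM)
    have sA: "app (st A * A) = adj ip (app A) \<circ> app A" by (simp add: app_times app_st A)
    show "Im (t (st A * A)) = 0" "0 \<le> Re (t (st A * A))" using tr A unfolding t_def sA by (auto simp: NM)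
    show "A = 0" if "t (st A * A) = 0"
    proof (rule app_inj)
      show "app A = app 0" using that tr A unfolding t_def sA by (auto simp: NM app_zero)
    qed
    assume B: "B \<in> N"
    show "st (A + B) = st A + st B"
      by (rule app_inj) (simp add: app_st app_plus adj_plus Nb A B aN)
    show "st (A * B) = st B * st A"
      by (rule app_inj) (simp add: app_st app_times adj_comp Nb A B mN)
    show "t (A + B) = t A + t B" using tr A B unfolding t_def app_plus by (auto simp: NM)
    show "t (A * B) = t (B * A)" using tr A B unfolding t_def app_times by (auto simp: NM)
  qed (simp_all add: aN mN sN iN)
  then interpret ta: tracial_algebra N st io t .
  have "tracial_factor N st io t"
  proof (rule tracial_factor.intro[OF ta], rule tracial_factor_axioms.intro)
    fix V assume V: "V \<in> N"
    obtain r where r: "r \<in> M" "adj ip r = r" "r \<circ> r = r" "r \<circ> app V = app V"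
      "\<And>b. b \<in> M \<Longrightarrow> (\<forall>x. b (app V x) = 0) \<Longrightarrow> (\<forall>x. b (r x) = 0)"
      using range_projection_exists[of "app V"] V by (auto simp: NM)
    have ar: "app (Endo r) = r" using bop_app_Endo M_bop r by blast
    have rN: "Endo r \<in> N" by (simp add: NM ar r)
    have "ta.proj (Endo r)"
      unfolding ta.proj_def
      by (intro conjI rN; rule app_inj) (simp_all add: ar app_st rN app_times r)
    moreover have "Endo r * V = V" by (rule app_inj) (simp add: app_times ar r)
    moreover have "b * Endo r = 0" if "b \<in> N" "b * V = 0" for b
    proof (rule app_inj)
      have "app (b * V) = 0" using that app_zero by simp
      then have "\<forall>x. app b (app V x) = 0" by (simp add: app_times fun_eq_iff)
      then have "\<forall>x. app b (r x) = 0" using r(5) that by (simp add: NM)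
      then show "app (b * Endo r) = app 0" by (simp add: app_times ar app_zero fun_eq_iff)
    qed
    ultimately show "\<exists>r. ta.proj r \<and> r * V = V \<and> (\<forall>b\<in>N. b * V = 0 \<longrightarrow> b * r = 0)" by blast
  next
    fix D assume D: "D \<in> N"
    obtain c where c: "c \<in> M" "adj ip c = c" "\<And>x. c (c (c (c x))) = adj ip (app D) (app D x)"
      "\<And>b x. b \<in> M \<Longrightarrow> (\<forall>x. b (adj ip (app D) (app D x)) = adj ip (app D) (app D (b x))) \<Longrightarrow> b (c x) = c (b x)"
      using fourth_root_exists[of "app D"] D unfolding NM by auto
    have ac: "app (Endo c) = c" using bop_app_Endo M_bop c by blast
    have cN: "Endo c \<in> N" by (simp add: NM ac c)
    show "\<exists>c\<in>N. st c = c \<and> c * c * (c * c) = st D * D \<and> (\<forall>b\<in>N. b * (st D * D) = st D * D * b \<longrightarrow> b * c = c * b)"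
    proof (intro bexI[OF _ cN] conjI ballI impI)
      show "st (Endo c) = Endo c" by (rule app_inj) (simp add: app_st cN ac c)
      show "Endo c * Endo c * (Endo c * Endo c) = st D * D"
        by (rule app_inj) (simp add: app_times ac app_st D fun_eq_iff c)
      fix b assume b: "b \<in> N" "b * (st D * D) = st D * D * b"
      have "app (b * (st D * D)) = app (st D * D * b)" using b by simp
      then have "\<forall>x. app b (adj ip (app D) (app D x)) = adj ip (app D) (app D (app b x))"
        by (simp add: app_times app_st D fun_eq_iff)
      then have "app b (c x) = c (app b x)" for x using c(4) b by (simp add: NM)
      then show "b * Endo c = Endo c * b" by (intro app_inj) (simp add: app_times ac fun_eq_iff)
    qed
  next
    fix A B assume A: "A \<in> N" "A \<noteq> 0" and B: "B \<in> N" "B \<noteq> 0"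
    have nz: "\<exists>x. app C x \<noteq> 0" if "C \<noteq> 0" for C :: "'h endo"
      using that app_inj[of C 0] by (auto simp: app_zero fun_eq_iff)
    obtain a b where "app A a \<noteq> 0" "app B b \<noteq> 0" using nz A B by blast
    then obtain z x where z: "z \<in> M" "app A (z (app B x)) \<noteq> 0"
      using factor_prime[OF fac, of "app A" a "app B" b] A B by (auto simp: NM)
    have az: "app (Endo z) = z" using bop_app_Endo M_bop z by blast
    have "app (A * Endo z * B) x \<noteq> 0" using z by (simp add: app_times az)
    then have "A * Endo z * B \<noteq> 0" by (auto simp: zero_endo.rep_eq)
    then show "\<exists>z\<in>N. A * z * B \<noteq> 0" using z by (intro bexI[of _ "Endo z"]) (simp_all add: NM az)
  next
    fix v :: "nat \<Rightarrow> 'h endo"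
    assume pi: "\<And>n. ta.partial_isometry (v n)" and incr: "\<And>m n. m \<le> n \<Longrightarrow> ta.extends (v n) (v m)"
    have vN: "v n \<in> N" for n using pi ta.partial_isometryD by blast
    define p where "p n = app (st (v n) * v n)" for n
    have px: "p n x = adj ip (app (v n)) (app (v n) x)" for n x
      by (simp add: p_def app_times app_st vN)
    have e: "app (v n) (p m x) = app (v m) x" "p n (p m x) = p m x" if "m \<le> n" for m n x
    proof -
      have "v n * (st (v m) * v m) = v m" "st (v n) * v n * (st (v m) * v m) = st (v m) * v m"
        using incr[OF that] by (auto simp: ta.extends_def)
      then have "app (v n * (st (v m) * v m)) x = app (v m) x"
        "app (st (v n) * v n * (st (v m) * v m)) x = app (st (v m) * v m) x" by simp_all
      then show "app (v n) (p m x) = app (v m) x" "p n (p m x) = p m x"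
        unfolding p_def by (simp_all add: app_times)
    qed
    obtain u where u: "u \<in> M" "\<And>x. adj ip u (u (adj ip u (u x))) = adj ip u (u x)"
      "\<And>n x. u (p n x) = app (v n) x" "\<And>n x. adj ip u (u (p n x)) = p n x"
      "\<And>x. nrm (adj ip u (u x)) \<le> nrm x" "\<And>n x. nrm (p n x) \<le> nrm x"
      "\<And>z x. (\<lambda>n. ip z (p n x)) \<longlonglongrightarrow> ip z (adj ip u (u x))"
      using partial_isometry_limit_exists[of "\<lambda>n. app (v n)" p, OF _ px e] vN unfolding NM by blast
    have au: "app (Endo u) = u" using bop_app_Endo M_bop u by blast
    have uN: "Endo u \<in> N" by (simp add: NM au u)
    define P where "P = app (st (Endo u) * Endo u)"
    have Px: "P x = adj ip u (u x)" for x by (simp add: P_def app_times app_st uN au)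
    have "ta.proj (st (Endo u) * Endo u)"
      unfolding ta.proj_def
    proof (intro conjI)
      show "st (Endo u) * Endo u * (st (Endo u) * Endo u) = st (Endo u) * Endo u"
        by (rule app_inj) (simp add: app_times app_st uN au fun_eq_iff u)
    qed (simp_all add: uN)
    then have "ta.partial_isometry (Endo u)" using uN by (simp add: ta.partial_isometry_def)
    moreover have "ta.extends (Endo u) (v n)" for n
      unfolding ta.extends_def
    proof (intro conjI; rule app_inj; rule ext)
      fix x
      show "app (Endo u * (st (v n) * v n)) x = app (v n) x"
        using u(3)[of n x] by (simp add: app_times[of "Endo u"] au p_def)
      show "app (st (Endo u) * Endo u * (st (v n) * v n)) x = app (st (v n) * v n) x"
        using u(4)[of n x] Px[of "p n x"] by (simp add: app_times[of "st (Endo u) * Endo u"] P_def[symmetric] p_def[symmetric])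
    qed
    moreover have "(\<lambda>n. t (st (v n) * v n)) \<longlonglongrightarrow> t (st (Endo u) * Endo u)"
    proof -
      have PM: "P \<in> M" "p n \<in> M" for n
        using mN[OF sN[OF uN] uN] mN[OF sN[OF vN] vN] unfolding P_def p_def NM by blast+
      have c: "contraction ip P" "contraction ip (p n)" for n
        using u(5,6) by (simp_all add: contraction_def Px)
      \<comment> \<open>Normality is formulated for filters. It is applied to the image of
        \<open>sequentially\<close> under \<open>p\<close>, a sequence of contractions converging
        weakly to \<open>P\<close>.\<close>
      have normal: "\<forall>F x. x \<in> M \<longrightarrow> contraction ip x \<longrightarrow>
        eventually (\<lambda>T. T \<in> M \<and> contraction ip T) F \<longrightarrow>
        (\<forall>\<xi> \<eta>. ((\<lambda>T. ip \<eta> (T \<xi>)) \<longlongrightarrow> ip \<eta> (x \<xi>)) F) \<longrightarrow> (\<tau> \<longlongrightarrow> \<tau> x) F"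
        using tr by blast
      have "(\<tau> \<longlongrightarrow> \<tau> P) (filtermap p sequentially)"
        using PM c u(7) by (intro normal[rule_format]) (auto simp: eventually_filtermap filterlim_filtermap Px)
      then show ?thesis unfolding t_def P_def p_def by (simp add: filterlim_filtermap)
    qed
    ultimately show "\<exists>u. ta.partial_isometry u \<and> (\<forall>n. ta.extends u (v n)) \<and>
        (\<lambda>n. t (st (v n) * v n)) \<longlonglongrightarrow> t (st u * u)" by blast
  next
    fix I :: "('h endo \<times> 'h endo) set" and f
    assume I: "finite I" and f: "\<And>i. i \<in> I \<Longrightarrow> f i \<in> N"
    interpret ops: module "op_scale sc" by (rule module_op_scale)
    let ?B = "(\<lambda>i. app (f i)) ` I"
    have "finite ?B" "?B \<subseteq> M" using I f by (auto simp: NM)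
    then obtain m where m: "m \<in> M" "m \<notin> ops.span ?B" using inf unfolding infinite_dimensional_def by blast
    have am: "app (Endo m) = m" using bop_app_Endo M_bop m by blast
    have "Endo m \<noteq> (\<Sum>i\<in>I. io (c i) * f i)" for c
    proof
      assume eq: "Endo m = (\<Sum>i\<in>I. io (c i) * f i)"
      \<comment> \<open>The sum runs over a subset \<open>J\<close> while the span stays that of the
        whole image, so that the induction on \<open>J\<close> goes through.\<close>
      have "app (\<Sum>i\<in>J. io (c i) * f i) \<in> ops.span ?B" if "J \<subseteq> I" for J
        using finite_subset[OF that I] that
      proof (induction J rule: finite_induct)
        case empty
        then show ?case by (simp only: sum.empty app_zero ops.span_zero)
      next
        case (insert i J)
        have "app (io (c i) * f i) = op_scale sc (c i) (app (f i))"
          by (simp add: app_times app_io op_scale_def fun_eq_iff)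
        then have "app (io (c i) * f i) \<in> ops.span ?B"
          using insert.prems by (simp add: ops.span_scale ops.span_base)
        moreover have "app (\<Sum>i\<in>J. io (c i) * f i) \<in> ops.span ?B" using insert by blast
        ultimately show ?case
          unfolding sum.insert[OF insert.hyps] app_plus by (rule ops.span_add)
      qed
      then have "m \<in> ops.span ?B" using am eq by (metis order_refl)
      then show False using m by blast
    qed
    then show "\<exists>m\<in>N. \<forall>c. m \<noteq> (\<Sum>i\<in>I. io (c i) * f i)"
      using m by (intro bexI[of _ "Endo m"]) (simp_all add: NM am)
  qed
  then show ?thesis by (simp add: N_def st_def io_def t_def)
qed

theorem theoremH:
  fixes sc :: "complex \<Rightarrow> 'h::ab_group_add \<Rightarrow> 'h"
    and ip :: "'h \<Rightarrow> 'h \<Rightarrow> complex"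
    and M :: "('h \<Rightarrow> 'h) set"
    and \<tau> :: "('h \<Rightarrow> 'h) \<Rightarrow> complex"
    and X Y :: "('h \<Rightarrow> 'h) set"
  assumes "II1_factor sc ip M \<tau>"
    and "finite X" and "X \<subseteq> {x \<in> M. \<tau> x = 0}"
    and "finite Y" and "Y \<subseteq> {y \<in> M. \<tau> y = 0}"
  shows "\<exists>u. unitary_in ip M u \<and>
           (\<forall>x\<in>X. \<forall>y\<in>Y. \<tau> (adj ip y \<circ> (u \<circ> x \<circ> adj ip u)) = 0)"
proof -
  interpret vN_algebra sc ip M
    using assms(1) by unfold_locales (auto simp: II1_factor_def vN_factor_def)
  interpret N: tracial_factor "{A. app A \<in> M}" "\<lambda>A. Endo (adj ip (app A))" "\<lambda>c. Endo (sc c)" "\<lambda>A. \<tau> (app A)"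
    using II1_factor_tracial_factor[OF assms(1)] .
  have E: "app (Endo T) = T" if "T \<in> M" for T using that bop_app_Endo M_bop by blast
  have XM: "x \<in> M" if "x \<in> X" for x using that assms by blast
  have YM: "y \<in> M" "\<tau> y = 0" if "y \<in> Y" for y using that assms by blast+
  \<comment> \<open>The inner product of \<open>y\<close> with \<open>u x u^-1\<close> has the
    adjoint of \<open>y\<close> as left factor, whereas the abstract theorem uses the left factor as
    given. Traces of adjoints are conjugates, so trace zero is preserved.\<close>
  define Y' where "Y' = (\<lambda>y. Endo (adj ip y)) ` Y"
  have Y': "finite Y'" "Y' \<subseteq> {A. app A \<in> M}" using assms YM by (auto simp: Y'_def E M_adj)
  have X': "Endo ` X \<subseteq> {A. app A \<in> M}" using XM by (auto simp: E)
  have "\<tau> (app z) = 0" if z: "z \<in> Y'" for z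
  proof -
    obtain y where y: "y \<in> Y" "z = Endo (adj ip y)" using z by (auto simp: Y'_def)
    have "\<tau> (app (Endo (adj ip (app (Endo y))))) = cnj (\<tau> (app (Endo y)))"
      by (rule N.trace_star) (simp add: E YM y)
    then show ?thesis using y by (simp add: E YM)
  qed
  then obtain U where U: "app U \<in> M" "Endo (adj ip (app U)) * U = 1" "U * Endo (adj ip (app U)) = 1"
    "\<And>x z. x \<in> Endo ` X \<Longrightarrow> z \<in> Y' \<Longrightarrow> \<tau> (app (z * (U * x * Endo (adj ip (app U))))) = 0"
    using N.orthogonalizing_unitary[OF finite_imageI[OF assms(2)] X' Y'] by auto
  define u where "u = app U"
  have app_times: "app (A * B) = app A \<circ> app B" for A B :: "'h endo"
    by (simp add: fun_eq_iff times_endo.rep_eq)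
  have app_one: "app (1 :: 'h endo) = id" by (simp add: fun_eq_iff one_endo.rep_eq)
  have su: "app (Endo (adj ip u)) = adj ip u" using E M_adj U by (simp add: u_def)
  have "unitary_in ip M u"
    unfolding unitary_in_def
    using U(1) arg_cong[OF U(2), of app] arg_cong[OF U(3), of app]
    by (simp add: app_times app_one su u_def[symmetric])
  moreover have "\<tau> (adj ip y \<circ> (u \<circ> x \<circ> adj ip u)) = 0" if "x \<in> X" "y \<in> Y" for x y
    using U(4)[of "Endo x" "Endo (adj ip y)"] that XM YM M_adj
    by (simp add: Y'_def app_times E su u_def[symmetric])
  ultimately show ?thesis by blast
qed

end
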